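(* Let $\sigma_1,\sigma_2\in\mathbb{R}$, $s_1=\sigma_1+it$, $s_2=\sigma_2+it$, $T\ge2$, and \[ I^{\Box}(T)=\int_2^T|\zeta_2(s_1,s_2)|^2\,dt. \] Let \[ \zeta_2^{\Box}(\sigma_1,\sigma_2)=\sum_{k=2}^\infty\Bigl(\sum_{\substack{mn=k\\ m<n}}\frac{1}{m^{\sigma_1}n^{\sigma_2}}\Bigr)^2 \] (sum over positive integers $m,n$), a series which converges if and only if $\sigma_2>1/2$ and $\sigma_1+\sigma_2>1$. Then: (i) if $\sigma_2>1$ and $\sigma_1+\sigma_2>2$, $I^{\Box}(T)=\zeta_2^{\Box}(\sigma_1,\sigma_2)T+O(1)$; (ii) if $\sigma_1>1$ and $1/2<\sigma_2\le1$, $I^{\Box}(T)=\zeta_2^{\Box}(\sigma_1,\sigma_2)T+O(T^{2-2\sigma_2+\epsilon})+O(T^{1/2})$ for every sufficiently small $\epsilon>0$; (iii) if $\sigma_1\le1$ and $3/2<\sigma_1+\sigma_2\le2$, $I^{\Box}(T)=\zeta_2^{\Box}(\sigma_1,\sigma_2)T+O(T^{4-2\sigma_1-2\sigma_2+\epsilon})+O(T^{1/2})$ for every sufficiently small $\epsilon>0$; (iv) if $\sigma_1>1$ and $\sigma_2=1/2$, $I^{\Box}(T)\asymp T\log T$.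
   Context: The Euler double zeta-function is $\zeta_2(s_1,s_2)=\sum_{m=1}^\infty m^{-s_1}\sum_{n=1}^\infty (m+n)^{-s_2}$, absolutely convergent for $\Re s_2>1$, $\Re(s_1+s_2)>2$; it continues meromorphically to $\mathbb{C}^2$ and is holomorphic on $\{(s_1,s_2): s_2\neq 1,\ s_1+s_2\notin\{2,1,0,-2,-4,-6,\dots\}\}$. Implied constants are independent of $T$ (they may depend on $\sigma_1,\sigma_2,\epsilon$). *)

theory Defs
  imports "HOL-Complex_Analysis.Complex_Analysis" "HOL-Library.Landau_Symbols"
begin

text \<open>Holomorphy in two complex variables: Frechet differentiability with a
  complex-linear derivative.\<close>

definition holomorphic2_on :: "(complex \<times> complex \<Rightarrow> complex) \<Rightarrow> (complex \<times> complex) set \<Rightarrow> bool"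
  (infixl \<open>holomorphic2'_on\<close> 50) where
  "f holomorphic2_on D \<longleftrightarrow>
     (\<forall>p\<in>D. \<exists>a b. (f has_derivative (\<lambda>(h, k). a * h + b * k)) (at p within D))"

definition double_zeta_series :: "complex \<Rightarrow> complex \<Rightarrow> complex" where
  "double_zeta_series s1 s2 =
     (\<Sum>\<^sub>\<infinity>m\<in>{1::nat..}. of_nat m powr (- s1) * (\<Sum>\<^sub>\<infinity>n\<in>{1::nat..}. of_nat (m + n) powr (- s2)))"

definition double_zeta_dom :: "(complex \<times> complex) set" where
  "double_zeta_dom =
     {(s1, s2). s2 \<noteq> 1 \<and> s1 + s2 \<notin> {2, 1} \<union> range (\<lambda>k::nat. - (2 * of_nat k))}"

definition is_double_zeta_continuation :: "(complex \<times> complex \<Rightarrow> complex) \<Rightarrow> bool" where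
  "is_double_zeta_continuation Z \<longleftrightarrow>
     Z holomorphic2_on double_zeta_dom \<and>
     (\<forall>s1 s2. Re s2 > 1 \<and> Re (s1 + s2) > 2 \<longrightarrow> Z (s1, s2) = double_zeta_series s1 s2)"

text \<open>By the identity theorem the continuation is unique on \<^const>\<open>double_zeta_dom\<close>;
  off that set the value is unspecified.\<close>

definition double_zeta :: "complex \<Rightarrow> complex \<Rightarrow> complex" where
  "double_zeta s1 s2 = (SOME Z. is_double_zeta_continuation Z) (s1, s2)"

definition double_zeta_mean_square :: "real \<Rightarrow> real \<Rightarrow> real \<Rightarrow> real" where
  "double_zeta_mean_square \<sigma>1 \<sigma>2 T =
     integral {2..T} (\<lambda>t. (cmod (double_zeta (Complex \<sigma>1 t) (Complex \<sigma>2 t)))\<^sup>2)"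

definition box_coeff :: "real \<Rightarrow> real \<Rightarrow> nat \<Rightarrow> real" where
  "box_coeff \<sigma>1 \<sigma>2 k =
     (\<Sum>(m, n) \<in> {(m, n). 0 < m \<and> m < n \<and> m * n = k}. 1 / (real m powr \<sigma>1 * real n powr \<sigma>2))"

definition double_zeta_box :: "real \<Rightarrow> real \<Rightarrow> real" where
  "double_zeta_box \<sigma>1 \<sigma>2 = (\<Sum>\<^sub>\<infinity>k\<in>{2..}. (box_coeff \<sigma>1 \<sigma>2 k)\<^sup>2)"

end

theory Submission
  imports Defs
begin

text \<open>
  Euler--Maclaurin summation of the inner sum, to arbitrary order, continues the double
  zeta-function and shows that, for \<open>X \<le> t \<le> 2 * X\<close> and \<open>N\<close> about \<open>X powr (1 + \<delta>)\<close>, it differs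
  by a negative power of \<open>X\<close> from the finite sum over \<open>m < n < N\<close>. That sum is a Dirichlet
  polynomial in \<open>k = m * n\<close>; the divisor bound controls its coefficients, and integrating
  \<open>(k / l) powr (\<i> * t)\<close> termwise gives a diagonal approximating \<open>double_zeta_box\<close> times the
  length of the interval, plus an off-diagonal part estimated by a Hilbert-type inequality.
  Summing over dyadic intervals gives (ii) and (iii); in the region of absolute convergence the
  off-diagonal part is bounded outright, which gives (i).
  On \<open>\<sigma>2 = 1/2\<close> the upper bound needs a Kusmin--Landau estimate to shorten the inner sums to length
  of order \<open>X\<close>; the lower bound comes from pairing with the sum of
  \<open>n powr (- 1/2 - \<i> * t)\<close> over \<open>n \<le> X powr (1/64)\<close>.
\<close>

section \<open>Euler--Maclaurin summation of powers\<close>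

text \<open>Put e = 2 - \<tau> - \<sigma>2 with \<tau> = min \<sigma>1 1; this one parameter carries
  (ii) and (iii) together. The coefficients of the sum over m < n < N add up to at most about N powr
  e, so the off-diagonal part costs N powr (2 * e). With N just above X this stays below the main
  term when e < 1/2, that is, \<sigma>2 > 1/2 in (ii) and \<sigma>1 + \<sigma>2 > 3/2 in (iii). The
  term T powr (1/2) comes from replacing the function by the finite sum: a pointwise error X powr
  (-1/2) on an interval of length X. High order is what allows N as short as X powr (1 + \<delta>):
  each further order gains the square of X / N, a negative power of X. For e = 1/2 the cost N powr
  (2 * e) exceeds X * ln X, and the diagonal series diverges; hence the line \<sigma>2 = 1/2 is
  treated separately, its sums have to be shortened to length about X, and only an order of
  magnitude results.\<close>

lemma poly_antiderivative_exists:
  fixes p :: "real poly"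
  shows "\<exists>q. pderiv q = p"
proof
  let ?q = "\<Sum>i\<le>degree p. monom (coeff p i / real (Suc i)) (Suc i)"
  have "pderiv ?q = (\<Sum>i\<le>degree p. pderiv (monom (coeff p i / real (Suc i)) (Suc i)))"
    using higher_pderiv_sum[of 1 _ "{..degree p}"] by simp
  also have "\<dots> = (\<Sum>i\<le>degree p. monom (coeff p i) i)"
    by (intro sum.cong) (simp_all add: pderiv_monom del: of_nat_Suc)
  finally have "pderiv ?q = (\<Sum>i\<le>degree p. monom (coeff p i) i)" .
  then show "pderiv ?q = p"
    using poly_as_sum_of_monoms by metis
qed

lemma poly_antiderivative_with_value:
  fixes p :: "real poly"
  obtains q where "pderiv q = p" "poly q a = c"
proof -
  obtain q where q: "pderiv q = p" using poly_antiderivative_exists by blast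
  have "pderiv (q + [:c - poly q a:]) = p" "poly (q + [:c - poly q a:]) a = c"
    using q by (simp_all add: pderiv_add pderiv_pCons)
  then show ?thesis using that by blast
qed

text \<open>Kept in \<open>has_integral\<close> form with an arbitrary value \<open>y\<close>, so
  that the result of one integration by parts can be fed into the next.\<close>

lemma poly_by_parts:
  fixes W w :: "real poly" and g g' :: "real \<Rightarrow> complex"
  assumes "pderiv W = w"
    and g: "\<And>v. v \<in> {0..1} \<Longrightarrow> (g has_vector_derivative g' v) (at v)"
    and I: "((\<lambda>v. of_real (poly w v) * g v) has_integral y) {0..1}"
  shows "((\<lambda>v. of_real (poly W v) * g' v) has_integral
     (of_real (poly W 1) * g 1 - of_real (poly W 0) * g 0 - y)) {0..1}"
proof -
  have cg: "continuous_on {0..1} g"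
    using g by (meson continuous_at_imp_continuous_on has_vector_derivative_continuous)
  have dW: "((\<lambda>v. of_real (poly W v) :: complex) has_vector_derivative of_real (poly w v)) (at v)" for v
    using poly_DERIV[of W v] assms(1)
    by (auto simp: has_real_derivative_iff_has_vector_derivative intro: has_vector_derivative_of_real)
  show ?thesis
  proof (rule integration_by_parts[where prod="\<lambda>x y. y * x" and f=g and g'="\<lambda>v. of_real (poly w v)"])
    show "bounded_bilinear (\<lambda>x y :: complex. y * x)"
      by (simp add: bounded_bilinear.flip bounded_bilinear_mult)
    show "continuous_on {0..1} (\<lambda>v. complex_of_real (poly W v))"
      by (intro continuous_intros)
    show "((\<lambda>x. complex_of_real (poly w x) * g x) has_integral
      complex_of_real (poly W 1) * g 1 - complex_of_real (poly W 0) * g 0 -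
      (complex_of_real (poly W 1) * g 1 - complex_of_real (poly W 0) * g 0 - y)) {0..1}"
      using I by simp
  qed (use cg g dW in auto)
qed

lemma poly_eq_const_of_pderiv_0:
  fixes p :: "real poly"
  assumes "pderiv p = 0"
  shows "poly p x = poly p y"
proof -
  have "degree p = 0" using assms by (simp add: pderiv_eq_0_iff)
  then obtain c where "p = [:c:]" by (rule degree_eq_zeroE)
  then show ?thesis by simp
qed

text \<open>The weight is antisymmetric about \<open>1/2\<close>, so that only boundary terms of even
  order occur.\<close>

lemma euler_maclaurin_unit_interval:
  "\<exists>(b :: nat \<Rightarrow> real) (w :: real poly).
     (\<forall>v. poly w (1 - v) = - poly w v) \<and>
     (\<forall>g :: nat \<Rightarrow> real \<Rightarrow> complex.
        (\<forall>k. \<forall>v\<in>{0..1}. (g k has_vector_derivative g (Suc k) v) (at v)) \<longrightarrow>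
        ((\<lambda>v. of_real (poly w v) * g (2 * J + 2) v) has_integral
          ((g 1 0 + g 1 1) / 2 - (g 0 1 - g 0 0)
            - (\<Sum>j=1..J. of_real (b j) * (g (2 * j) 1 - g (2 * j) 0)))) {0..1})"
proof (induction J)
  case 0
  \<comment> \<open>The weight v - 1/2 is the first Bernoulli polynomial; one integration by parts
    against it gives the trapezoidal rule.\<close>
  let ?w = "[:-1/2, 1:] :: real poly"
  have "((\<lambda>v. of_real (poly ?w v) * g 2 v) has_integral
          ((g 1 0 + g 1 1) / 2 - (g 0 1 - g 0 0))) {0..1}"
    if g: "\<forall>k. \<forall>v\<in>{0..1}. (g k has_vector_derivative g (Suc k) v) (at v)"
    for g :: "nat \<Rightarrow> real \<Rightarrow> complex"
  proof -
    have "(g 1 has_integral (g 0 1 - g 0 0)) {0..1}"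
      using g by (intro fundamental_theorem_of_calculus)
        (auto intro: has_vector_derivative_at_within)
    then have I: "((\<lambda>v. of_real (poly [:1:] v) * g 1 v) has_integral (g 0 1 - g 0 0)) {0..1}"
      by simp
    have g1: "(g 1 has_vector_derivative g 2 v) (at v)" if "v \<in> {0..1}" for v
      using g[rule_format, of v 1] that by (simp add: numeral_2_eq_2)
    show ?thesis
      using poly_by_parts[OF _ g1 I, of ?w]
      by (simp add: pderiv_pCons field_simps)
  qed
  then show ?case
    by (intro exI[of _ "\<lambda>_. 0"] exI[of _ ?w]) (auto simp: algebra_simps numeral_2_eq_2)
next
  case (Suc J)
  then obtain b w where odd: "\<And>v. poly w (1 - v) = - poly w v"
    and main: "\<And>g :: nat \<Rightarrow> real \<Rightarrow> complex.
        (\<forall>k. \<forall>v\<in>{0..1}. (g k has_vector_derivative g (Suc k) v) (at v)) \<Longrightarrow>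
        ((\<lambda>v. of_real (poly w v) * g (2 * J + 2) v) has_integral
          ((g 1 0 + g 1 1) / 2 - (g 0 1 - g 0 0)
            - (\<Sum>j=1..J. of_real (b j) * (g (2 * j) 1 - g (2 * j) 0)))) {0..1}"
    by blast
  \<comment> \<open>Each order takes two primitives. Subtracting \<open>c\<close> from the first
    makes the second vanish at 0 and at 1, so the only boundary term left comes from
    \<open>W\<close>, whose two end values agree by symmetry. Hence the new coefficient is
    \<open>poly W 0\<close>.\<close>
  obtain W0 where W0: "pderiv W0 = w" using poly_antiderivative_exists by blast
  obtain V0 where V0: "pderiv V0 = W0" "poly V0 0 = 0"
    by (rule poly_antiderivative_with_value)
  define c where "c = poly V0 1"
  define W where "W = W0 - [:c:]"
  define V where "V = V0 - [:0, c:]"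
  let ?r = "[:1, -1:] :: real poly"
  have pW: "pderiv W = w" and pV: "pderiv V = W"
    by (simp_all add: W_def V_def W0 V0 pderiv_diff pderiv_pCons)
  have V01: "poly V 0 = 0" "poly V 1 = 0" by (simp_all add: V_def V0 c_def)
  have pr: "pderiv (p \<circ>\<^sub>p ?r) = - (pderiv p \<circ>\<^sub>p ?r)" for p :: "real poly"
    by (simp add: pderiv_pcompose pderiv_pCons)
  have evenW: "poly W (1 - v) = poly W v" for v
  proof -
    have "poly (pderiv (W \<circ>\<^sub>p ?r - W)) x = poly 0 x" for x
      using odd by (simp add: pderiv_diff pr pW poly_pcompose)
    then have "pderiv (W \<circ>\<^sub>p ?r - W) = 0"
      using poly_eq_poly_eq_iff by blast
    from poly_eq_const_of_pderiv_0[OF this, of v "1/2"] show ?thesis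
      by (simp add: poly_pcompose)
  qed
  have oddV: "poly V (1 - v) = - poly V v" for v
  proof -
    have "poly (pderiv (V \<circ>\<^sub>p ?r + V)) x = poly 0 x" for x
      using evenW by (simp add: pderiv_add pr pV poly_pcompose)
    then have "pderiv (V \<circ>\<^sub>p ?r + V) = 0"
      using poly_eq_poly_eq_iff by blast
    from poly_eq_const_of_pderiv_0[OF this, of v 0] show ?thesis
      by (simp add: poly_pcompose V01)
  qed
  have W10: "poly W 1 = poly W 0" using evenW[of 0] by simp
  let ?b = "b(Suc J := poly W 0)"
  have "((\<lambda>v. of_real (poly V v) * g (2 * Suc J + 2) v) has_integral
          ((g 1 0 + g 1 1) / 2 - (g 0 1 - g 0 0)
            - (\<Sum>j=1..Suc J. of_real (?b j) * (g (2 * j) 1 - g (2 * j) 0)))) {0..1}"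
    if g: "\<forall>k. \<forall>v\<in>{0..1}. (g k has_vector_derivative g (Suc k) v) (at v)"
    for g :: "nat \<Rightarrow> real \<Rightarrow> complex"
  proof -
    have gk: "\<And>v. v \<in> {0..1} \<Longrightarrow> (g k has_vector_derivative g (Suc k) v) (at v)" for k
      using g by blast
    have s: "(\<Sum>j=1..J. of_real (?b j) * (g (2 * j) 1 - g (2 * j) 0)) =
        (\<Sum>j=1..J. of_real (b j) * (g (2 * j) 1 - g (2 * j) 0))"
      by (intro sum.cong) auto
    have "2 * Suc J + 2 = Suc (Suc (2 * J + 2))" "2 * Suc J = 2 * J + 2" by simp_all
    then show ?thesis
      using poly_by_parts[OF pV gk poly_by_parts[OF pW gk main[OF g]]]
      by (simp add: V01 W10 s algebra_simps)
  qed
  then show ?case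
    using oddV by blast
qed

text \<open>The Euler--Maclaurin value of the sum of k powr (-s) over k \<ge> n, without half the
  first term: the integral from n on, then the corrections of even order. The numbers
  \<open>b j\<close> play the part of the Bernoulli numbers of index 2 * j divided by
  factorials.\<close>

definition em_main :: "nat \<Rightarrow> (nat \<Rightarrow> real) \<Rightarrow> complex \<Rightarrow> nat \<Rightarrow> complex" where
  "em_main J b s n = of_nat n powr (1 - s) / (s - 1)
     + (\<Sum>j=1..J. of_real (b j) * pochhammer s (2 * j - 1) * of_nat n powr (1 - s - of_nat (2 * j)))"

text \<open>The trapezoid over one unit interval minus the decrease of \<open>em_main\<close>.
  Summed over n, the \<open>em_main\<close> part telescopes, and what remains decays faster with
  every order.\<close>

definition em_defect :: "nat \<Rightarrow> (nat \<Rightarrow> real) \<Rightarrow> complex \<Rightarrow> nat \<Rightarrow> complex" where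
  "em_defect J b s n = (of_nat n powr (-s) + of_nat (Suc n) powr (-s)) / 2
     - (em_main J b s n - em_main J b s (Suc n))"

lemma norm_of_nat_powr [simp]: "norm (of_nat n powr (z :: complex)) = real n powr Re z"
  by (simp add: norm_powr_real_powr)

lemma has_vector_derivative_shifted_powr:
  fixes a :: complex
  assumes "0 < x + v"
  shows "((\<lambda>v. of_real (x + v) powr a) has_vector_derivative
           a * of_real (x + v) powr (a - 1)) (at v)"
proof -
  have "((\<lambda>z. z powr a) has_field_derivative a * of_real (x + v) powr (a - 1)) (at (complex_of_real (x + v)))"
    using assms by (intro has_field_derivative_powr) (simp add: complex_nonpos_Reals_iff)
  moreover have "((\<lambda>v. complex_of_real (x + v)) has_vector_derivative 1) (at v)"
    by (auto intro!: derivative_eq_intros)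
  ultimately show ?thesis
    using field_vector_diff_chain_at[of "\<lambda>v. complex_of_real (x + v)" 1 v "\<lambda>z. z powr a"]
    by (simp add: o_def)
qed

text \<open>The unit interval formula is applied to the successive derivatives of (n + v) powr (1 -
  s) / (1 - s); the defect is then the integral of a bounded weight against the derivative of order
  2 * J + 2. The lower bound on Re s makes that derivative largest in modulus at v = 0.\<close>

lemma em_defect_bound_exists:
  "\<exists>b C. 0 \<le> C \<and> (\<forall>s n. s \<noteq> 1 \<longrightarrow> 1 \<le> n \<longrightarrow> - real (2 * J + 1) \<le> Re s \<longrightarrow>
     norm (em_defect J b s n) \<le> C * norm (pochhammer s (2 * J + 1)) * real n powr (- Re s - real (2 * J + 1)))"
proof -
  obtain b w where main: "\<And>g :: nat \<Rightarrow> real \<Rightarrow> complex.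
        (\<forall>k. \<forall>v\<in>{0..1}. (g k has_vector_derivative g (Suc k) v) (at v)) \<Longrightarrow>
        ((\<lambda>v. of_real (poly w v) * g (2 * J + 2) v) has_integral
          ((g 1 0 + g 1 1) / 2 - (g 0 1 - g 0 0)
            - (\<Sum>j=1..J. of_real (b j) * (g (2 * j) 1 - g (2 * j) 0)))) {0..1}"
    using euler_maclaurin_unit_interval[of J] by blast
  have "bounded ((\<lambda>v. poly w v) ` {0..1})"
    by (intro compact_imp_bounded compact_continuous_image continuous_intros) auto
  then obtain C where C: "\<And>v. v \<in> {0..1} \<Longrightarrow> \<bar>poly w v\<bar> \<le> C"
    unfolding bounded_iff by (metis imageI real_norm_def)
  have C0: "0 \<le> C" using C[of 0] by simp
  have "norm (em_defect J b s n) \<le> C * norm (pochhammer s (2 * J + 1)) * real n powr (- Re s - real (2 * J + 1))"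
    if s: "s \<noteq> 1" and n: "1 \<le> n" and re: "- real (2 * J + 1) \<le> Re s" for s n
  proof -
    \<comment> \<open>The chain begins one order below the summand, at its primitive, so that
      \<open>g 1\<close> is the summand itself. The division by 1 - s is why s = 1 is
      excluded.\<close>
    define g where "g k v = (case k of 0 \<Rightarrow> of_real (real n + v) powr (1 - s) / (1 - s)
      | Suc i \<Rightarrow> (-1) ^ i * pochhammer s i * of_real (real n + v) powr (- s - of_nat i))" for k v
    have der: "\<forall>k. \<forall>v\<in>{0..1}. (g k has_vector_derivative g (Suc k) v) (at v)"
    proof (intro allI ballI)
      fix k and v :: real assume "v \<in> {0..1}"
      then have pos: "0 < real n + v" using n by auto
      note d = has_vector_derivative_shifted_powr[OF pos]
      show "(g k has_vector_derivative g (Suc k) v) (at v)"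
      proof (cases k)
        case 0
        have "((\<lambda>v. inverse (1 - s) * of_real (real n + v) powr (1 - s)) has_vector_derivative
               inverse (1 - s) * ((1 - s) * of_real (real n + v) powr (1 - s - 1))) (at v)"
          by (intro has_vector_derivative_mult_right d)
        moreover have "g 0 = (\<lambda>v. inverse (1 - s) * of_real (real n + v) powr (1 - s))"
          by (simp add: fun_eq_iff g_def divide_inverse mult.commute)
        moreover have "g (Suc 0) v = inverse (1 - s) * ((1 - s) * of_real (real n + v) powr (1 - s - 1))"
          using s by (simp add: g_def mult.assoc [symmetric])
        ultimately show ?thesis by (simp only: 0)
      next
        case (Suc i)
        have "((\<lambda>v. ((-1) ^ i * pochhammer s i) * of_real (real n + v) powr (- s - of_nat i))
           has_vector_derivative ((-1) ^ i * pochhammer s i) *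
             ((- s - of_nat i) * of_real (real n + v) powr (- s - of_nat i - 1))) (at v)"
          by (intro has_vector_derivative_mult_right d)
        moreover have "g (Suc i) = (\<lambda>v. ((-1) ^ i * pochhammer s i) * of_real (real n + v) powr (- s - of_nat i))"
          by (simp add: fun_eq_iff g_def)
        moreover have "g (Suc (Suc i)) v = ((-1) ^ i * pochhammer s i) *
             ((- s - of_nat i) * of_real (real n + v) powr (- s - of_nat i - 1))"
          by (simp add: g_def pochhammer_Suc algebra_simps)
        ultimately show ?thesis by (simp only: Suc)
      qed
    qed
    have g01: "g 0 1 = - (of_nat (Suc n) powr (1 - s) / (s - 1))"
      "g 0 0 = - (of_nat n powr (1 - s) / (s - 1))"
      using s by (simp_all add: g_def divide_simps add.commute) (simp_all add: algebra_simps)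
    have g1: "g 1 0 = of_nat n powr (-s)" "g 1 1 = of_nat (Suc n) powr (-s)"
      by (simp_all add: g_def add.commute)
    have g2: "g (2 * j) 0 = - (pochhammer s (2 * j - 1) * of_nat n powr (1 - s - of_nat (2 * j)))"
      "g (2 * j) 1 = - (pochhammer s (2 * j - 1) * of_nat (Suc n) powr (1 - s - of_nat (2 * j)))"
      if j: "j \<in> {1..J}" for j
    proof -
      obtain i where "j = Suc i" using j by (cases j) auto
      have e: "- s - of_nat (2 * i + 1) = 1 - s - of_nat (2 * j)" "2 * j = Suc (2 * i + 1)"
        "2 * j - 1 = 2 * i + 1" using \<open>j = Suc i\<close> by (simp_all add: algebra_simps)
      have "g (2 * j) v = - (pochhammer s (2 * j - 1) * of_real (real n + v) powr (1 - s - of_nat (2 * j)))" for v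
        unfolding e(1) [symmetric] e(3) unfolding e(2) by (simp add: g_def)
      from this[of 0] this[of 1] show "g (2 * j) 0 = - (pochhammer s (2 * j - 1) * of_nat n powr (1 - s - of_nat (2 * j)))"
        "g (2 * j) 1 = - (pochhammer s (2 * j - 1) * of_nat (Suc n) powr (1 - s - of_nat (2 * j)))"
        by (simp_all add: add.commute)
    qed
    have "(\<Sum>j=1..J. of_real (b j) * (g (2 * j) 1 - g (2 * j) 0)) =
      (\<Sum>j=1..J. of_real (b j) * pochhammer s (2 * j - 1) * of_nat n powr (1 - s - of_nat (2 * j))
        - of_real (b j) * pochhammer s (2 * j - 1) * of_nat (Suc n) powr (1 - s - of_nat (2 * j)))"
    proof (rule sum.cong)
      fix j assume "j \<in> {1..J}"
      from g2[OF this] show "of_real (b j) * (g (2 * j) 1 - g (2 * j) 0) =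
         of_real (b j) * pochhammer s (2 * j - 1) * of_nat n powr (1 - s - of_nat (2 * j))
        - of_real (b j) * pochhammer s (2 * j - 1) * of_nat (Suc n) powr (1 - s - of_nat (2 * j))"
        by (simp add: algebra_simps)
    qed simp
    then have eq: "(g 1 0 + g 1 1) / 2 - (g 0 1 - g 0 0)
            - (\<Sum>j=1..J. of_real (b j) * (g (2 * j) 1 - g (2 * j) 0)) = em_defect J b s n"
      unfolding em_defect_def em_main_def g01 g1 sum_subtractf
      by (simp add: algebra_simps del: of_nat_Suc)
    have "norm (em_defect J b s n) \<le>
       C * norm (pochhammer s (2 * J + 1)) * real n powr (- Re s - real (2 * J + 1)) * measure lborel {0..1::real}"
    proof (rule has_integral_bound_real[where S="{}"])
      show "((\<lambda>v. of_real (poly w v) * g (2 * J + 2) v) has_integral em_defect J b s n) {0..1}"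
        using main[OF der] eq by simp
      fix v :: real assume v: "v \<in> {0..1} - {}"
      have "norm (g (2 * J + 2) v) = norm (pochhammer s (2 * J + 1)) * (real n + v) powr (- Re s - real (2 * J + 1))"
        using v by (simp add: g_def norm_mult norm_power norm_powr_real_powr del: of_real_add)
      also have "(real n + v) powr (- Re s - real (2 * J + 1)) \<le> real n powr (- Re s - real (2 * J + 1))"
        using v re n by (intro powr_mono2') auto
      finally have "norm (g (2 * J + 2) v) \<le> norm (pochhammer s (2 * J + 1)) * real n powr (- Re s - real (2 * J + 1))"
        by (simp add: mult_left_mono)
      then have "\<bar>poly w v\<bar> * norm (g (2 * J + 2) v) \<le> C * (norm (pochhammer s (2 * J + 1)) * real n powr (- Re s - real (2 * J + 1)))"
        using C v C0 by (intro mult_mono) auto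
      then show "norm (of_real (poly w v) * g (2 * J + 2) v) \<le> C * norm (pochhammer s (2 * J + 1)) * real n powr (- Re s - real (2 * J + 1))"
        by (simp add: norm_mult)
    qed (use C0 in auto)
    then show ?thesis by simp
  qed
  with C0 show ?thesis by blast
qed

text \<open>Mean value theorem for x powr (1 - a) on a unit interval; the intermediate point is at
  most 2 * x, which costs the factor 2 powr a. The right side telescopes, so tails are bounded
  without integrals.\<close>

lemma powr_diff_ge:
  fixes a x :: real
  assumes "1 < a" "1 \<le> x"
  shows "x powr (-a) \<le> 2 powr a / (a - 1) * (x powr (1 - a) - (x + 1) powr (1 - a))"
proof -
  have "\<exists>z>x. z < x + 1 \<and> (x + 1) powr (1 - a) - x powr (1 - a) = (x + 1 - x) * ((1 - a) * z powr (1 - a - 1))"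
    using assms by (intro MVT2) (auto intro!: derivative_eq_intros)
  then obtain z where z: "x < z" "z < x + 1"
    "(x + 1) powr (1 - a) - x powr (1 - a) = (1 - a) * z powr (- a)"
    by auto
  have "x powr (-a) = 2 powr a * (2 * x) powr (-a)"
    using assms by (simp add: powr_mult powr_minus field_simps)
  also have "(2 * x) powr (-a) \<le> z powr (-a)"
    using z assms by (intro powr_mono2') auto
  also have "2 powr a * z powr (-a) = 2 powr a / (a - 1) * ((a - 1) * z powr (-a))"
    using assms by simp
  also have "(a - 1) * z powr (-a) = x powr (1 - a) - (x + 1) powr (1 - a)"
    using z(3) by (simp add: algebra_simps)
  finally show ?thesis by simp
qed

lemma
  fixes a :: real
  assumes a: "1 < a" and N: "1 \<le> N"
  shows summable_powr_tail: "summable (\<lambda>n. real (N + n) powr (-a))"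
    and suminf_powr_tail_le: "(\<Sum>n. real (N + n) powr (-a)) \<le> 2 powr a / (a - 1) * real N powr (1 - a)"
proof -
  let ?f = "\<lambda>n. real (N + n) powr (1 - a)"
  let ?g = "\<lambda>n. 2 powr a / (a - 1) * (?f n - ?f (Suc n))"
  have "filterlim (\<lambda>n. real (N + n)) at_top sequentially"
    using filterlim_tendsto_add_at_top[OF tendsto_const filterlim_real_sequentially, of "real N"] by simp
  then have "?f \<longlonglongrightarrow> 0"
    using a by (intro tendsto_neg_powr) auto
  from sums_mult[OF telescope_sums'[OF this], of "2 powr a / (a - 1)"]
  have g: "?g sums (2 powr a / (a - 1) * real N powr (1 - a))" by simp
  have le: "real (N + n) powr (-a) \<le> ?g n" for n
    using powr_diff_ge[OF a, of "real (N + n)"] N by (simp add: add_ac)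
  show s: "summable (\<lambda>n. real (N + n) powr (-a))"
    by (rule summable_comparison_test'[OF sums_summable[OF g]]) (use le in simp)
  show "(\<Sum>n. real (N + n) powr (-a)) \<le> 2 powr a / (a - 1) * real N powr (1 - a)"
    using suminf_le[OF le s sums_summable[OF g]] sums_unique[OF g] by simp
qed

lemma norm_pochhammer_le: "norm (pochhammer (s :: complex) k) \<le> (norm s + real k) ^ k"
proof (induction k)
  case (Suc k)
  have "norm (pochhammer s (Suc k)) = norm (pochhammer s k) * norm (s + of_nat k)"
    by (simp add: pochhammer_Suc norm_mult)
  also have "\<dots> \<le> (norm s + real k) ^ k * (norm s + real k)"
    using Suc norm_triangle_ineq[of s "of_nat k"] by (intro mult_mono) auto
  also have "\<dots> = (norm s + real k) ^ Suc k" by simp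
  also have "\<dots> \<le> (norm s + real (Suc k)) ^ Suc k"
    by (intro power_mono) auto
  finally show ?case .
qed simp

lemma continuous_on_pochhammer [continuous_intros]:
  fixes f :: "'a :: topological_space \<Rightarrow> complex"
  shows "continuous_on A f \<Longrightarrow> continuous_on A (\<lambda>x. pochhammer (f x) k)"
  by (induction k) (auto simp: pochhammer_Suc intro!: continuous_intros)

lemma holomorphic_on_pochhammer [holomorphic_intros]:
  "f holomorphic_on A \<Longrightarrow> (\<lambda>x. pochhammer (f x) k) holomorphic_on A"
  by (induction k) (auto simp: pochhammer_Suc intro!: holomorphic_intros)

lemma holomorphic_on_em_main:
  "1 \<notin> A \<Longrightarrow> (\<lambda>s. em_main J b s n) holomorphic_on A"
  unfolding em_main_def by (intro holomorphic_intros) auto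

lemma holomorphic_on_em_defect:
  "1 \<notin> A \<Longrightarrow> (\<lambda>s. em_defect J b s n) holomorphic_on A"
  unfolding em_defect_def by (intro holomorphic_intros holomorphic_on_em_main) auto

lemma tendsto_of_nat_powr_0:
  assumes "Re a < 0"
  shows "(\<lambda>n. of_nat (N + n) powr a :: complex) \<longlonglongrightarrow> 0"
proof (rule tendsto_norm_zero_cancel)
  have "filterlim (\<lambda>n. real (N + n)) at_top sequentially"
    using filterlim_tendsto_add_at_top[OF tendsto_const filterlim_real_sequentially, of "real N"] by simp
  then show "(\<lambda>n. norm (of_nat (N + n) powr a :: complex)) \<longlonglongrightarrow> 0"
    using assms unfolding norm_of_nat_powr by (intro tendsto_neg_powr)
qed

lemma tendsto_em_main_0:
  assumes "1 < Re s"
  shows "(\<lambda>n. em_main J b s (N + n)) \<longlonglongrightarrow> 0"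
proof -
  have "(\<lambda>n. of_nat (N + n) powr (1 - s) / (s - 1) + (\<Sum>j=1..J. of_real (b j) * pochhammer s (2 * j - 1)
     * of_nat (N + n) powr (1 - s - of_nat (2 * j)))) \<longlonglongrightarrow>
     0 / (s - 1) + (\<Sum>j=1..J. of_real (b j) * pochhammer s (2 * j - 1) * 0)"
    using assms by (intro tendsto_intros tendsto_of_nat_powr_0) auto
  then show ?thesis by (simp add: em_main_def)
qed

section \<open>Continued tails of the one-variable zeta-function\<close>

locale euler_maclaurin =
  fixes J :: nat and b :: "nat \<Rightarrow> real" and C :: real
  assumes C_nonneg: "0 \<le> C"
    and norm_defect_le: "\<And>s n. s \<noteq> 1 \<Longrightarrow> 1 \<le> n \<Longrightarrow> - real (2 * J + 1) \<le> Re s \<Longrightarrow>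
     norm (em_defect J b s n) \<le> C * norm (pochhammer s (2 * J + 1)) * real n powr (- (Re s + real (2 * J + 1)))"
begin

text \<open>Equal to the sum of n powr (-w) over n \<ge> N when Re w > 1, and its analytic
  continuation to Re w > - 2 * J with the point 1 removed.\<close>

definition zeta_tail :: "complex \<Rightarrow> nat \<Rightarrow> complex" where
  "zeta_tail w N = em_main J b w N + of_nat N powr (-w) / 2 + (\<Sum>n. em_defect J b w (N + n))"

lemma summable_norm_defect:
  assumes "w \<noteq> 1" "- real (2 * J) < Re w" "1 \<le> N"
  shows "summable (\<lambda>n. norm (em_defect J b w (N + n)))"
proof (rule summable_comparison_test')
  show "summable (\<lambda>n. C * norm (pochhammer w (2 * J + 1)) * real (N + n) powr (- (Re w + real (2 * J + 1))))"
    using assms by (intro summable_mult summable_powr_tail) auto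
  show "norm (norm (em_defect J b w (N + n))) \<le> C * norm (pochhammer w (2 * J + 1)) * real (N + n) powr (- (Re w + real (2 * J + 1)))" for n
    using norm_defect_le[of w "N + n"] assms by simp
qed

lemma zeta_tail_sums:
  assumes w: "1 < Re w" and N: "1 \<le> N"
  shows "(\<lambda>n. of_nat (N + n) powr (-w)) sums zeta_tail w N"
proof -
  have "w \<noteq> 1" using w by auto
  define E p d where "E n = em_main J b w (N + n)" and "p n = (of_nat (N + n) powr (-w) :: complex)"
    and "d n = em_defect J b w (N + n)" for n
  have d: "d n = (p n + p (Suc n)) / 2 - (E n - E (Suc n))" for n
    by (simp add: d_def p_def E_def em_defect_def)
  have d2: "2 * d n = p n + p (Suc n) - 2 * (E n - E (Suc n))" for n
    by (simp add: d)
  \<comment> \<open>Everything is doubled so that the induction does not meet the halves of the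
    trapezoidal rule.\<close>
  have eq2: "2 * (\<Sum>i<n. p i) = p 0 - p n + 2 * (\<Sum>i<n. d i) + 2 * (E 0 - E n)" for n
  proof (induction n)
    case (Suc n)
    show ?case unfolding sum.lessThan_Suc distrib_left Suc d2 by (simp add: algebra_simps)
  qed simp
  have eq: "(\<Sum>i<n. p i) = p 0 / 2 - p n / 2 + (\<Sum>i<n. d i) + (E 0 - E n)" for n
  proof -
    have "(\<Sum>i<n. p i) = (2 * (\<Sum>i<n. p i)) / 2" by simp
    then show ?thesis unfolding eq2 by (simp add: add_divide_distrib diff_divide_distrib)
  qed
  have "summable (\<lambda>n. em_defect J b w (N + n))"
    by (rule summable_norm_cancel, rule summable_norm_defect[OF \<open>w \<noteq> 1\<close> _ N]) (use w in simp)
  then have "(\<lambda>n. \<Sum>i<n. d i) \<longlonglongrightarrow> (\<Sum>i. d i)"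
    unfolding d_def by (rule summable_LIMSEQ)
  moreover have p0: "p \<longlonglongrightarrow> 0"
    unfolding p_def by (rule tendsto_of_nat_powr_0) (use w in simp)
  moreover have E0: "E \<longlonglongrightarrow> 0"
    unfolding E_def by (rule tendsto_em_main_0) (use w in simp)
  ultimately have "(\<lambda>n. p 0 / 2 - p n / 2 + (\<Sum>i<n. d i) + (E 0 - E n)) \<longlonglongrightarrow>
     p 0 / 2 - 0 / 2 + (\<Sum>i. d i) + (E 0 - 0)"
    by (intro tendsto_add tendsto_diff tendsto_divide tendsto_const) simp_all
  moreover have "p 0 / 2 - 0 / 2 + (\<Sum>i. d i) + (E 0 - 0) = zeta_tail w N"
    by (simp add: zeta_tail_def p_def d_def E_def)
  ultimately have "p sums zeta_tail w N"
    unfolding sums_def eq by simp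
  then show ?thesis unfolding p_def .
qed

text \<open>Near \<open>w0\<close> both the Pochhammer factor and the exponent vary; giving up the
  margin between \<sigma> and Re w0 yields one power of n for a whole disc, as the M-test
  requires.\<close>

lemma defect_majorant:
  assumes "w0 \<noteq> 1" and sigma: "\<sigma> < Re w0" "- real (2 * J + 1) \<le> \<sigma>"
  shows "\<exists>r>0. \<exists>B\<ge>0. \<forall>w\<in>cball w0 r. w \<noteq> 1 \<and> \<sigma> < Re w \<and>
    (\<forall>n\<ge>1. norm (em_defect J b w n) \<le> B * real n powr (- (\<sigma> + real (2 * J + 1))))"
proof -
  have "open ({w. \<sigma> < Re w} \<inter> - {1})"
    by (intro open_Int open_halfspace_Re_gt) auto
  moreover have "w0 \<in> {w. \<sigma> < Re w} \<inter> - {1}" using assms by auto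
  ultimately obtain r where r: "0 < r" "cball w0 r \<subseteq> {w. \<sigma> < Re w} \<inter> - {1}"
    using open_contains_cball by blast
  have "bounded ((\<lambda>w. pochhammer w (2 * J + 1)) ` cball w0 r)"
    by (intro compact_imp_bounded compact_continuous_image continuous_intros) auto
  then obtain P where P: "\<And>w. w \<in> cball w0 r \<Longrightarrow> norm (pochhammer w (2 * J + 1)) \<le> P"
    unfolding bounded_iff by (metis imageI)
  have P0: "0 \<le> P"
    using P[of w0] r by (meson centre_in_cball less_imp_le norm_ge_zero order_trans)
  have "norm (em_defect J b w n) \<le> (C * P) * real n powr (- (\<sigma> + real (2 * J + 1)))"
    if w: "w \<in> cball w0 r" and n: "1 \<le> n" for w n
  proof -
    have w': "w \<noteq> 1" "\<sigma> < Re w" using w r by auto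
    have "norm (em_defect J b w n) \<le> C * norm (pochhammer w (2 * J + 1)) * real n powr (- (Re w + real (2 * J + 1)))"
      using w' sigma n by (intro norm_defect_le) auto
    also have "\<dots> \<le> C * P * real n powr (- (\<sigma> + real (2 * J + 1)))"
      using P[OF w] P0 C_nonneg w' n by (intro mult_mono powr_mono mult_nonneg_nonneg) auto
    finally show ?thesis .
  qed
  then show ?thesis
    using r C_nonneg P0 by (intro exI[of _ r] conjI exI[of _ "C * P"]) auto
qed

lemma holomorphic_on_zeta_tail:
  assumes "1 \<le> N"
  shows "(\<lambda>w. zeta_tail w N) holomorphic_on ({w. - real (2 * J) < Re w} - {1})"
proof -
  let ?S = "{w. - real (2 * J) < Re w} - {1}"
  have oS: "open ?S" by (intro open_Diff open_halfspace_Re_gt) auto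
  have "(\<lambda>w. \<Sum>n. em_defect J b w (N + n)) holomorphic_on ?S"
  proof (rule holomorphic_uniform_sequence[OF oS])
    show "(\<lambda>w. \<Sum>i<n. em_defect J b w (N + i)) holomorphic_on ?S" for n
      by (intro holomorphic_intros holomorphic_on_em_defect) auto
    fix w0 assume w0: "w0 \<in> ?S"
    \<comment> \<open>Midway between Re w0 and - 2 * J, so that \<sigma> + 2 * J + 1 > 1 still
      holds.\<close>
    define \<sigma> where "\<sigma> = (Re w0 - real (2 * J)) / 2"
    have s: "\<sigma> < Re w0" "- real (2 * J) < \<sigma>" using w0 by (auto simp: \<sigma>_def)
    obtain r B where r: "0 < r" "0 \<le> B" and rB: "\<And>w. w \<in> cball w0 r \<Longrightarrow> w \<noteq> 1 \<and> \<sigma> < Re w"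
      "\<And>w n. w \<in> cball w0 r \<Longrightarrow> 1 \<le> n \<Longrightarrow> norm (em_defect J b w n) \<le> B * real n powr (- (\<sigma> + real (2 * J + 1)))"
      using defect_majorant[of w0 \<sigma>] w0 s by auto
    have "cball w0 r \<subseteq> ?S" using rB(1) s by fastforce
    moreover have "uniform_limit (cball w0 r) (\<lambda>n w. \<Sum>i<n. em_defect J b w (N + i))
        (\<lambda>w. \<Sum>i. em_defect J b w (N + i)) sequentially"
    proof (rule Weierstrass_m_test)
      show "summable (\<lambda>n. B * real (N + n) powr (- (\<sigma> + real (2 * J + 1))))"
        using s assms by (intro summable_mult summable_powr_tail) auto
      show "norm (em_defect J b w (N + n)) \<le> B * real (N + n) powr (- (\<sigma> + real (2 * J + 1)))"
        if "w \<in> cball w0 r" for n w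
        using rB(2)[OF that, of "N + n"] assms by simp
    qed
    ultimately show "\<exists>d>0. cball w0 d \<subseteq> ?S \<and> uniform_limit (cball w0 d) (\<lambda>n w. \<Sum>i<n. em_defect J b w (N + i))
        (\<lambda>w. \<Sum>i. em_defect J b w (N + i)) sequentially"
      using r by blast
  qed
  moreover have "(\<lambda>w. em_main J b w N) holomorphic_on ?S"
    by (rule holomorphic_on_em_main) simp
  moreover have "(\<lambda>w. of_nat N powr (-w) / 2) holomorphic_on ?S"
    by (intro holomorphic_intros) auto
  ultimately show ?thesis
    unfolding zeta_tail_def by (intro holomorphic_on_add)
qed

end

section \<open>Holomorphic functions of two variables\<close>

lemma holomorphic2_onD:
  assumes "f holomorphic2_on U" "open U" "p \<in> U"
  obtains a b where "(f has_derivative (\<lambda>(h, k). a * h + b * k)) (at p)"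
  using assms unfolding holomorphic2_on_def by (metis at_within_open)

lemma holomorphic2_onI:
  assumes "\<And>p. p \<in> U \<Longrightarrow> \<exists>a b. (f has_derivative (\<lambda>(h, k). a * h + b * k)) (at p)"
  shows "f holomorphic2_on U"
  using assms unfolding holomorphic2_on_def by (meson has_derivative_at_withinI)

lemma holomorphic2_on_subset: "f holomorphic2_on U \<Longrightarrow> V \<subseteq> U \<Longrightarrow> f holomorphic2_on V"
  unfolding holomorphic2_on_def by (meson has_derivative_subset subset_eq)

lemma holomorphic2_on_imp_continuous_on: "f holomorphic2_on U \<Longrightarrow> continuous_on U f"
  unfolding holomorphic2_on_def continuous_on_eq_continuous_within
  using has_derivative_continuous by blast

lemma holomorphic2_on_cong:
  assumes "f holomorphic2_on U" "\<And>p. p \<in> U \<Longrightarrow> f p = g p"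
  shows "g holomorphic2_on U"
  unfolding holomorphic2_on_def
proof
  fix p assume p: "p \<in> U"
  then obtain a b where "(f has_derivative (\<lambda>(h, k). a * h + b * k)) (at p within U)"
    using assms(1) unfolding holomorphic2_on_def by blast
  then have "(g has_derivative (\<lambda>(h, k). a * h + b * k)) (at p within U)"
    by (rule has_derivative_transform[rotated 2]) (use p assms(2) in auto)
  then show "\<exists>a b. (g has_derivative (\<lambda>(h, k). a * h + b * k)) (at p within U)"
    by blast
qed

lemma holomorphic2_on_const [intro]: "(\<lambda>_. c) holomorphic2_on U"
proof -
  have "((\<lambda>_. c) has_derivative (\<lambda>(h, k). 0 * h + 0 * k)) (at p within U)" for p :: "complex \<times> complex"
    by (simp add: case_prod_unfold)
  then show ?thesis unfolding holomorphic2_on_def by blast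
qed

lemma holomorphic2_on_fst [intro]: "fst holomorphic2_on U"
proof -
  have "(fst has_derivative (\<lambda>(h, k). 1 * h + 0 * k)) (at p within U)" for p :: "complex \<times> complex"
    using has_derivative_fst[OF has_derivative_ident] by (simp add: case_prod_unfold)
  then show ?thesis unfolding holomorphic2_on_def by blast
qed

lemma holomorphic2_on_snd [intro]: "snd holomorphic2_on U"
proof -
  have "(snd has_derivative (\<lambda>(h, k). 0 * h + 1 * k)) (at p within U)" for p :: "complex \<times> complex"
    using has_derivative_snd[OF has_derivative_ident] by (simp add: case_prod_unfold)
  then show ?thesis unfolding holomorphic2_on_def by blast
qed

lemma holomorphic2_on_add [intro]:
  assumes "f holomorphic2_on U" "g holomorphic2_on U"
  shows "(\<lambda>p. f p + g p) holomorphic2_on U"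
  unfolding holomorphic2_on_def
proof
  fix p assume "p \<in> U"
  then obtain a b c d where "(f has_derivative (\<lambda>(h, k). a * h + b * k)) (at p within U)"
     "(g has_derivative (\<lambda>(h, k). c * h + d * k)) (at p within U)"
    using assms unfolding holomorphic2_on_def by blast
  from has_derivative_add[OF this]
  show "\<exists>a b. ((\<lambda>p. f p + g p) has_derivative (\<lambda>(h, k). a * h + b * k)) (at p within U)"
    by (intro exI[of _ "a + c"] exI[of _ "b + d"]) (simp add: case_prod_unfold algebra_simps)
qed

lemma holomorphic2_on_mult [intro]:
  assumes "f holomorphic2_on U" "g holomorphic2_on U"
  shows "(\<lambda>p. f p * g p) holomorphic2_on U"
  unfolding holomorphic2_on_def
proof
  fix p assume "p \<in> U"
  then obtain a b c d where "(f has_derivative (\<lambda>(h, k). a * h + b * k)) (at p within U)"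
     "(g has_derivative (\<lambda>(h, k). c * h + d * k)) (at p within U)"
    using assms unfolding holomorphic2_on_def by blast
  from has_derivative_mult[OF this]
  show "\<exists>a b. ((\<lambda>p. f p * g p) has_derivative (\<lambda>(h, k). a * h + b * k)) (at p within U)"
    by (intro exI[of _ "f p * c + a * g p"] exI[of _ "f p * d + b * g p"])
       (simp add: case_prod_unfold algebra_simps)
qed

lemma holomorphic2_on_sum [intro]:
  assumes "\<And>i. i \<in> I \<Longrightarrow> f i holomorphic2_on U"
  shows "(\<lambda>p. \<Sum>i\<in>I. f i p) holomorphic2_on U"
  using assms by (induction I rule: infinite_finite_induct) auto

lemma holomorphic2_on_compose:
  assumes "L holomorphic2_on U" "g holomorphic_on A" "open A" "\<And>p. p \<in> U \<Longrightarrow> L p \<in> A"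
  shows "(\<lambda>p. g (L p)) holomorphic2_on U"
  unfolding holomorphic2_on_def
proof
  fix p assume p: "p \<in> U"
  then obtain a b where L: "(L has_derivative (\<lambda>(h, k). a * h + b * k)) (at p within U)"
    using assms unfolding holomorphic2_on_def by blast
  have "(g has_field_derivative deriv g (L p)) (at (L p))"
    using assms p holomorphic_derivI by blast
  from has_derivative_compose[OF L this[unfolded has_field_derivative_def]]
  show "\<exists>a b. ((\<lambda>p. g (L p)) has_derivative (\<lambda>(h, k). a * h + b * k)) (at p within U)"
    by (intro exI[of _ "deriv g (L p) * a"] exI[of _ "deriv g (L p) * b"])
       (simp add: case_prod_unfold algebra_simps)
qed

text \<open>Slicing by complex lines lets Cauchy's inequality and the identity theorem, both
  one-variable results, act on functions of two variables.\<close>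

lemma holomorphic2_on_along_line:
  assumes f: "f holomorphic2_on U" and "\<And>z. z \<in> A \<Longrightarrow> (u1 + v1 * z, u2 + v2 * z) \<in> U"
  shows "(\<lambda>z. f (u1 + v1 * z, u2 + v2 * z)) holomorphic_on A"
proof -
  have "\<exists>f'. ((\<lambda>z. f (u1 + v1 * z, u2 + v2 * z)) has_field_derivative f') (at z within A)"
    if "z \<in> A" for z
  proof -
    let ?l = "\<lambda>z. (u1 + v1 * z, u2 + v2 * z)"
    have "?l z \<in> U" using that assms by blast
    then obtain a b where "(f has_derivative (\<lambda>(h, k). a * h + b * k)) (at (?l z) within U)"
      using f unfolding holomorphic2_on_def by blast
    then have d: "(f has_derivative (\<lambda>(h, k). a * h + b * k)) (at (?l z) within ?l ` A)"
      by (rule has_derivative_subset) (use assms in auto)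
    have "(?l has_derivative (\<lambda>h. (v1 * h, v2 * h))) (at z within A)"
      by (auto intro!: derivative_eq_intros)
    from has_derivative_in_compose[OF this d]
    have "((\<lambda>z. f (?l z)) has_derivative (\<lambda>h. (a * v1 + b * v2) * h)) (at z within A)"
      by (simp add: algebra_simps)
    then show ?thesis unfolding has_field_derivative_def by blast
  qed
  then show ?thesis
    unfolding holomorphic_on_def field_differentiable_def by blast
qed

text \<open>Cauchy's inequality for the slices through \<open>p\<close> in the two coordinate
  directions. The circle has radius r / 2 because \<open>f\<close> is controlled only on the open
  ball; hence the factor 2.\<close>

lemma norm_partial_derivatives_le:
  assumes f: "f holomorphic2_on ball p r" and "0 < r"
    and B: "\<And>q. q \<in> ball p r \<Longrightarrow> norm (f q) \<le> B"
    and d: "(f has_derivative (\<lambda>(h, k). a * h + b * k)) (at p)"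
  shows "norm a \<le> 2 * B / r" "norm b \<le> 2 * B / r"
proof -
  obtain p1 p2 where p: "p = (p1, p2)" by force
  have aux: "norm (a * v1 + b * v2) \<le> 2 * B / r" if v: "norm (v1, v2) = 1" for v1 v2
  proof -
    let ?l = "\<lambda>z. (p1 + v1 * z, p2 + v2 * z)"
    have l: "dist p (?l z) = norm z" for z
    proof -
      have "p - ?l z = (- v1 * z, - v2 * z)" by (simp add: p)
      then have "dist p (?l z) = norm (v1 * z, v2 * z)"
        by (simp add: dist_norm norm_Pair)
      also have "\<dots> = norm (v1, v2) * norm z"
        by (simp add: norm_Pair norm_mult power_mult_distrib real_sqrt_mult
            flip: distrib_right)
      finally show ?thesis using v by simp
    qed
    have hol: "(\<lambda>z. f (?l z)) holomorphic_on ball 0 r"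
      by (rule holomorphic2_on_along_line[OF f]) (use l in auto)
    have "norm ((deriv ^^ 1) (\<lambda>z. f (?l z)) 0) \<le> fact 1 * B / (r / 2) ^ 1"
    proof (rule Cauchy_inequality)
      show "(\<lambda>z. f (?l z)) holomorphic_on ball 0 (r / 2)"
        by (rule holomorphic_on_subset[OF hol]) (use \<open>0 < r\<close> in auto)
      show "continuous_on (cball 0 (r / 2)) (\<lambda>z. f (?l z))"
        by (rule continuous_on_subset[OF holomorphic_on_imp_continuous_on[OF hol]]) (use \<open>0 < r\<close> in auto)
      show "norm (f (?l x)) \<le> B" if "norm (0 - x) = r / 2" for x
        using that \<open>0 < r\<close> l[of x] by (intro B) auto
    qed (use \<open>0 < r\<close> in auto)
    moreover have "deriv (\<lambda>z. f (?l z)) 0 = a * v1 + b * v2"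
    proof (rule DERIV_imp_deriv)
      have lh: "(?l has_derivative (\<lambda>h. (v1 * h, v2 * h))) (at 0)"
        by (auto intro!: derivative_eq_intros)
      have "(f has_derivative (\<lambda>(h, k). a * h + b * k)) (at (?l 0))"
        using d by (simp add: p)
      from has_derivative_compose[OF lh this]
      have "((\<lambda>z. f (?l z)) has_derivative (\<lambda>h. (a * v1 + b * v2) * h)) (at 0)"
        by (simp add: algebra_simps)
      then show "((\<lambda>z. f (?l z)) has_field_derivative (a * v1 + b * v2)) (at 0)"
        unfolding has_field_derivative_def .
    qed
    ultimately show ?thesis by (simp add: mult.commute)
  qed
  show "norm a \<le> 2 * B / r" "norm b \<le> 2 * B / r"
    using aux[of 1 0] aux[of 0 1] by (simp_all add: norm_Pair)
qed

text \<open>The Weierstrass theorem in two variables: the majorant also bounds the partial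
  derivatives on a ball of half the radius, so the differentiated series converge uniformly there
  and the series may be differentiated termwise.\<close>

lemma holomorphic2_on_suminf:
  assumes "open U" and hol: "\<And>n. f n holomorphic2_on U"
    and maj: "\<And>p. p \<in> U \<Longrightarrow> \<exists>r>0. \<exists>M. summable M \<and> (\<forall>n. \<forall>q\<in>ball p r. norm (f n q) \<le> M n)"
  shows "(\<lambda>p. \<Sum>n. f n p) holomorphic2_on U"
proof (rule holomorphic2_onI)
  fix p assume "p \<in> U"
  obtain r0 M where r0: "0 < r0" and M: "summable M" "\<And>n q. q \<in> ball p r0 \<Longrightarrow> norm (f n q) \<le> M n"
    using maj[OF \<open>p \<in> U\<close>] by blast
  obtain r1 where r1: "0 < r1" "ball p r1 \<subseteq> U"
    using \<open>open U\<close> \<open>p \<in> U\<close> open_contains_ball by blast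
  define r where "r = min r0 r1"
  have r: "0 < r" "r \<le> r0" "r \<le> r1" by (simp_all add: r_def r0 r1)
  define S where "S = ball p (r / 2)"
  have ball: "ball q (r / 2) \<subseteq> ball p r" if "q \<in> S" for q
    using that unfolding S_def ball_subset_ball_iff by (simp add: dist_commute)
  have U: "ball p r \<subseteq> U" using r r1 by (meson order_trans subset_ball)
  have SU: "S \<subseteq> U" using U r by (auto simp: S_def)
  define D where "D n q a b \<longleftrightarrow> (f n has_derivative (\<lambda>(h, k). a * h + b * k)) (at q)" for n q a b
  have "\<exists>a b. D n q a b" if q: "q \<in> S" for n q
    unfolding D_def by (rule holomorphic2_onD[OF hol[of n] \<open>open U\<close> subsetD[OF SU q]]) blast
  then have "\<forall>n q. \<exists>a b. q \<in> S \<longrightarrow> D n q a b" by blast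
  then obtain a b where "\<And>n q. q \<in> S \<Longrightarrow> D n q (a n q) (b n q)"
    by metis
  then have ab: "\<And>n q. q \<in> S \<Longrightarrow> (f n has_derivative (\<lambda>(h, k). a n q * h + b n q * k)) (at q)"
    by (simp add: D_def)
  have bnd: "norm (a n q) \<le> 2 * M n / (r / 2)" "norm (b n q) \<le> 2 * M n / (r / 2)" if "q \<in> S" for n q
  proof -
    have "norm (f n x) \<le> M n" if "x \<in> ball q (r / 2)" for x
      using M(2)[of x n] ball[OF \<open>q \<in> S\<close>] that r by (auto simp del: split_paired_All)
    moreover have "f n holomorphic2_on ball q (r / 2)"
      by (rule holomorphic2_on_subset[OF hol]) (rule order_trans[OF ball[OF that] U])
    moreover have "0 < r / 2" using r by simp
    ultimately show "norm (a n q) \<le> 2 * M n / (r / 2)" "norm (b n q) \<le> 2 * M n / (r / 2)"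
      using norm_partial_derivatives_le[OF _ _ _ ab[OF that]] by blast+
  qed
  have sM: "summable (\<lambda>n. 2 * M n / (r / 2))"
    using M(1) by (intro summable_divide summable_mult)
  have ua: "uniform_limit S (\<lambda>n q. \<Sum>i<n. a i q) (\<lambda>q. \<Sum>i. a i q) sequentially"
    and ub: "uniform_limit S (\<lambda>n q. \<Sum>i<n. b i q) (\<lambda>q. \<Sum>i. b i q) sequentially"
    by (rule Weierstrass_m_test[OF bnd(1) sM], assumption) (rule Weierstrass_m_test[OF bnd(2) sM], assumption)
  have summ: "summable (\<lambda>n. f n q)" if "q \<in> S" for q
  proof (rule summable_comparison_test'[OF M(1)])
    show "norm (f n q) \<le> M n" for n
      using that r unfolding S_def by (intro M(2)) auto
  qed
  have pS: "p \<in> S" using r by (simp add: S_def)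
  have "\<exists>g. \<forall>x\<in>S. (\<lambda>n. f n x) sums (g x) \<and>
      (g has_derivative (\<lambda>(h, k). (\<Sum>i. a i x) * h + (\<Sum>i. b i x) * k)) (at x within S)"
  proof (rule has_derivative_series[where f' = "\<lambda>n x (h, k). a n x * h + b n x * k"])
    show "convex S" by (simp add: S_def)
    show "(f n has_derivative (\<lambda>(h, k). a n x * h + b n x * k)) (at x within S)" if "x \<in> S" for n x
      using ab[OF that] by (rule has_derivative_at_withinI)
    show "\<forall>\<^sub>F n in sequentially. \<forall>x\<in>S. \<forall>h.
        norm ((\<Sum>i<n. case h of (h, k) \<Rightarrow> a i x * h + b i x * k) -
          (case h of (h, k) \<Rightarrow> (\<Sum>i. a i x) * h + (\<Sum>i. b i x) * k)) \<le> e * norm h" if "0 < e" for e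
    proof -
      have "\<forall>\<^sub>F n in sequentially. \<forall>x\<in>S. dist (\<Sum>i<n. a i x) (\<Sum>i. a i x) < e / 2"
        "\<forall>\<^sub>F n in sequentially. \<forall>x\<in>S. dist (\<Sum>i<n. b i x) (\<Sum>i. b i x) < e / 2"
        using ua ub that unfolding uniform_limit_iff by (meson half_gt_zero)+
      then show ?thesis
      proof eventually_elim
        case (elim n)
        show ?case
        proof (intro ballI allI)
          fix x and hk :: "complex \<times> complex" assume x: "x \<in> S"
          obtain h k where hk: "hk = (h, k)" by force
          have le: "norm h \<le> norm hk" "norm k \<le> norm hk"
            using norm_fst_le[of h k] norm_snd_le[of k h] by (simp_all add: hk)
          have "(\<Sum>i<n. a i x * h + b i x * k) - ((\<Sum>i. a i x) * h + (\<Sum>i. b i x) * k) =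
             ((\<Sum>i<n. a i x) - (\<Sum>i. a i x)) * h + ((\<Sum>i<n. b i x) - (\<Sum>i. b i x)) * k"
            by (simp add: sum.distrib sum_distrib_left sum_distrib_right algebra_simps)
          also have "norm \<dots> \<le> e / 2 * norm hk + e / 2 * norm hk"
          proof (rule norm_triangle_mono)
            have "norm ((\<Sum>i<n. a i x) - (\<Sum>i. a i x)) \<le> e / 2" "norm ((\<Sum>i<n. b i x) - (\<Sum>i. b i x)) \<le> e / 2"
              using elim x by (simp_all add: dist_norm less_imp_le)
            note * = this
            show "norm (((\<Sum>i<n. a i x) - (\<Sum>i. a i x)) * h) \<le> e / 2 * norm hk"
              unfolding norm_mult by (rule mult_mono[OF *(1) le(1)]) (use \<open>0 < e\<close> in simp_all)
            show "norm (((\<Sum>i<n. b i x) - (\<Sum>i. b i x)) * k) \<le> e / 2 * norm hk"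
              unfolding norm_mult by (rule mult_mono[OF *(2) le(2)]) (use \<open>0 < e\<close> in simp_all)
          qed
          finally show "norm ((\<Sum>i<n. case hk of (h, k) \<Rightarrow> a i x * h + b i x * k) -
            (case hk of (h, k) \<Rightarrow> (\<Sum>i. a i x) * h + (\<Sum>i. b i x) * k)) \<le> e * norm hk"
            by (simp add: hk)
        qed
      qed
    qed
    show "p \<in> S" by fact
    show "(\<lambda>n. f n p) sums (\<Sum>n. f n p)" using summ[OF pS] by (rule summable_sums)
  qed
  then obtain g where g0: "\<forall>x\<in>S. (\<lambda>n. f n x) sums (g x) \<and>
      (g has_derivative (\<lambda>(h, k). (\<Sum>i. a i x) * h + (\<Sum>i. b i x) * k)) (at x within S)"
    by (rule exE)
  have g: "(\<Sum>n. f n x) = g x" if "x \<in> S" for x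
    using bspec[OF g0 that, THEN conjunct1] by (rule sums_unique [symmetric])
  have "((\<lambda>q. \<Sum>n. f n q) has_derivative (\<lambda>(h, k). (\<Sum>i. a i p) * h + (\<Sum>i. b i p) * k)) (at p within S)"
  proof (rule has_derivative_transform[of p S "\<lambda>q. \<Sum>n. f n q" g])
    show "(g has_derivative (\<lambda>(h, k). (\<Sum>i. a i p) * h + (\<Sum>i. b i p) * k)) (at p within S)"
      using bspec[OF g0 pS] by (rule conjunct2)
  qed (use pS g in simp_all)
  moreover have "at p within S = at p"
    by (rule at_within_open[OF pS]) (simp add: S_def)
  ultimately show "\<exists>a b. ((\<lambda>q. \<Sum>n. f n q) has_derivative (\<lambda>(h, k). a * h + b * k)) (at p)"
    by (intro exI) simp
qed

section \<open>The domain of holomorphy and the uniqueness of the continuation\<close>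

lemma open_double_zeta_dom: "open double_zeta_dom"
proof -
  let ?E = "{2, 1} \<union> range (\<lambda>k::nat. - (2 * of_nat k)) :: complex set"
  have "?E \<subseteq> \<int>" by auto
  then have "closed ?E" by (rule closed_subset_Ints)
  then have "closed ((\<lambda>p. fst p + snd p) -` ?E)"
    by (rule closed_vimage) (intro continuous_intros)
  moreover have "closed (snd -` {1 :: complex} :: (complex \<times> complex) set)"
    by (intro closed_vimage continuous_intros closed_singleton)
  ultimately have "open (- ((\<lambda>p. fst p + snd p) -` ?E) \<inter> - (snd -` {1}))"
    by blast
  also have "- ((\<lambda>p. fst p + snd p) -` ?E) \<inter> - (snd -` {1}) = double_zeta_dom"
    by (auto simp: double_zeta_dom_def)
  finally show ?thesis .
qed

text \<open>For v = 0 the map is constant with value u outside E, so the preimage is empty;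
  otherwise the map is injective.\<close>

lemma countable_affine_preimage:
  fixes u v :: complex
  assumes "countable E" "u \<notin> E"
  shows "countable {z. u + v * z \<in> E}"
proof (cases "v = 0")
  case False
  have "{z. u + v * z \<in> E} \<subseteq> (\<lambda>e. (e - u) / v) ` E"
    using False by (auto simp: image_iff field_simps intro!: bexI[of _ "u + v * _"])
  then show ?thesis using assms(1) by (meson countable_image countable_subset)
qed (use assms in simp)

text \<open>On the complex line through \<open>p\<close> and \<open>(2, 2)\<close> the excluded set is countable, so
  that the one-variable identity theorem applies.\<close>

lemma double_zeta_dom_identity:
  assumes Z: "Z holomorphic2_on V" and W: "W holomorphic2_on V"
    and V: "V = double_zeta_dom \<inter> {p. c < Re (snd p) \<and> c < Re (fst p + snd p)}" and "c < 2"
    and eq: "\<And>s1 s2. 1 < Re s2 \<Longrightarrow> 2 < Re (s1 + s2) \<Longrightarrow> Z (s1, s2) = W (s1, s2)"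
    and p: "p \<in> V"
  shows "Z p = W p"
proof -
  obtain p1 p2 where pp: "p = (p1, p2)" by force
  define E where "E = {2, 1} \<union> range (\<lambda>k::nat. - (2 * of_nat k) :: complex)"
  have dom: "q \<in> double_zeta_dom \<longleftrightarrow> snd q \<noteq> 1 \<and> fst q + snd q \<notin> E" for q
    by (simp add: double_zeta_dom_def case_prod_unfold E_def)
  \<comment> \<open>The parametrisation has \<open>l 0 = p\<close> and
    \<open>l 1 = (2, 2)\<close>.\<close>
  define l where "l z = (p1 + (2 - p1) * z, p2 + (2 - p2) * z)" for z
  define u v where "u = p1 + p2" and "v = 4 - p1 - p2"
  have l12: "fst (l z) = (u + v * z) - (p2 + (2 - p2) * z)" "snd (l z) = p2 + (2 - p2) * z" for z
    by (simp_all add: l_def u_def v_def algebra_simps)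
  \<comment> \<open>\<open>H\<close> is convex and \<open>T\<close> is countable, so the open set
    \<open>A = H - T\<close> is connected.\<close>
  define H where "H = {z. c < Re (p2 + (2 - p2) * z)} \<inter> {z. c < Re (u + v * z)}"
  define T where "T = {z. u + v * z \<in> E} \<union> {z. p2 + (2 - p2) * z \<in> {1}}"
  define A where "A = H - T"
  have pd: "p2 \<noteq> 1" "u \<notin> E" "c < Re p2" "c < Re u"
    using p unfolding V Int_iff mem_Collect_eq dom by (simp_all add: pp u_def)
  have A: "z \<in> A \<longleftrightarrow> l z \<in> V" for z
    unfolding A_def H_def T_def V Int_iff Diff_iff Un_iff mem_Collect_eq dom l12
      diff_add_cancel singleton_iff
    by blast
  have "open {p :: complex \<times> complex. c < Re (snd p)}"
    by (rule open_Collect_less) (intro continuous_intros)+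
  moreover have "open {p :: complex \<times> complex. c < Re (fst p + snd p)}"
    by (rule open_Collect_less) (intro continuous_intros)+
  ultimately have oV: "open V"
    unfolding V Collect_conj_eq by (intro open_Int open_double_zeta_dom)
  have cl: "continuous_on UNIV (\<lambda>z. l z)" unfolding l_def
    by (intro continuous_on_Pair continuous_on_add continuous_on_mult continuous_on_const continuous_on_id)
  have "A = l -` V" by (rule set_eqI) (simp only: A vimage_eq)
  then have oA: "open A" by (simp only: open_vimage[OF oV cl])
  have half: "{z. d < Re (x + y * z)} = {z. inner (cnj y) z > d - Re x}" for d x y
    by (rule Collect_cong) (simp add: inner_complex_def, linarith)
  have oH: "open H" unfolding H_def half
    by (intro open_Int open_halfspace_gt)
  have cH: "convex H" unfolding H_def half
    by (intro convex_Int convex_halfspace_gt)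
  have "countable T" unfolding T_def
    using pd by (intro countable_Un countable_affine_preimage) (simp_all add: E_def)
  then have conA: "connected A"
    unfolding A_def using oH cH
    by (intro connected_open_diff_countable) (auto intro: convex_connected)
  have hol: "(\<lambda>z. F (l z)) holomorphic_on A" if "F holomorphic2_on V" for F
    unfolding l_def by (rule holomorphic2_on_along_line[OF that]) (use A in \<open>auto simp: l_def\<close>)
  \<comment> \<open>The part of the line inside the region where the two functions agree by
    hypothesis. It contains z = 1, since 2 + 2 is not an excluded value.\<close>
  define B where "B = {z. 1 < Re (p2 + (2 - p2) * z)} \<inter> {z. 2 < Re (u + v * z)} \<inter> A"
  have oB: "open B" unfolding B_def half
    by (intro open_Int oA open_halfspace_gt)
  have "l 1 = (2, 2)" by (simp add: l_def)
  moreover have "(2 + 2 :: complex) \<notin> E"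
    by (auto simp: E_def complex_eq_iff)
  then have "(2, 2) \<in> V" using \<open>c < 2\<close>
    unfolding V Int_iff mem_Collect_eq dom by simp
  ultimately have "1 \<in> A" using A by simp
  then have B1: "1 \<in> B"
    by (simp add: B_def u_def v_def)
  have 0: "0 \<in> A" using A[of 0] p by (simp add: l_def pp)
  have "Z (l 0) - W (l 0) = 0"
  proof (rule analytic_continuation_open[of B A "\<lambda>z. Z (l z) - W (l z)" "\<lambda>_. 0" 0])
    fix z assume z: "z \<in> B"
    have "Z (fst (l z), snd (l z)) = W (fst (l z), snd (l z))"
      by (rule eq) (use z l12 in \<open>auto simp: B_def\<close>)
    then show "Z (l z) - W (l z) = 0" by simp
  next
    show "(\<lambda>z. Z (l z) - W (l z)) holomorphic_on A"
      by (intro holomorphic_on_diff hol Z W)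
    show "B \<noteq> {}" using B1 by blast
    show "B \<subseteq> A" by (auto simp: B_def)
  qed (use oB oA conA 0 in auto)
  then show ?thesis by (simp add: l_def pp)
qed

section \<open>Continuation of the double zeta-function\<close>

text \<open>Interchange of a triangular double sum. The partial sums of the two sides differ by a
  partial sum of \<open>x\<close> times a tail of \<open>y\<close>, which a tail of the weighted
  series dominates. Applied to the defects, it turns a sum over m of tails into a series of single
  defects weighted by partial sums over m, the form in which holomorphy is proved.\<close>

lemma triangle_sums:
  fixes x y :: "nat \<Rightarrow> complex"
  assumes y: "summable (\<lambda>k. norm (y k))"
    and xy: "summable (\<lambda>k. norm (y k) * (\<Sum>i\<le>k. norm (x i)))"
  shows "(\<lambda>i. x i * (\<Sum>n. y (i + n))) sums (\<Sum>k. y k * (\<Sum>i\<le>k. x i))"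
proof -
  define Y where "Y i = (\<Sum>n. y (i + n))" for i
  have sy: "summable (\<lambda>n. norm (y (i + n)))" for i
    using summable_ignore_initial_segment[OF y, of i] by (simp add: add.commute)
  have sxy: "summable (\<lambda>n. norm (y (i + n)) * (\<Sum>j\<le>i + n. norm (x j)))" for i
    using summable_ignore_initial_segment[OF xy, of i] by (simp add: add.commute)
  have Y: "Y i = y i + Y (Suc i)" for i
    using suminf_split_head[OF summable_norm_cancel[OF sy], of i] by (simp add: Y_def)
  have eq: "(\<Sum>i<K. x i * Y i) = (\<Sum>k<K. y k * (\<Sum>i\<le>k. x i)) + (\<Sum>i<K. x i) * Y K" for K
  proof (induction K)
    case (Suc K)
    have "(\<Sum>i\<le>K. x i) = (\<Sum>i<K. x i) + x K" by (simp add: lessThan_Suc_atMost [symmetric])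
    with Suc show ?case by (simp add: Y[of K] algebra_simps)
  qed simp
  have le: "norm ((\<Sum>i<K. x i) * Y K) \<le> (\<Sum>n. norm (y (n + K)) * (\<Sum>j\<le>n + K. norm (x j)))" for K
  proof -
    have "norm (Y K) \<le> (\<Sum>n. norm (y (K + n)))"
      unfolding Y_def by (rule summable_norm[OF sy])
    moreover have "norm (\<Sum>i<K. x i) \<le> (\<Sum>i<K. norm (x i))" by (rule norm_sum)
    ultimately have "norm ((\<Sum>i<K. x i) * Y K) \<le> (\<Sum>i<K. norm (x i)) * (\<Sum>n. norm (y (K + n)))"
      unfolding norm_mult by (intro mult_mono sum_nonneg) auto
    also have "\<dots> = (\<Sum>n. norm (y (K + n)) * (\<Sum>i<K. norm (x i)))"
      using suminf_mult2[OF sy[of K], of "\<Sum>i<K. norm (x i)"] by (simp add: mult.commute)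
    also have "\<dots> \<le> (\<Sum>n. norm (y (K + n)) * (\<Sum>j\<le>K + n. norm (x j)))"
      by (intro suminf_le mult_left_mono sum_mono2 summable_mult2 sy sxy) auto
    finally show ?thesis by (simp add: add.commute)
  qed
  have "(\<lambda>K. \<Sum>n. norm (y (n + K)) * (\<Sum>j\<le>n + K. norm (x j))) \<longlonglongrightarrow> 0"
    by (rule suminf_exist_split2[OF xy])
  then have "(\<lambda>K. (\<Sum>i<K. x i) * Y K) \<longlonglongrightarrow> 0"
    by (rule Lim_null_comparison[rotated]) (use le in auto)
  moreover have "summable (\<lambda>k. y k * (\<Sum>i\<le>k. x i))"
  proof (rule summable_comparison_test'[OF xy])
    show "norm (y n * (\<Sum>i\<le>n. x i)) \<le> norm (y n) * (\<Sum>i\<le>n. norm (x i))" for n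
      unfolding norm_mult by (intro mult_left_mono norm_sum) auto
  qed
  then have "(\<lambda>K. \<Sum>k<K. y k * (\<Sum>i\<le>k. x i)) \<longlonglongrightarrow> (\<Sum>k. y k * (\<Sum>i\<le>k. x i))"
    by (rule summable_LIMSEQ)
  ultimately have "(\<lambda>K. \<Sum>i<K. x i * Y i) \<longlonglongrightarrow> (\<Sum>k. y k * (\<Sum>i\<le>k. x i)) + 0"
    unfolding eq by (intro tendsto_add)
  then show ?thesis by (simp add: sums_def Y_def)
qed

lemma sum_triangle_swap:
  fixes a :: "nat \<Rightarrow> nat \<Rightarrow> 'a :: comm_monoid_add"
  shows "(\<Sum>m=1..<N. \<Sum>n=Suc m..<N. a m n) = (\<Sum>n=1..<N. \<Sum>m=1..<n. a m n)"
proof (induction N)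
  case (Suc N)
  show ?case
  proof (cases "N = 0")
    case False
    have "(\<Sum>m=1..<N. \<Sum>n=Suc m..<Suc N. a m n) = (\<Sum>m=1..<N. (\<Sum>n=Suc m..<N. a m n) + a m N)"
      by (intro sum.cong) auto
    with False Suc show ?thesis by (simp add: sum.distrib)
  qed simp
qed simp

lemma sum_atMost_shift_to_interval:
  fixes g :: "nat \<Rightarrow> 'a :: comm_monoid_add"
  shows "(\<Sum>i\<le>k. g (N + i)) = (\<Sum>m=N..N + k. g m)"
  using sum.shift_bounds_cl_nat_ivl[of g 0 N k] by (simp add: atLeast0AtMost add.commute)

lemma sums_imp_infsum_atLeast_1:
  fixes f :: "nat \<Rightarrow> complex"
  assumes "(\<lambda>n. f (Suc n)) sums s" "summable (\<lambda>n. norm (f (Suc n)))"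
  shows "infsum f {1..} = s"
proof -
  have "((\<lambda>n. f (Suc n)) has_sum s) UNIV"
    using norm_summable_imp_has_sum[OF assms(2)] assms(1) by simp
  then have "(f has_sum s) (range Suc)"
    by (subst has_sum_reindex) (auto simp: o_def)
  moreover have "range Suc = {1..}"
    by (auto simp: image_iff dest: Suc_le_D)
  ultimately show ?thesis by (simp add: infsumI)
qed

definition dz_partial :: "nat \<Rightarrow> complex \<Rightarrow> complex \<Rightarrow> complex" where
  "dz_partial N s1 s2 = (\<Sum>n=1..<N. \<Sum>m=1..<n. of_nat m powr (-s1) * of_nat n powr (-s2))"

text \<open>With c = 2 - 2 * J this is where the formula of order J is used; as J grows, these sets
  exhaust \<open>double_zeta_dom\<close>.\<close>

definition dz_region :: "real \<Rightarrow> (complex \<times> complex) set" where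
  "dz_region c = double_zeta_dom \<inter> {p. c < Re (snd p) \<and> c < Re (fst p + snd p)}"

lemma open_dz_region: "open (dz_region c)"
proof -
  have "open {p :: complex \<times> complex. c < Re (snd p)}"
    by (rule open_Collect_less) (intro continuous_intros)+
  moreover have "open {p :: complex \<times> complex. c < Re (fst p + snd p)}"
    by (rule open_Collect_less) (intro continuous_intros)+
  ultimately show ?thesis
    unfolding dz_region_def Collect_conj_eq by (intro open_Int open_double_zeta_dom)
qed

text \<open>Number of terms times the largest one. Such waste is affordable because the order
  \<open>J\<close> is free.\<close>

lemma sum_powr_le_crude:
  assumes "1 \<le> N"
  shows "(\<Sum>m=N..M. real m powr (-x)) \<le> real M powr (1 + max 0 (-x))"
proof -
  have "(\<Sum>m=N..M. real m powr (-x)) \<le> (\<Sum>m=N..M. real M powr (max 0 (-x)))"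
  proof (rule sum_mono)
    fix m assume m: "m \<in> {N..M}"
    have "real m powr (-x) \<le> real m powr (max 0 (-x))"
      using m assms by (intro powr_mono) auto
    also have "\<dots> \<le> real M powr (max 0 (-x))"
      using m by (intro powr_mono2) auto
    finally show "real m powr (-x) \<le> real M powr (max 0 (-x))" .
  qed
  also have "\<dots> = real (card {N..M}) * real M powr (max 0 (-x))" by simp
  also have "\<dots> \<le> real M * real M powr (max 0 (-x))"
    using assms by (intro mult_right_mono) auto
  also have "\<dots> \<le> real M powr (1 + max 0 (-x))"
    by (cases "M = 0") (auto simp: powr_add)
  finally show ?thesis .
qed

section \<open>The continuation of order \<open>J\<close>\<close>

context euler_maclaurin
begin

definition defect_series :: "nat \<Rightarrow> nat \<Rightarrow> complex \<times> complex \<Rightarrow> complex" where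
  "defect_series N n p = em_defect J b (snd p) (N + n) * (\<Sum>m=N..N + n. of_nat m powr (- fst p))"

text \<open>What the terms with n \<ge> N contribute. For m < N they form m powr (-s1) times a tail
  in s2; for m \<ge> N the Euler--Maclaurin expansion of the inner sum leaves pure powers of m,
  hence tails at s1 + s2 - 1, s1 + s2 and s1 + s2 + 2 * j - 1. The poles of these tails and the
  factor 1 / (s2 - 1) account for the excluded values s1 + s2 = 2, 1, 2 - 2 * j and s2 = 1. The
  coefficient is -1/2 and not 1/2 because n = m is left out of the inner sum.\<close>

definition dz_tail :: "nat \<Rightarrow> complex \<times> complex \<Rightarrow> complex" where
  "dz_tail N p = (\<Sum>m=1..<N. of_nat m powr (- fst p)) * zeta_tail (snd p) N
     + (inverse (snd p - 1) * zeta_tail (fst p + snd p - 1) N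
     + (\<Sum>j=1..J. of_real (b j) * pochhammer (snd p) (2 * j - 1) * zeta_tail (fst p + snd p + of_nat (2 * j) - 1) N)
     + (-1/2) * zeta_tail (fst p + snd p) N
     + (\<Sum>n. defect_series N n p))"

definition dz_cont :: "nat \<Rightarrow> complex \<times> complex \<Rightarrow> complex" where
  "dz_cont N p = dz_partial N (fst p) (snd p) + dz_tail N p"

lemma norm_defect_series_le:
  assumes "1 \<le> N" "norm (em_defect J b (snd p) (N + n)) \<le> B * real (N + n) powr (- (\<sigma> + real (2 * J + 1)))"
    and "0 \<le> B"
  shows "norm (defect_series N n p) \<le> B * real (N + n) powr (max 0 (- Re (fst p)) - \<sigma> - real (2 * J))"
proof -
  have "norm (\<Sum>m=N..N + n. of_nat m powr (- fst p) :: complex) \<le> (\<Sum>m=N..N + n. real m powr (- Re (fst p)))"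
    by (rule order_trans[OF norm_sum]) simp
  also have "\<dots> \<le> real (N + n) powr (1 + max 0 (- Re (fst p)))"
    by (rule sum_powr_le_crude) fact
  finally have "norm (defect_series N n p) \<le>
     (B * real (N + n) powr (- (\<sigma> + real (2 * J + 1)))) * real (N + n) powr (1 + max 0 (- Re (fst p)))"
    unfolding defect_series_def norm_mult using assms by (intro mult_mono) auto
  also have "\<dots> = B * real (N + n) powr (- (\<sigma> + real (2 * J + 1)) + (1 + max 0 (- Re (fst p))))"
    by (simp only: powr_add mult.assoc)
  also have "- (\<sigma> + real (2 * J + 1)) + (1 + max 0 (- Re (fst p))) = max 0 (- Re (fst p)) - \<sigma> - real (2 * J)"
    by simp
  finally show ?thesis .
qed

lemma holomorphic2_on_defect_series:
  assumes N: "1 \<le> N"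
  shows "(\<lambda>p. \<Sum>n. defect_series N n p) holomorphic2_on dz_region (2 - real (2 * J))"
proof (rule holomorphic2_on_suminf[OF open_dz_region])
  let ?U = "dz_region (2 - real (2 * J))"
  have U1: "snd p \<noteq> 1" if "p \<in> ?U" for p
    using that by (auto simp: dz_region_def double_zeta_dom_def)
  fix n
  have "(\<lambda>p. em_defect J b (snd p) (N + n)) holomorphic2_on ?U"
    by (rule holomorphic2_on_compose[OF holomorphic2_on_snd holomorphic_on_em_defect[of "- {1}"]])
       (use U1 in auto)
  moreover have "(\<lambda>p. of_nat m powr (- fst p)) holomorphic2_on ?U" for m
    by (rule holomorphic2_on_compose[OF holomorphic2_on_fst, of "\<lambda>z. of_nat m powr (-z)" UNIV])
       (auto intro!: holomorphic_intros)
  ultimately show "defect_series N n holomorphic2_on ?U"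
    unfolding defect_series_def by (intro holomorphic2_on_mult holomorphic2_on_sum)
next
  fix p assume p: "p \<in> dz_region (2 - real (2 * J))"
  then have p': "snd p \<noteq> 1" "2 - real (2 * J) < Re (snd p)" "2 - real (2 * J) < Re (fst p) + Re (snd p)"
    by (auto simp: dz_region_def double_zeta_dom_def)
  \<comment> \<open>At \<open>p\<close> the exponent of the majorant lies below -2; giving up 1/4 in
    each variable still leaves it below -3/2, which is summable.\<close>
  define \<sigma> where "\<sigma> = Re (snd p) - 1/4"
  obtain r B where r: "0 < r" "0 \<le> B" and rB:
      "\<And>w n. w \<in> cball (snd p) r \<Longrightarrow> 1 \<le> n \<Longrightarrow> norm (em_defect J b w n) \<le> B * real n powr (- (\<sigma> + real (2 * J + 1)))"
    using defect_majorant[of "snd p" \<sigma>] p' by (auto simp: \<sigma>_def)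
  let ?M = "\<lambda>n. B * real (N + n) powr (- (3/2))"
  show "\<exists>r>0. \<exists>M. summable M \<and> (\<forall>n. \<forall>q\<in>ball p r. norm (defect_series N n q) \<le> M n)"
  proof (intro exI[of _ "min r (1/4)"] exI[of _ ?M] conjI allI ballI)
    show "summable ?M" using N by (intro summable_mult summable_powr_tail) auto
    fix n q assume q: "q \<in> ball p (min r (1/4))"
    have "dist (fst p) (fst q) \<le> dist p q" "dist (snd p) (snd q) \<le> dist p q"
      by (rule dist_fst_le dist_snd_le)+
    with q have d: "dist (fst p) (fst q) < 1/4" "dist (snd p) (snd q) < r" by auto
    have "\<bar>Re (fst p - fst q)\<bar> \<le> dist (fst p) (fst q)"
      unfolding dist_norm by (rule abs_Re_le_cmod)
    then have re: "\<bar>Re (fst p) - Re (fst q)\<bar> < 1/4" using d by simp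
    have "norm (defect_series N n q) \<le> B * real (N + n) powr (max 0 (- Re (fst q)) - \<sigma> - real (2 * J))"
      using d rB[of "snd q" "N + n"] N r by (intro norm_defect_series_le) auto
    also have "max 0 (- Re (fst q)) - \<sigma> - real (2 * J) \<le> - (3/2)"
      using re p' unfolding \<sigma>_def by linarith
    then have "B * real (N + n) powr (max 0 (- Re (fst q)) - \<sigma> - real (2 * J)) \<le> B * real (N + n) powr (- (3/2))"
      using r N by (intro mult_left_mono powr_mono) auto
    finally show "norm (defect_series N n q) \<le> ?M n" .
  qed (use r in auto)
qed

lemma holomorphic2_on_dz_cont:
  assumes N: "1 \<le> N"
  shows "dz_cont N holomorphic2_on dz_region (2 - real (2 * J))"
proof -
  let ?U = "dz_region (2 - real (2 * J))" and ?S = "{w. - real (2 * J) < Re w} - {1}"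
  have oS: "open ?S" by (intro open_Diff open_halfspace_Re_gt) auto
  note T = holomorphic_on_zeta_tail[OF N]
  have U: "snd p \<noteq> 1" "fst p + snd p \<noteq> 2" "fst p + snd p \<noteq> 1" "fst p + snd p \<noteq> - (2 * of_nat k)"
      "2 - real (2 * J) < Re (snd p)" "2 - real (2 * J) < Re (fst p) + Re (snd p)" if "p \<in> ?U" for p k
    using that by (auto simp: dz_region_def double_zeta_dom_def image_iff)
  have L: "(\<lambda>p. fst p + snd p + c) holomorphic2_on ?U" for c
    by (intro holomorphic2_on_add holomorphic2_on_fst holomorphic2_on_snd holomorphic2_on_const)
  have p1: "(\<lambda>p. of_nat m powr (- fst p)) holomorphic2_on ?U" for m
    by (rule holomorphic2_on_compose[OF holomorphic2_on_fst, of "\<lambda>z. of_nat m powr (-z)" UNIV])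
       (auto intro!: holomorphic_intros)
  have p2: "(\<lambda>p. of_nat m powr (- snd p)) holomorphic2_on ?U" for m
    by (rule holomorphic2_on_compose[OF holomorphic2_on_snd, of "\<lambda>z. of_nat m powr (-z)" UNIV])
       (auto intro!: holomorphic_intros)
  have A: "(\<lambda>p. dz_partial N (fst p) (snd p)) holomorphic2_on ?U"
    unfolding dz_partial_def by (intro holomorphic2_on_sum holomorphic2_on_mult p1 p2)
  have T2: "(\<lambda>p. zeta_tail (snd p) N) holomorphic2_on ?U"
    by (rule holomorphic2_on_compose[OF holomorphic2_on_snd T oS]) (use U in fastforce)
  have Tc: "(\<lambda>p. zeta_tail (fst p + snd p + c) N) holomorphic2_on ?U"
    if "-2 \<le> Re c" "\<And>p. p \<in> ?U \<Longrightarrow> fst p + snd p + c \<noteq> 1" for c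
    by (rule holomorphic2_on_compose[OF L T oS]) (use U(6) that in fastforce)
  have T3: "(\<lambda>p. zeta_tail (fst p + snd p - 1) N) holomorphic2_on ?U"
    using Tc[of "-1"] U(2) by (simp add: diff_eq_eq)
  have T4: "(\<lambda>p. zeta_tail (fst p + snd p) N) holomorphic2_on ?U"
    using Tc[of 0] U(3) by simp
  have T5: "(\<lambda>p. zeta_tail (fst p + snd p + of_nat (2 * j) - 1) N) holomorphic2_on ?U"
    if j: "j \<in> {1..J}" for j
  proof -
    have "fst p + snd p + (of_nat (2 * j) - 1) \<noteq> 1" if "p \<in> ?U" for p
    proof
      assume "fst p + snd p + (of_nat (2 * j) - 1) = 1"
      then have "fst p + snd p = - (2 * of_nat (j - 1))"
        using j by (simp add: of_nat_diff algebra_simps)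
      then show False using U(4)[OF that] by blast
    qed
    from Tc[OF _ this] show ?thesis by (simp add: add_diff_eq)
  qed
  have I: "(\<lambda>p. inverse (snd p - 1)) holomorphic2_on ?U"
    by (rule holomorphic2_on_compose[OF holomorphic2_on_snd, of "\<lambda>z. inverse (z - 1)" "- {1}"])
       (use U(1) in \<open>auto intro!: holomorphic_intros\<close>)
  have P: "(\<lambda>p. pochhammer (snd p) k) holomorphic2_on ?U" for k
    by (rule holomorphic2_on_compose[OF holomorphic2_on_snd, of "\<lambda>z. pochhammer z k" UNIV])
       (auto intro!: holomorphic_intros)
  show ?thesis
    unfolding dz_cont_def[abs_def] dz_tail_def
    by (intro holomorphic2_on_add holomorphic2_on_mult holomorphic2_on_sum holomorphic2_on_const
        A T2 T3 T4 T5 I P p1 holomorphic2_on_defect_series N)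
qed

lemma zeta_tail_Suc:
  assumes "1 < Re w" "1 \<le> N"
  shows "zeta_tail w N = of_nat N powr (-w) + zeta_tail w (Suc N)"
proof -
  have "(\<lambda>n. of_nat (N + Suc n) powr (-w)) sums (zeta_tail w N - of_nat (N + 0) powr (-w))"
    using sums_Suc_iff[THEN iffD2, of "\<lambda>n. of_nat (N + n) powr (-w)"] zeta_tail_sums[OF assms]
    by (subst sums_Suc_iff) simp
  moreover have "(\<lambda>n. of_nat (N + Suc n) powr (-w)) sums zeta_tail w (Suc N)"
    using zeta_tail_sums[of w "Suc N"] assms by simp
  ultimately show ?thesis by (auto dest: sums_unique2)
qed

lemma zeta_tail_split:
  assumes "1 < Re w" "1 \<le> m" "m \<le> N"
  shows "zeta_tail w m = (\<Sum>n=m..<N. of_nat n powr (-w)) + zeta_tail w N"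
  using assms(3)
proof (induction N rule: dec_induct)
  case (step n)
  then show ?case using zeta_tail_Suc[OF assms(1), of n] assms(2) by (simp add: add.assoc)
qed simp

lemma norm_zeta_tail_le:
  assumes "1 < Re w" "1 \<le> N"
  shows "norm (zeta_tail w N) \<le> 2 powr Re w / (Re w - 1) * real N powr (1 - Re w)"
proof -
  have s: "summable (\<lambda>n. norm (of_nat (N + n) powr (-w) :: complex))"
    using summable_powr_tail[OF assms] unfolding norm_of_nat_powr by simp
  have "norm (zeta_tail w N) = norm (\<Sum>n. of_nat (N + n) powr (-w) :: complex)"
    using zeta_tail_sums[OF assms] by (simp add: sums_iff)
  also have "\<dots> \<le> (\<Sum>n. norm (of_nat (N + n) powr (-w) :: complex))"
    by (rule summable_norm[OF s])
  also have "\<dots> = (\<Sum>n. real (N + n) powr (- Re w))"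
    unfolding norm_of_nat_powr by simp
  also have "\<dots> \<le> 2 powr Re w / (Re w - 1) * real N powr (1 - Re w)"
    by (rule suminf_powr_tail_le[OF assms])
  finally show ?thesis .
qed

text \<open>In the region of convergence the formula is a rearrangement: for m < N the inner sum is
  split at N, for m \<ge> N it is expanded by Euler--Maclaurin and summed piece by piece.\<close>

lemma dz_cont_sums:
  assumes s2: "1 < Re s2" and s12: "2 < Re (s1 + s2)" and N: "1 \<le> N" and J: "1 \<le> J"
  shows "(\<lambda>i. of_nat (Suc i) powr (-s1) * zeta_tail s2 (Suc (Suc i))) sums dz_cont N (s1, s2)"
proof -
  have s21: "s2 \<noteq> 1" using s2 by auto
  define f where "f m = of_nat m powr (-s1) * zeta_tail s2 (Suc m)" for m
  let ?w = "\<lambda>j. s1 + s2 + of_nat (2 * j) - 1"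
  have f_tail: "f (N + i) = inverse (s2 - 1) * of_nat (N + i) powr (- (s1 + s2 - 1))
      + (\<Sum>j=1..J. of_real (b j) * pochhammer s2 (2 * j - 1) * of_nat (N + i) powr (- ?w j))
      + (-1/2) * of_nat (N + i) powr (- (s1 + s2))
      + of_nat (N + i) powr (-s1) * (\<Sum>n. em_defect J b s2 (N + (i + n)))" for i
  proof -
    let ?p = "\<lambda>a. of_nat (N + i) powr a :: complex"
    \<comment> \<open>The inner sum starts at m + 1; removing the term n = m turns plus one half of
      it into minus one half.\<close>
    have "zeta_tail s2 (Suc (N + i)) = zeta_tail s2 (N + i) - ?p (-s2)"
      using zeta_tail_Suc[OF s2, of "N + i"] N by simp
    also have "\<dots> = em_main J b s2 (N + i) - ?p (-s2) / 2 + (\<Sum>n. em_defect J b s2 (N + (i + n)))"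
      by (simp add: zeta_tail_def add.assoc)
    finally have "f (N + i) = ?p (-s1) * (?p (1 - s2) / (s2 - 1)
      + (\<Sum>j=1..J. of_real (b j) * pochhammer s2 (2 * j - 1) * ?p (1 - s2 - of_nat (2 * j)))
      - ?p (-s2) / 2 + (\<Sum>n. em_defect J b s2 (N + (i + n))))"
      by (simp add: f_def em_main_def)
    note f_eq = this
    have e: "- (s1 + s2 - 1) = -s1 + (1 - s2)" "- (s1 + s2) = -s1 + -s2"
      "- ?w j = -s1 + (1 - s2 - of_nat (2 * j))" for j
      by (simp_all add: algebra_simps)
    have gen: "P * (A / d + X - B / 2 + R) = inverse d * (P * A) + P * X + (-1/2) * (P * B) + P * R"
      for P A d X B R :: complex
    proof -
      have "P * (A / d) = inverse d * (P * A)" by (simp add: divide_inverse)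
      moreover have "P * (B / 2) = - ((-1/2) * (P * B))" by simp
      ultimately show ?thesis
        by (simp only: distrib_left right_diff_distrib diff_minus_eq_add)
    qed
    show ?thesis
      unfolding f_eq gen e powr_add sum_distrib_left by (simp only: mult.left_commute mult.assoc)
  qed
  have T: "(\<lambda>i. of_nat (N + i) powr (-w)) sums zeta_tail w N" if "1 < Re w" for w
    using zeta_tail_sums[OF that N] .
  have tri: "(\<lambda>i. of_nat (N + i) powr (-s1) * (\<Sum>n. em_defect J b s2 (N + (i + n)))) sums
     (\<Sum>n. defect_series N n (s1, s2))"
  proof -
    have sm: "summable (\<lambda>k. norm (em_defect J b s2 (N + k)))"
      using s21 s2 N by (intro summable_norm_defect) auto
    obtain B where B: "0 \<le> B" "\<And>n. 1 \<le> n \<Longrightarrow> norm (em_defect J b s2 n) \<le> B * real n powr (- (Re s2 + real (2 * J + 1)))"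
      using norm_defect_le[OF s21] s2 C_nonneg
      by (intro that[of "C * norm (pochhammer s2 (2 * J + 1))"]) auto
    have "summable (\<lambda>k. norm (em_defect J b s2 (N + k)) * (\<Sum>i\<le>k. norm (of_nat (N + i) powr (-s1) :: complex)))"
    proof (rule summable_comparison_test')
      show "summable (\<lambda>k. B * real (N + k) powr (- (3/2)))"
        using N by (intro summable_mult summable_powr_tail) auto
      fix k :: nat
      have "(\<Sum>i\<le>k. norm (of_nat (N + i) powr (-s1) :: complex)) = (\<Sum>m=N..N + k. real m powr (- Re s1))"
        unfolding norm_of_nat_powr using sum_atMost_shift_to_interval[of "\<lambda>m. real m powr (- Re s1)" N k] by simp
      also have "\<dots> \<le> real (N + k) powr (1 + max 0 (- Re s1))"
        by (rule sum_powr_le_crude) fact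
      finally have "norm (em_defect J b s2 (N + k)) * (\<Sum>i\<le>k. norm (of_nat (N + i) powr (-s1) :: complex)) \<le>
        (B * real (N + k) powr (- (Re s2 + real (2 * J + 1)))) * real (N + k) powr (1 + max 0 (- Re s1))"
        using B(2)[of "N + k"] N B(1) by (intro mult_mono sum_nonneg) auto
      also have "\<dots> = B * real (N + k) powr (- (Re s2 + real (2 * J + 1)) + (1 + max 0 (- Re s1)))"
        by (simp only: powr_add mult.assoc)
      also have "\<dots> \<le> B * real (N + k) powr (- (3/2))"
        using s2 s12 J N B(1) by (intro mult_left_mono powr_mono) auto
      finally show "norm (norm (em_defect J b s2 (N + k)) * (\<Sum>i\<le>k. norm (of_nat (N + i) powr (-s1) :: complex)))
         \<le> B * real (N + k) powr (- (3/2))"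
        by (simp add: sum_nonneg)
    qed
    from triangle_sums[OF sm this] show ?thesis
      unfolding defect_series_def fst_conv snd_conv by (simp only: sum_atMost_shift_to_interval[of "\<lambda>m. of_nat m powr (-s1)" N])
  qed
  have "(\<lambda>i. f (N + i)) sums (inverse (s2 - 1) * zeta_tail (s1 + s2 - 1) N
     + (\<Sum>j=1..J. of_real (b j) * pochhammer s2 (2 * j - 1) * zeta_tail (?w j) N)
     + (-1/2) * zeta_tail (s1 + s2) N + (\<Sum>n. defect_series N n (s1, s2)))"
    unfolding f_tail
    by (intro sums_add sums_mult sums_sum T tri) (use s12 in auto)
  then have "(\<lambda>i. f (Suc (i + (N - 1)))) sums (dz_tail N (s1, s2) - (\<Sum>m=1..<N. of_nat m powr (-s1)) * zeta_tail s2 N)"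
    using N by (simp add: dz_tail_def add.commute)
  then have "(\<lambda>i. f (Suc i)) sums (dz_tail N (s1, s2) - (\<Sum>m=1..<N. of_nat m powr (-s1)) * zeta_tail s2 N
     + (\<Sum>i<N - 1. f (Suc i)))"
    by (rule sums_iff_shift[of "\<lambda>i. f (Suc i)" "N - 1", THEN iffD1])
  also have "(\<Sum>i<N - 1. f (Suc i)) = (\<Sum>m=1..<N. f m)"
    using N sum.shift_bounds_Suc_ivl[of f 0 "N - 1"] by (simp add: lessThan_atLeast0)
  also have "(\<Sum>m=1..<N. f m) = (\<Sum>m=1..<N. of_nat m powr (-s1) * (\<Sum>n=Suc m..<N. of_nat n powr (-s2)))
     + (\<Sum>m=1..<N. of_nat m powr (-s1)) * zeta_tail s2 N"
  proof -
    have "f m = of_nat m powr (-s1) * (\<Sum>n=Suc m..<N. of_nat n powr (-s2)) + of_nat m powr (-s1) * zeta_tail s2 N"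
      if "m \<in> {1..<N}" for m
      using zeta_tail_split[OF s2, of "Suc m" N] that by (simp add: f_def distrib_left)
    then show ?thesis by (simp add: sum.distrib sum_distrib_right)
  qed
  also have "(\<Sum>m=1..<N. of_nat m powr (-s1) * (\<Sum>n=Suc m..<N. of_nat n powr (-s2))) = dz_partial N s1 s2"
    unfolding dz_partial_def sum_distrib_left
    by (rule sum_triangle_swap)
  finally show ?thesis
    by (simp add: dz_cont_def f_def add_ac)
qed

text \<open>The series is an \<open>infsum\<close>, so the outer terms must also be absolutely
  summable; they are of size m powr (1 - Re (s1 + s2)).\<close>

lemma double_zeta_series_eq_dz_cont:
  assumes s2: "1 < Re s2" and s12: "2 < Re (s1 + s2)" and N: "1 \<le> N" and J: "1 \<le> J"
  shows "double_zeta_series s1 s2 = dz_cont N (s1, s2)"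
proof -
  have s21: "s2 \<noteq> 1" using s2 by auto
  define f where "f m = of_nat m powr (-s1) * zeta_tail s2 (Suc m)" for m
  have inner: "(\<Sum>\<^sub>\<infinity>n\<in>{1::nat..}. of_nat (m + n) powr (-s2)) = zeta_tail s2 (Suc m)" for m
  proof (rule sums_imp_infsum_atLeast_1)
    show "(\<lambda>n. of_nat (m + Suc n) powr (-s2)) sums zeta_tail s2 (Suc m)"
      using zeta_tail_sums[OF s2, of "Suc m"] by simp
    show "summable (\<lambda>n. norm (of_nat (m + Suc n) powr (-s2) :: complex))"
      using summable_powr_tail[OF s2, of "Suc m"] unfolding norm_of_nat_powr by simp
  qed
  have series: "double_zeta_series s1 s2 = infsum f {1..}"
    unfolding double_zeta_series_def inner f_def ..
  have sums: "(\<lambda>i. f (Suc i)) sums dz_cont N (s1, s2)"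
    unfolding f_def by (rule dz_cont_sums[OF s2 s12 N J])
  have "summable (\<lambda>i. norm (f (Suc i)))"
  proof (rule summable_comparison_test')
    show "summable (\<lambda>i. 2 powr Re s2 / (Re s2 - 1) * real (1 + i) powr (- (Re (s1 + s2) - 1)))"
      using s12 by (intro summable_mult summable_powr_tail) auto
    fix i
    have "norm (zeta_tail s2 (Suc (Suc i))) \<le> 2 powr Re s2 / (Re s2 - 1) * real (Suc (Suc i)) powr (1 - Re s2)"
      using s2 by (intro norm_zeta_tail_le) auto
    also have "\<dots> \<le> 2 powr Re s2 / (Re s2 - 1) * real (1 + i) powr (1 - Re s2)"
      using s2 by (intro mult_left_mono powr_mono2') auto
    finally have "norm (zeta_tail s2 (Suc (Suc i))) \<le> 2 powr Re s2 / (Re s2 - 1) * real (1 + i) powr (1 - Re s2)" .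
    then have "norm (f (Suc i)) \<le> real (1 + i) powr (- Re s1) * (2 powr Re s2 / (Re s2 - 1) * real (1 + i) powr (1 - Re s2))"
      unfolding f_def norm_mult norm_of_nat_powr by (intro mult_mono) auto
    also have "\<dots> = 2 powr Re s2 / (Re s2 - 1) * (real (1 + i) powr (- Re s1) * real (1 + i) powr (1 - Re s2))"
      by simp
    also have "real (1 + i) powr (- Re s1) * real (1 + i) powr (1 - Re s2) = real (1 + i) powr (- (Re (s1 + s2) - 1))"
      unfolding powr_add [symmetric] by (simp add: algebra_simps)
    finally show "norm (norm (f (Suc i))) \<le> 2 powr Re s2 / (Re s2 - 1) * real (1 + i) powr (- (Re (s1 + s2) - 1))"
      by simp
  qed
  from sums_imp_infsum_atLeast_1[OF sums this] show ?thesis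
    unfolding series .
qed

end

section \<open>Gluing the orders to one global continuation\<close>

lemma ex_euler_maclaurin: "\<exists>b C. euler_maclaurin J b C"
proof -
  obtain b C where "0 \<le> C" and *: "\<forall>s n. s \<noteq> 1 \<longrightarrow> 1 \<le> n \<longrightarrow> - real (2 * J + 1) \<le> Re s \<longrightarrow>
     norm (em_defect J b s n) \<le> C * norm (pochhammer s (2 * J + 1)) * real n powr (- Re s - real (2 * J + 1))"
    using em_defect_bound_exists[of J] by blast
  have "euler_maclaurin J b C"
  proof
    fix s :: complex and n :: nat
    assume "s \<noteq> 1" "1 \<le> n" "- real (2 * J + 1) \<le> Re s"
    moreover have "- Re s - real (2 * J + 1) = - (Re s + real (2 * J + 1))" by simp
    ultimately show "norm (em_defect J b s n) \<le> C * norm (pochhammer s (2 * J + 1)) * real n powr (- (Re s + real (2 * J + 1)))"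
      using * by metis
  qed fact
  then show ?thesis by blast
qed

lemma dz_region_mono: "c \<le> d \<Longrightarrow> dz_region d \<subseteq> dz_region c"
  by (auto simp: dz_region_def)

lemma dz_region_identity:
  assumes "Z holomorphic2_on dz_region c" "W holomorphic2_on dz_region c" "c < 2"
    and "\<And>s1 s2. 1 < Re s2 \<Longrightarrow> 2 < Re (s1 + s2) \<Longrightarrow> Z (s1, s2) = W (s1, s2)"
    and "p \<in> dz_region c"
  shows "Z p = W p"
  using double_zeta_dom_identity[OF assms(1,2) dz_region_def assms(3,4,5)] .

text \<open>The formulas of different orders agree on their common region by the identity theorem,
  so they glue to one function on the whole domain. Its existence is what gives the
  \<open>SOME\<close> in the definition of \<open>double_zeta\<close> its meaning.\<close>

lemma is_double_zeta_continuation_double_zeta: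
  "is_double_zeta_continuation (\<lambda>p. double_zeta (fst p) (snd p))"
proof -
  obtain b C where EM: "\<And>J. euler_maclaurin J (b J) (C J)"
    using ex_euler_maclaurin by metis
  define F where "F J = euler_maclaurin.dz_cont J (b J) 1" for J
  have hol: "F J holomorphic2_on dz_region (2 - real (2 * J))" for J
    unfolding F_def by (rule euler_maclaurin.holomorphic2_on_dz_cont[OF EM]) simp
  have ser: "F J (s1, s2) = double_zeta_series s1 s2"
    if "1 < Re s2" "2 < Re (s1 + s2)" "1 \<le> J" for J s1 s2
    unfolding F_def using euler_maclaurin.double_zeta_series_eq_dz_cont[OF EM that(1,2) _ that(3), of 1] by simp
  have agree: "F J p = F K p" if "1 \<le> J" "J \<le> K" "p \<in> dz_region (2 - real (2 * J))" for J K p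
  proof (rule dz_region_identity[OF hol[of J] _ _ _ that(3)])
    have "dz_region (2 - real (2 * J)) \<subseteq> dz_region (2 - real (2 * K))"
      using that by (intro dz_region_mono) auto
    then show "F K holomorphic2_on dz_region (2 - real (2 * J))"
      by (rule holomorphic2_on_subset[OF hol[of K]])
    show "F J (s1, s2) = F K (s1, s2)" if "1 < Re s2" "2 < Re (s1 + s2)" for s1 s2
      using that ser[OF that] \<open>1 \<le> J\<close> \<open>J \<le> K\<close> by simp
  qed (use that in simp)
  have ex: "\<exists>J\<ge>1. p \<in> dz_region (2 - real (2 * J))" if "p \<in> double_zeta_dom" for p
  proof -
    obtain n where "max (2 - Re (snd p)) (2 - Re (fst p + snd p)) < real n"
      using reals_Archimedean2 by blast
    then show ?thesis
      using that by (intro exI[of _ "Suc n"]) (auto simp: dz_region_def)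
  qed
  \<comment> \<open>The least admissible order makes the choice definite; by \<open>agree\<close>,
    any larger order gives the same value, so near each point \<open>Z\<close> is a single
    holomorphic \<open>F J\<close>.\<close>
  define Jof where "Jof p = (LEAST J. 1 \<le> J \<and> p \<in> dz_region (2 - real (2 * J)))" for p
  define Z where "Z p = F (Jof p) p" for p
  have Z: "Z p = F J p" if "1 \<le> J" "p \<in> dz_region (2 - real (2 * J))" for J p
  proof -
    have Q: "1 \<le> J \<and> p \<in> dz_region (2 - real (2 * J))" using that by (rule conjI)
    have "1 \<le> Jof p \<and> p \<in> dz_region (2 - real (2 * Jof p))"
      unfolding Jof_def by (rule LeastI[of "\<lambda>J. 1 \<le> J \<and> p \<in> dz_region (2 - real (2 * J))", OF Q])
    moreover have "Jof p \<le> J"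
      unfolding Jof_def by (rule Least_le[of "\<lambda>J. 1 \<le> J \<and> p \<in> dz_region (2 - real (2 * J))", OF Q])
    ultimately show ?thesis unfolding Z_def by (intro agree) auto
  qed
  have "Z holomorphic2_on double_zeta_dom"
  proof (rule holomorphic2_onI)
    fix p assume p: "p \<in> double_zeta_dom"
    obtain J where J: "1 \<le> J" "p \<in> dz_region (2 - real (2 * J))" using ex[OF p] by blast
    have ZJ: "Z holomorphic2_on dz_region (2 - real (2 * J))"
      using holomorphic2_on_cong[OF hol[of J], of Z] Z[OF J(1)] by simp
    show "\<exists>a b. (Z has_derivative (\<lambda>(h, k). a * h + b * k)) (at p)"
      by (rule holomorphic2_onD[OF ZJ open_dz_region J(2)]) (intro exI)
  qed
  moreover have "Z (s1, s2) = double_zeta_series s1 s2" if s: "1 < Re s2" "2 < Re (s1 + s2)" for s1 s2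
  proof -
    have "s1 + s2 \<noteq> 2" "s1 + s2 \<noteq> 1" "s1 + s2 \<noteq> - (2 * of_nat k)" "s2 \<noteq> 1" for k
      using s by (auto simp: complex_eq_iff)
    then have "(s1, s2) \<in> dz_region (2 - real (2 * 1))"
      using s by (auto simp: dz_region_def double_zeta_dom_def)
    then show ?thesis using Z[of 1 "(s1, s2)"] ser[OF s, of 1] by simp
  qed
  ultimately have "is_double_zeta_continuation Z"
    unfolding is_double_zeta_continuation_def by blast
  then show ?thesis
    unfolding double_zeta_def by (simp add: someI)
qed

lemma continuous_on_double_zeta:
  "continuous_on double_zeta_dom (\<lambda>p. double_zeta (fst p) (snd p))"
  using is_double_zeta_continuation_double_zeta holomorphic2_on_imp_continuous_on
  unfolding is_double_zeta_continuation_def by blast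

lemma double_zeta_eq_series:
  "1 < Re s2 \<Longrightarrow> 2 < Re (s1 + s2) \<Longrightarrow> double_zeta s1 s2 = double_zeta_series s1 s2"
  using is_double_zeta_continuation_double_zeta unfolding is_double_zeta_continuation_def by auto

text \<open>The left side depends neither on \<open>N\<close> nor on the order. The estimates use
  this freedom: the order is fixed by the accuracy wanted, and \<open>N\<close> varies with the
  height.\<close>

lemma (in euler_maclaurin) double_zeta_eq_dz_cont:
  assumes "1 \<le> J" "1 \<le> N" and p: "(s1, s2) \<in> dz_region (2 - real (2 * J))"
  shows "double_zeta s1 s2 = dz_cont N (s1, s2)"
proof -
  let ?Z = "\<lambda>p. double_zeta (fst p) (snd p)"
  have "?Z (s1, s2) = dz_cont N (s1, s2)"
  proof (rule dz_region_identity[OF _ holomorphic2_on_dz_cont[OF \<open>1 \<le> N\<close>] _ _ p])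
    have "?Z holomorphic2_on double_zeta_dom"
      using is_double_zeta_continuation_double_zeta unfolding is_double_zeta_continuation_def by blast
    then show "?Z holomorphic2_on dz_region (2 - real (2 * J))"
      by (rule holomorphic2_on_subset) (auto simp: dz_region_def)
    show "?Z (s1, s2) = dz_cont N (s1, s2)" if "1 < Re s2" "2 < Re (s1 + s2)" for s1 s2
      using double_zeta_eq_series[OF that] double_zeta_series_eq_dz_cont[OF that assms(2,1)] by simp
  qed (use \<open>1 \<le> J\<close> in simp)
  then show ?thesis by simp
qed

section \<open>Approximation by partial sums\<close>

text \<open>The height may reach \<open>4 * X\<close> since s1 + s2 has imaginary part 2 * t, with t
  up to 2 * X.\<close>

lemma norm_pochhammer_vertical_le:
  assumes "1 \<le> X" "\<bar>Im w\<bar> \<le> 4 * X"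
  shows "norm (pochhammer w k) \<le> (\<bar>Re w\<bar> + 4 + real k) ^ k * X ^ k"
proof -
  have "norm w \<le> \<bar>Re w\<bar> + \<bar>Im w\<bar>" by (rule cmod_le)
  moreover have "(\<bar>Re w\<bar> + real k) * 1 \<le> (\<bar>Re w\<bar> + real k) * X"
    using assms by (intro mult_left_mono) auto
  ultimately have "norm w + real k \<le> (\<bar>Re w\<bar> + 4 + real k) * X"
    using assms by (simp add: algebra_simps)
  then have "(norm w + real k) ^ k \<le> ((\<bar>Re w\<bar> + 4 + real k) * X) ^ k"
    by (intro power_mono) auto
  then show ?thesis
    using norm_pochhammer_le[of w k] by (simp add: power_mult_distrib)
qed

text \<open>The power of X is the size of the Pochhammer factor in the correction of index j; for n
  \<ge> X the whole correction is still smaller than the leading power by a factor X.\<close>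

lemma power_ratio_le:
  fixes X n :: real
  assumes "1 \<le> X" "X \<le> n" "1 \<le> j"
  shows "X ^ (2 * j - 1) * n powr (a - real (2 * j)) \<le> n powr a / X"
proof -
  have n: "0 < n" using assms by simp
  have "X ^ (2 * j - 1) * X = X ^ (2 * j)"
    using assms by (metis Suc_diff_1 mult.commute mult_pos_pos power_Suc pos2 less_le_trans zero_less_one)
  also have "\<dots> \<le> n ^ (2 * j)" using assms by (intro power_mono) auto
  finally have "X ^ (2 * j - 1) \<le> n ^ (2 * j) / X"
    using assms by (simp add: field_simps)
  then have "X ^ (2 * j - 1) * (n powr a / n ^ (2 * j)) \<le> n ^ (2 * j) / X * (n powr a / n ^ (2 * j))"
    using n by (intro mult_right_mono) auto
  also have "\<dots> = n powr a / X" using n by simp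
  also have "n powr a / n ^ (2 * j) = n powr (a - real (2 * j))"
    using n by (simp add: powr_diff powr_realpow del: of_nat_mult)
  finally show ?thesis .
qed

context euler_maclaurin
begin

text \<open>At height about X the leading term N powr (1 - w) / (w - 1) decides; the corrections and
  the half term are of no larger order, and the hypothesis on X / N pushes the summed defects below
  the same bound.\<close>

lemma norm_zeta_tail_vertical:
  assumes a: "- real (2 * J) < a"
  shows "\<exists>K\<ge>0. \<forall>X N w. 1 \<le> X \<longrightarrow> X \<le> real N \<longrightarrow> (X / real N) ^ (2 * J + 1) \<le> 1 / X \<longrightarrow>
     Re w = a \<longrightarrow> X \<le> \<bar>Im w\<bar> \<longrightarrow> \<bar>Im w\<bar> \<le> 4 * X \<longrightarrow>
     norm (zeta_tail w N) \<le> K * (real N powr (1 - a) / X)"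
proof -
  define P where "P k = (\<bar>a\<bar> + 4 + real k) ^ k" for k
  have P0: "0 \<le> P k" for k unfolding P_def by (intro zero_le_power) simp
  define K where "K = 1 + (\<Sum>j=1..J. \<bar>b j\<bar> * P (2 * j - 1)) + 1
     + C * P (2 * J + 1) * (2 powr (a + real (2 * J + 1)) / (a + real (2 * J + 1) - 1))"
  have "0 \<le> K"
    unfolding K_def using P0 C_nonneg a by (intro add_nonneg_nonneg sum_nonneg mult_nonneg_nonneg divide_nonneg_nonneg) auto
  moreover have "norm (zeta_tail w N) \<le> K * (real N powr (1 - a) / X)"
    if X: "1 \<le> X" "X \<le> real N" and q: "(X / real N) ^ (2 * J + 1) \<le> 1 / X"
      and w: "Re w = a" "X \<le> \<bar>Im w\<bar>" "\<bar>Im w\<bar> \<le> 4 * X" for X N w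
  proof -
    have N: "1 \<le> N" "0 < real N" using X by auto
    have w1: "w \<noteq> 1" using w X by auto
    let ?R = "real N powr (1 - a) / X"
    have R0: "0 \<le> ?R" using X by simp
    have poch: "norm (pochhammer w k) \<le> P k * X ^ k" for k
      using norm_pochhammer_vertical_le[OF X(1) w(3)] w(1) by (simp add: P_def)
    have "X \<le> norm (w - 1)" using abs_Im_le_cmod[of "w - 1"] w(2) by simp
    then have m0: "norm (of_nat N powr (1 - w) / (w - 1)) \<le> ?R"
      unfolding norm_divide norm_of_nat_powr using X w by (intro frac_le) auto
    have m1: "norm (of_real (b j) * pochhammer w (2 * j - 1) * of_nat N powr (1 - w - of_nat (2 * j)))
        \<le> \<bar>b j\<bar> * P (2 * j - 1) * ?R" if "j \<in> {1..J}" for j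
    proof -
      have "norm (of_real (b j) * pochhammer w (2 * j - 1) * of_nat N powr (1 - w - of_nat (2 * j)))
         = \<bar>b j\<bar> * (norm (pochhammer w (2 * j - 1)) * real N powr (1 - a - real (2 * j)))"
        unfolding norm_mult norm_of_nat_powr using w(1) by (simp add: mult.assoc)
      also have "\<dots> \<le> \<bar>b j\<bar> * ((P (2 * j - 1) * X ^ (2 * j - 1)) * real N powr (1 - a - real (2 * j)))"
        by (intro mult_left_mono mult_right_mono poch) auto
      also have "\<dots> = \<bar>b j\<bar> * P (2 * j - 1) * (X ^ (2 * j - 1) * real N powr (1 - a - real (2 * j)))"
        by (simp only: mult.assoc)
      also have "\<dots> \<le> \<bar>b j\<bar> * P (2 * j - 1) * ?R"
        using power_ratio_le[OF X, of j "1 - a"] that P0 by (intro mult_left_mono) auto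
      finally show ?thesis .
    qed
    have "norm (em_main J b w N) \<le> ?R + (\<Sum>j=1..J. \<bar>b j\<bar> * P (2 * j - 1) * ?R)"
      unfolding em_main_def by (intro norm_triangle_mono m0 order_trans[OF norm_sum] sum_mono m1)
    then have m: "norm (em_main J b w N) \<le> (1 + (\<Sum>j=1..J. \<bar>b j\<bar> * P (2 * j - 1))) * ?R"
      by (simp only: distrib_right mult_1_left sum_distrib_right)
    have "norm (of_nat N powr (-w) / 2 :: complex) = real N powr (1 - a - 1) / 2"
      unfolding norm_divide norm_of_nat_powr using w by simp
    also have "\<dots> = real N powr (1 - a) / real N / 2"
      using N powr_diff[of "real N" "1 - a" 1] by simp
    also have "\<dots> \<le> real N powr (1 - a) / real N"
    proof -
      have half: "y / 2 \<le> y" if "0 \<le> y" for y :: real using that by simp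
      show ?thesis by (rule half) simp
    qed
    also have "\<dots> \<le> ?R" using X N by (intro divide_left_mono) auto
    finally have h: "norm (of_nat N powr (-w) / 2 :: complex) \<le> 1 * ?R" by simp
    let ?e = "a + real (2 * J + 1)"
    have e: "1 < ?e" using a by simp
    have d: "norm (em_defect J b w (N + n)) \<le> C * (P (2 * J + 1) * X ^ (2 * J + 1)) * real (N + n) powr (- ?e)" for n
    proof -
      have "norm (em_defect J b w (N + n)) \<le> C * norm (pochhammer w (2 * J + 1)) * real (N + n) powr (- (Re w + real (2 * J + 1)))"
        using w1 N a w by (intro norm_defect_le) auto
      also have "\<dots> \<le> C * (P (2 * J + 1) * X ^ (2 * J + 1)) * real (N + n) powr (- ?e)"
        unfolding w(1) by (intro mult_right_mono mult_left_mono poch C_nonneg) auto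
      finally show ?thesis .
    qed
    have s: "summable (\<lambda>n. norm (em_defect J b w (N + n)))"
      using w1 a w N by (intro summable_norm_defect) auto
    have "norm (\<Sum>n. em_defect J b w (N + n)) \<le> (\<Sum>n. norm (em_defect J b w (N + n)))"
      by (rule summable_norm[OF s])
    also have "\<dots> \<le> (\<Sum>n. C * (P (2 * J + 1) * X ^ (2 * J + 1)) * real (N + n) powr (- ?e))"
      using s summable_powr_tail[OF e N(1)] by (intro suminf_le d summable_mult)
    also have "\<dots> = C * (P (2 * J + 1) * X ^ (2 * J + 1)) * (\<Sum>n. real (N + n) powr (- ?e))"
      by (rule suminf_mult[OF summable_powr_tail[OF e N(1)]])
    also have "\<dots> \<le> C * (P (2 * J + 1) * X ^ (2 * J + 1)) * (2 powr ?e / (?e - 1) * real N powr (1 - ?e))"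
      using suminf_powr_tail_le[OF e N(1)] C_nonneg P0 X by (intro mult_left_mono mult_nonneg_nonneg) auto
    also have "\<dots> = C * P (2 * J + 1) * (2 powr ?e / (?e - 1)) * (X ^ (2 * J + 1) * real N powr (1 - ?e))"
      by (simp only: mult.assoc mult.left_commute)
    also have "X ^ (2 * J + 1) * real N powr (1 - ?e) = real N powr (1 - a) * (X / real N) ^ (2 * J + 1)"
    proof -
      have "1 - ?e = (1 - a) - real (2 * J + 1)" by simp
      then have "real N powr (1 - ?e) = real N powr (1 - a) / real N ^ (2 * J + 1)"
        using N by (simp only: powr_diff powr_realpow)
      then show ?thesis by (simp add: power_divide)
    qed
    also have "C * P (2 * J + 1) * (2 powr ?e / (?e - 1)) * (real N powr (1 - a) * (X / real N) ^ (2 * J + 1))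
        \<le> C * P (2 * J + 1) * (2 powr ?e / (?e - 1)) * (real N powr (1 - a) * (1 / X))"
      using C_nonneg P0 e q by (intro mult_left_mono mult_nonneg_nonneg divide_nonneg_nonneg) auto
    finally have D: "norm (\<Sum>n. em_defect J b w (N + n)) \<le> C * P (2 * J + 1) * (2 powr ?e / (?e - 1)) * ?R"
      by simp
    have "norm (zeta_tail w N) \<le> (1 + (\<Sum>j=1..J. \<bar>b j\<bar> * P (2 * j - 1))) * ?R + 1 * ?R
       + C * P (2 * J + 1) * (2 powr ?e / (?e - 1)) * ?R"
      unfolding zeta_tail_def by (intro norm_triangle_mono m h D)
    also have "\<dots> = K * ?R" unfolding K_def by (simp only: distrib_right)
    finally show ?thesis .
  qed
  ultimately show ?thesis by blast
qed

text \<open>Two scales arise. The product with the sum over m < N saves one factor X. The other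
  tails save two, one from the tail itself and one from 1 / (s2 - 1), from a Pochhammer ratio or
  from N \<ge> X; the defect series saves as much by the hypothesis on X / N, in which N powr (-
  \<bar>\<sigma>1\<bar>) compensates the crude bound for partial sums over m.\<close>

lemma norm_dz_tail_le:
  assumes "2 - real (2 * J) < \<sigma>2" "2 - real (2 * J) < \<sigma>1 + \<sigma>2"
  shows "\<exists>K\<ge>0. \<forall>X N t. 1 \<le> X \<longrightarrow> X \<le> real N \<longrightarrow> X \<le> t \<longrightarrow> t \<le> 2 * X \<longrightarrow>
     (X / real N) ^ (2 * J + 1) \<le> real N powr (- \<bar>\<sigma>1\<bar>) / X\<^sup>2 \<longrightarrow>
     norm (dz_tail N (Complex \<sigma>1 t, Complex \<sigma>2 t)) \<le>
       K * (real N powr (1 - \<sigma>2) / X * (\<Sum>m=1..<N. real m powr (- \<sigma>1)) + real N powr (2 - \<sigma>1 - \<sigma>2) / X\<^sup>2)"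
proof -
  define P where "P k = (\<bar>\<sigma>2\<bar> + 4 + real k) ^ k" for k
  have P0: "0 \<le> P k" for k unfolding P_def by (intro zero_le_power) simp
  have ex: "\<forall>a. \<exists>K. - real (2 * J) < a \<longrightarrow> 0 \<le> K \<and> (\<forall>X N w. 1 \<le> X \<longrightarrow> X \<le> real N \<longrightarrow> (X / real N) ^ (2 * J + 1) \<le> 1 / X \<longrightarrow>
     Re w = a \<longrightarrow> X \<le> \<bar>Im w\<bar> \<longrightarrow> \<bar>Im w\<bar> \<le> 4 * X \<longrightarrow>
     norm (zeta_tail w N) \<le> K * (real N powr (1 - a) / X))"
    using norm_zeta_tail_vertical by blast
  obtain k where k0: "\<And>a. - real (2 * J) < a \<Longrightarrow> 0 \<le> k a" and
    k: "\<And>a X N w. - real (2 * J) < a \<Longrightarrow> 1 \<le> X \<Longrightarrow> X \<le> real N \<Longrightarrow> (X / real N) ^ (2 * J + 1) \<le> 1 / X \<Longrightarrow>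
     Re w = a \<Longrightarrow> X \<le> \<bar>Im w\<bar> \<Longrightarrow> \<bar>Im w\<bar> \<le> 4 * X \<Longrightarrow>
     norm (zeta_tail w N) \<le> k a * (real N powr (1 - a) / X)"
    using choice[OF ex] by blast
  define s where "s = \<sigma>1 + \<sigma>2"
  \<comment> \<open>The decay exponent of the defect series: \<sigma>2 + 2 * J + 1 from the defect,
    minus the growth exponent 1 + max 0 (- \<sigma>1) of the partial sums over m.\<close>
  define e where "e = \<sigma>2 + real (2 * J) - max 0 (- \<sigma>1)"
  have e1: "1 < e" using assms by (auto simp: e_def)
  define K where "K = k \<sigma>2 + k (s - 1) + (\<Sum>j=1..J. \<bar>b j\<bar> * P (2 * j - 1) * k (s + real (2 * j) - 1)) + k s
     + C * P (2 * J + 1) * (2 powr e / (e - 1))"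
  have sJ: "- real (2 * J) < s - 1" "- real (2 * J) < s" "- real (2 * J) < \<sigma>2"
    "- real (2 * J) < s + real (2 * j) - 1" for j
    using assms by (auto simp: s_def)
  have kn: "0 \<le> k \<sigma>2" "0 \<le> k (s - 1)" "0 \<le> k s" "0 \<le> k (s + real (2 * j) - 1)" for j
    by (rule k0, rule sJ)+
  have S0: "0 \<le> (\<Sum>j=1..J. \<bar>b j\<bar> * P (2 * j - 1) * k (s + real (2 * j) - 1))"
    using kn P0 by (intro sum_nonneg mult_nonneg_nonneg) auto
  have D0: "0 \<le> C * P (2 * J + 1) * (2 powr e / (e - 1))"
    using C_nonneg P0 e1 by (intro mult_nonneg_nonneg divide_nonneg_nonneg) auto
  have K0: "0 \<le> K" unfolding K_def using kn S0 D0 by (intro add_nonneg_nonneg)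
  moreover have "norm (dz_tail N (Complex \<sigma>1 t, Complex \<sigma>2 t)) \<le>
       K * (real N powr (1 - \<sigma>2) / X * (\<Sum>m=1..<N. real m powr (- \<sigma>1)) + real N powr (2 - \<sigma>1 - \<sigma>2) / X\<^sup>2)"
    if X: "1 \<le> X" "X \<le> real N" and t: "X \<le> t" "t \<le> 2 * X"
      and q: "(X / real N) ^ (2 * J + 1) \<le> real N powr (- \<bar>\<sigma>1\<bar>) / X\<^sup>2" for X N t
  proof -
    have N: "1 \<le> N" "0 < real N" using X by auto
    let ?s1 = "Complex \<sigma>1 t" and ?s2 = "Complex \<sigma>2 t"
    let ?A = "real N powr (1 - \<sigma>2) / X * (\<Sum>m=1..<N. real m powr (- \<sigma>1))" and ?B = "real N powr (2 - s) / X\<^sup>2"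
    have A0: "0 \<le> ?A" using X by (intro mult_nonneg_nonneg sum_nonneg) auto
    have B0: "0 \<le> ?B" by simp
    have "real N powr (- \<bar>\<sigma>1\<bar>) / X\<^sup>2 \<le> 1 / X"
    proof (rule frac_le)
      have "real N powr (- \<bar>\<sigma>1\<bar>) \<le> real N powr 0" using N by (intro powr_mono) auto
      then show "real N powr (- \<bar>\<sigma>1\<bar>) \<le> 1" using N by simp
      show "X \<le> X\<^sup>2" using X by (simp add: power2_eq_square)
    qed (use X in auto)
    with q have q1: "(X / real N) ^ (2 * J + 1) \<le> 1 / X" by linarith
    have re: "Re (?s1 + ?s2) = s" "Im (?s1 + ?s2) = 2 * t" by (simp_all add: s_def)
    have poch: "norm (pochhammer ?s2 i) \<le> P i * X ^ i" for i
      using norm_pochhammer_vertical_le[OF X(1), of ?s2 i] t X by (simp add: P_def)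
    have a1: "norm ((\<Sum>m=1..<N. of_nat m powr (- ?s1)) * zeta_tail ?s2 N) \<le> k \<sigma>2 * ?A"
    proof -
      have "norm (\<Sum>m=1..<N. of_nat m powr (- ?s1) :: complex) \<le> (\<Sum>m=1..<N. real m powr (- \<sigma>1))"
        by (rule order_trans[OF norm_sum]) simp
      moreover have "norm (zeta_tail ?s2 N) \<le> k \<sigma>2 * (real N powr (1 - \<sigma>2) / X)"
        using t X by (intro k[OF sJ(3) X q1]) auto
      ultimately have "norm ((\<Sum>m=1..<N. of_nat m powr (- ?s1)) * zeta_tail ?s2 N) \<le>
         (\<Sum>m=1..<N. real m powr (- \<sigma>1)) * (k \<sigma>2 * (real N powr (1 - \<sigma>2) / X))"
        unfolding norm_mult by (intro mult_mono sum_nonneg) auto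
      then show ?thesis by (simp add: mult_ac)
    qed
    have "X \<le> norm (?s2 - 1)" using abs_Im_le_cmod[of "?s2 - 1"] t X by simp
    then have "inverse (norm (?s2 - 1)) \<le> inverse X" using X by (intro le_imp_inverse_le) auto
    then have i: "norm (inverse (?s2 - 1)) \<le> 1 / X" by (simp add: norm_inverse divide_inverse)
    have a2: "norm (inverse (?s2 - 1) * zeta_tail (?s1 + ?s2 - 1) N) \<le> k (s - 1) * ?B"
    proof -
      have "norm (zeta_tail (?s1 + ?s2 - 1) N) \<le> k (s - 1) * (real N powr (1 - (s - 1)) / X)"
        using re t X by (intro k[OF sJ(1) X q1]) auto
      with i have "norm (inverse (?s2 - 1) * zeta_tail (?s1 + ?s2 - 1) N) \<le> 1 / X * (k (s - 1) * (real N powr (1 - (s - 1)) / X))"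
        unfolding norm_mult using X by (intro mult_mono) auto
      also have "\<dots> = k (s - 1) * ?B" by (simp add: power2_eq_square)
      finally show ?thesis .
    qed
    have a3: "norm (of_real (b j) * pochhammer ?s2 (2 * j - 1) * zeta_tail (?s1 + ?s2 + of_nat (2 * j) - 1) N)
        \<le> \<bar>b j\<bar> * P (2 * j - 1) * k (s + real (2 * j) - 1) * ?B" if j: "j \<in> {1..J}" for j
    proof -
      let ?kk = "k (s + real (2 * j) - 1)"
      have z: "norm (zeta_tail (?s1 + ?s2 + of_nat (2 * j) - 1) N) \<le> ?kk * (real N powr (1 - (s + real (2 * j) - 1)) / X)"
        using re t X by (intro k[OF sJ(4) X q1]) auto
      have "norm (of_real (b j) * pochhammer ?s2 (2 * j - 1) * zeta_tail (?s1 + ?s2 + of_nat (2 * j) - 1) N)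
         \<le> \<bar>b j\<bar> * (P (2 * j - 1) * X ^ (2 * j - 1)) * (?kk * (real N powr (1 - (s + real (2 * j) - 1)) / X))"
        unfolding norm_mult norm_of_real using X P0
        by (intro mult_mono poch z mult_nonneg_nonneg order.refl) auto
      also have "1 - (s + real (2 * j) - 1) = (2 - s) - real (2 * j)" by simp
      also have "\<bar>b j\<bar> * (P (2 * j - 1) * X ^ (2 * j - 1)) * (?kk * (real N powr ((2 - s) - real (2 * j)) / X))
         = \<bar>b j\<bar> * P (2 * j - 1) * ?kk * ((X ^ (2 * j - 1) * real N powr ((2 - s) - real (2 * j))) / X)"
        by simp
      also have "\<dots> \<le> \<bar>b j\<bar> * P (2 * j - 1) * ?kk * ((real N powr (2 - s) / X) / X)"
        using power_ratio_le[OF X, of j "2 - s"] j kn P0 X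
        by (intro mult_left_mono divide_right_mono mult_nonneg_nonneg) auto
      also have "(real N powr (2 - s) / X) / X = ?B" by (simp add: power2_eq_square)
      finally show ?thesis .
    qed
    have a4: "norm ((-1/2) * zeta_tail (?s1 + ?s2) N) \<le> k s * ?B"
    proof -
      have "norm (zeta_tail (?s1 + ?s2) N) \<le> k s * (real N powr (1 - s) / X)"
        using re t X by (intro k[OF sJ(2) X q1]) auto
      also have "real N powr (1 - s) = real N powr (2 - s) / real N"
        using N powr_diff[of "real N" "2 - s" 1] by simp
      also have "k s * (real N powr (2 - s) / real N / X) \<le> k s * (real N powr (2 - s) / X / X)"
        using X N kn by (intro mult_left_mono divide_right_mono divide_left_mono) auto
      also have "real N powr (2 - s) / X / X = ?B" by (simp add: power2_eq_square)
      finally have "norm (zeta_tail (?s1 + ?s2) N) \<le> k s * ?B" .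
      moreover have "norm ((-1/2) * zeta_tail (?s1 + ?s2) N) = norm (zeta_tail (?s1 + ?s2) N) / 2"
        by (simp add: norm_mult norm_divide)
      ultimately show ?thesis by (smt (verit) norm_ge_zero field_sum_of_halves)
    qed
    let ?p = "(?s1, ?s2)"
    let ?D = "C * (P (2 * J + 1) * X ^ (2 * J + 1))"
    have D: "norm (defect_series N n ?p) \<le> ?D * real (N + n) powr (- e)" for n
    proof -
      have s21: "?s2 \<noteq> 1" using t X by (auto simp: complex_eq_iff)
      have "norm (em_defect J b ?s2 (N + n)) \<le> C * norm (pochhammer ?s2 (2 * J + 1)) * real (N + n) powr (- (Re ?s2 + real (2 * J + 1)))"
        using s21 N assms by (intro norm_defect_le) auto
      also have "\<dots> \<le> ?D * real (N + n) powr (- (\<sigma>2 + real (2 * J + 1)))"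
        unfolding complex.sel by (intro mult_right_mono mult_left_mono poch C_nonneg) auto
      finally have "norm (defect_series N n ?p) \<le> ?D * real (N + n) powr (max 0 (- Re (fst ?p)) - \<sigma>2 - real (2 * J))"
        using C_nonneg P0 X N by (intro norm_defect_series_le) auto
      also have "max 0 (- Re (fst ?p)) - \<sigma>2 - real (2 * J) = - e" by (simp add: e_def)
      finally show ?thesis .
    qed
    have sD: "summable (\<lambda>n. ?D * real (N + n) powr (- e))"
      using summable_powr_tail[OF e1 N(1)] by (rule summable_mult)
    have sd: "summable (\<lambda>n. norm (defect_series N n ?p))"
      by (rule summable_comparison_test'[OF sD]) (use D in simp)
    have a5: "norm (\<Sum>n. defect_series N n ?p) \<le> C * P (2 * J + 1) * (2 powr e / (e - 1)) * ?B"
    proof -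
      have "norm (\<Sum>n. defect_series N n ?p) \<le> (\<Sum>n. norm (defect_series N n ?p))"
        by (rule summable_norm[OF sd])
      also have "\<dots> \<le> (\<Sum>n. ?D * real (N + n) powr (- e))"
        by (rule suminf_le[OF D sd sD])
      also have "\<dots> = ?D * (\<Sum>n. real (N + n) powr (- e))"
        by (rule suminf_mult[OF summable_powr_tail[OF e1 N(1)]])
      also have "\<dots> \<le> ?D * (2 powr e / (e - 1) * real N powr (1 - e))"
        using suminf_powr_tail_le[OF e1 N(1)] C_nonneg P0 X by (intro mult_left_mono mult_nonneg_nonneg) auto
      also have "\<dots> = C * P (2 * J + 1) * (2 powr e / (e - 1)) * (X ^ (2 * J + 1) * real N powr (1 - e))"
        by (simp only: mult.assoc mult.left_commute)
      also have "X ^ (2 * J + 1) * real N powr (1 - e) \<le> ?B"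
      proof -
        have "1 - e = (2 - \<sigma>2 + max 0 (- \<sigma>1)) - real (2 * J + 1)" by (simp add: e_def)
        then have "real N powr (1 - e) = real N powr (2 - \<sigma>2 + max 0 (- \<sigma>1)) / real N ^ (2 * J + 1)"
          using N by (simp only: powr_diff powr_realpow)
        then have "X ^ (2 * J + 1) * real N powr (1 - e) = real N powr (2 - \<sigma>2 + max 0 (- \<sigma>1)) * (X / real N) ^ (2 * J + 1)"
          by (simp add: power_divide)
        also have "\<dots> \<le> real N powr (2 - \<sigma>2 + max 0 (- \<sigma>1)) * (real N powr (- \<bar>\<sigma>1\<bar>) / X\<^sup>2)"
          using q by (intro mult_left_mono) auto
        also have "\<dots> = real N powr (2 - \<sigma>2 + max 0 (- \<sigma>1) + (- \<bar>\<sigma>1\<bar>)) / X\<^sup>2"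
          by (simp only: powr_add times_divide_eq_right)
        also have "\<dots> \<le> ?B"
          using N by (intro divide_right_mono powr_mono) (auto simp: s_def)
        finally show ?thesis .
      qed
      then have "C * P (2 * J + 1) * (2 powr e / (e - 1)) * (X ^ (2 * J + 1) * real N powr (1 - e))
         \<le> C * P (2 * J + 1) * (2 powr e / (e - 1)) * ?B"
        using D0 by (rule mult_left_mono)
      finally show ?thesis .
    qed
    have "norm (dz_tail N ?p) \<le> k \<sigma>2 * ?A + (k (s - 1) * ?B
        + (\<Sum>j=1..J. \<bar>b j\<bar> * P (2 * j - 1) * k (s + real (2 * j) - 1) * ?B)
        + k s * ?B + C * P (2 * J + 1) * (2 powr e / (e - 1)) * ?B)"
      unfolding dz_tail_def fst_conv snd_conv
      by (intro norm_triangle_mono a1 a2 a4 a5 order_trans[OF norm_sum] sum_mono a3)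
    also have "\<dots> = k \<sigma>2 * ?A + (K - k \<sigma>2) * ?B"
      unfolding K_def by (simp only: distrib_right sum_distrib_right add_diff_cancel_left' add.assoc)
    also have "\<dots> \<le> K * ?A + K * ?B"
      using kn S0 D0 A0 B0 unfolding K_def by (intro add_mono mult_right_mono) auto
    finally show ?thesis by (simp add: s_def distrib_left diff_diff_eq)
  qed
  ultimately show ?thesis by blast
qed

end

lemma vertical_in_dz_region:
  "t \<noteq> 0 \<Longrightarrow> c < \<sigma>2 \<Longrightarrow> c < \<sigma>1 + \<sigma>2 \<Longrightarrow> (Complex \<sigma>1 t, Complex \<sigma>2 t) \<in> dz_region c"
  by (auto simp: dz_region_def double_zeta_dom_def complex_eq_iff)

theorem double_zeta_approximation:
  assumes "0 < \<delta>"
  shows "\<exists>K\<ge>0. \<forall>X t N. 1 \<le> X \<longrightarrow> X \<le> t \<longrightarrow> t \<le> 2 * X \<longrightarrow> X powr (1 + \<delta>) \<le> real N \<longrightarrow> real N \<le> X ^ 3 \<longrightarrow>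
     norm (double_zeta (Complex \<sigma>1 t) (Complex \<sigma>2 t) - dz_partial N (Complex \<sigma>1 t) (Complex \<sigma>2 t)) \<le>
       K * (real N powr (1 - \<sigma>2) / X * (\<Sum>m=1..<N. real m powr (- \<sigma>1)) + real N powr (2 - \<sigma>1 - \<sigma>2) / X\<^sup>2)"
proof -
  \<comment> \<open>The lower bound on N gives X / N \<le> X powr (-\<delta>), and N \<le> X ^ 3
    gives N powr (- \<bar>\<sigma>1\<bar>) \<ge> X powr (- 3 * \<bar>\<sigma>1\<bar>). So the
    hypothesis of \<open>norm_dz_tail_le\<close> follows from \<delta> * (2 * J0 + 1) \<ge> 2 + 3 *
    \<bar>\<sigma>1\<bar>.\<close>
  obtain J0 :: nat where J0: "max (max ((2 + 3 * \<bar>\<sigma>1\<bar>) / \<delta>) 1) (max (2 - \<sigma>2) (2 - \<sigma>1 - \<sigma>2)) < real J0"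
    using reals_Archimedean2 by blast
  have J: "(2 + 3 * \<bar>\<sigma>1\<bar>) / \<delta> < real J0" "1 \<le> J0" "2 - real (2 * J0) < \<sigma>2" "2 - real (2 * J0) < \<sigma>1 + \<sigma>2"
    using J0 by auto
  have Jd: "2 + 3 * \<bar>\<sigma>1\<bar> \<le> \<delta> * real (2 * J0 + 1)"
  proof -
    have "2 + 3 * \<bar>\<sigma>1\<bar> \<le> \<delta> * real J0" using J(1) assms by (simp add: field_simps)
    also have "\<dots> \<le> \<delta> * real (2 * J0 + 1)" using assms by (intro mult_left_mono) auto
    finally show ?thesis .
  qed
  obtain b C where EM: "euler_maclaurin J0 b C" using ex_euler_maclaurin by blast
  interpret euler_maclaurin J0 b C by (rule EM)
  obtain K where K: "0 \<le> K" "\<And>X N t. 1 \<le> X \<Longrightarrow> X \<le> real N \<Longrightarrow> X \<le> t \<Longrightarrow> t \<le> 2 * X \<Longrightarrow>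
     (X / real N) ^ (2 * J0 + 1) \<le> real N powr (- \<bar>\<sigma>1\<bar>) / X\<^sup>2 \<Longrightarrow>
     norm (dz_tail N (Complex \<sigma>1 t, Complex \<sigma>2 t)) \<le>
       K * (real N powr (1 - \<sigma>2) / X * (\<Sum>m=1..<N. real m powr (- \<sigma>1)) + real N powr (2 - \<sigma>1 - \<sigma>2) / X\<^sup>2)"
    using norm_dz_tail_le[OF J(3,4)] by blast
  have "norm (double_zeta (Complex \<sigma>1 t) (Complex \<sigma>2 t) - dz_partial N (Complex \<sigma>1 t) (Complex \<sigma>2 t)) \<le>
       K * (real N powr (1 - \<sigma>2) / X * (\<Sum>m=1..<N. real m powr (- \<sigma>1)) + real N powr (2 - \<sigma>1 - \<sigma>2) / X\<^sup>2)"
    if X: "1 \<le> X" "X \<le> t" "t \<le> 2 * X" and N: "X powr (1 + \<delta>) \<le> real N" "real N \<le> X ^ 3" for X t N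
  proof -
    have "X powr 1 \<le> X powr (1 + \<delta>)" using X assms by (intro powr_mono) auto
    then have XN: "X \<le> real N" using X N by simp
    then have N0: "0 < real N" "1 \<le> N" using X by auto
    have "X / real N \<le> X / X powr (1 + \<delta>)" using X N N0 by (intro divide_left_mono) auto
    also have "\<dots> = X powr (-\<delta>)" using X by (simp add: powr_add powr_minus field_simps)
    finally have "(X / real N) ^ (2 * J0 + 1) \<le> (X powr (-\<delta>)) ^ (2 * J0 + 1)"
      using X N0 by (intro power_mono) auto
    also have "\<dots> = X powr (- (\<delta> * real (2 * J0 + 1)))"
      using X by (simp only: powr_realpow[symmetric] powr_powr powr_gt_zero) simp
    also have "\<dots> \<le> X powr (- (2 + 3 * \<bar>\<sigma>1\<bar>))"
      using X Jd by (intro powr_mono) auto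
    also have "\<dots> = (X ^ 3) powr (- \<bar>\<sigma>1\<bar>) / X\<^sup>2"
    proof -
      have "(X ^ 3) powr (- \<bar>\<sigma>1\<bar>) = X powr (- (3 * \<bar>\<sigma>1\<bar>))"
      proof -
        have "X ^ 3 = X powr 3" using X powr_realpow[of X 3] by simp
        then show ?thesis by (simp only: powr_powr) simp
      qed
      moreover have "X\<^sup>2 = X powr 2" using X powr_realpow[of X 2] by simp
      moreover have "- (2 + 3 * \<bar>\<sigma>1\<bar>) = - (3 * \<bar>\<sigma>1\<bar>) - 2" by simp
      ultimately show ?thesis by (simp only: powr_diff)
    qed
    also have "\<dots> \<le> real N powr (- \<bar>\<sigma>1\<bar>) / X\<^sup>2"
      using N N0 by (intro divide_right_mono powr_mono2') auto
    finally have "norm (dz_tail N (Complex \<sigma>1 t, Complex \<sigma>2 t)) \<le>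
       K * (real N powr (1 - \<sigma>2) / X * (\<Sum>m=1..<N. real m powr (- \<sigma>1)) + real N powr (2 - \<sigma>1 - \<sigma>2) / X\<^sup>2)"
      using X XN by (intro K(2)) auto
    moreover have "double_zeta (Complex \<sigma>1 t) (Complex \<sigma>2 t) = dz_cont N (Complex \<sigma>1 t, Complex \<sigma>2 t)"
      using X N0 J by (intro double_zeta_eq_dz_cont vertical_in_dz_region) auto
    ultimately show ?thesis by (simp add: dz_cont_def)
  qed
  with K(1) show ?thesis by blast
qed

section \<open>The divisor bound\<close>

definition num_divisors :: "nat \<Rightarrow> nat" where
  "num_divisors n = card {d. d dvd n}"

lemma num_divisors_mult_le:
  assumes "0 < a" "0 < b"
  shows "num_divisors (a * b) \<le> num_divisors a * num_divisors b"
proof -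
  have fin: "finite {d. d dvd a}" "finite {d. d dvd b}" using assms by auto
  have "{d. d dvd a * b} \<subseteq> (\<lambda>(x, y). x * y) ` ({d. d dvd a} \<times> {d. d dvd b})"
  proof
    fix x assume "x \<in> {d. d dvd a * b}"
    then obtain y z where "x = y * z" "y dvd a" "z dvd b" using division_decomp[of x a b] by auto
    then show "x \<in> (\<lambda>(x, y). x * y) ` ({d. d dvd a} \<times> {d. d dvd b})"
      by (intro image_eqI[of _ _ "(y, z)"]) simp_all
  qed
  then have "num_divisors (a * b) \<le> card ({d. d dvd a} \<times> {d. d dvd b})"
    unfolding num_divisors_def by (rule surj_card_le[rotated]) (use fin in simp)
  then show ?thesis by (simp add: num_divisors_def card_cartesian_product)
qed

lemma num_divisors_prime_power:
  assumes "prime (p :: nat)"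
  shows "num_divisors (p ^ k) = Suc k"
proof -
  have "{d. d dvd p ^ k} = (\<lambda>i. p ^ i) ` {..k}"
    using assms by (auto simp: divides_primepow_nat)
  moreover have "inj_on (\<lambda>i. p ^ i) {..k}"
    using assms prime_gt_1_nat by (intro inj_onI) (simp add: power_inject_exp)
  ultimately show ?thesis by (simp add: num_divisors_def card_image)
qed

text \<open>Bernoulli's inequality. It serves to bound the a + 1 divisors of q ^ a for a small prime
  q, where q powr e may lie below 2.\<close>

lemma linear_le_powr:
  assumes "0 < (e :: real)"
  shows "\<exists>K>0. \<forall>a::nat. real (Suc a) \<le> K * (2 powr e) ^ a"
proof -
  define x where "x = 2 powr e - 1"
  have x: "0 < x" using assms by (simp add: x_def)
  have "real (Suc a) \<le> (1 + 1 / x) * (2 powr e) ^ a" for a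
  proof -
    have "1 + real a * x \<le> (1 + x) ^ a" using Bernoulli_inequality[of x a] x by simp
    then have "1 + real a * x \<le> (2 powr e) ^ a" by (simp add: x_def)
    moreover have "1 \<le> (2 powr e) ^ a" using assms by (simp add: ge_one_powr_ge_zero)
    ultimately have "1 * 1 + (1 / x) * (real a * x) \<le> 1 * (2 powr e) ^ a + (1 / x) * (2 powr e) ^ a"
      using x by (intro add_mono mult_left_mono) auto
    then show ?thesis using x by (simp add: field_simps)
  qed
  moreover have "0 < 1 + 1 / x" using x by (simp add: add_pos_pos)
  ultimately show ?thesis by blast
qed

text \<open>Downward induction on a lower bound \<open>q\<close> for the prime factors. Primes with
  \<open>p powr e \<ge> 2\<close> cost nothing, so that only finitely many primes contribute to the
  constant.\<close>

lemma num_divisors_le_powr: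
  assumes e: "0 < (e :: real)"
  shows "\<exists>C>0. \<forall>n>0. real (num_divisors n) \<le> C * real n powr e"
proof -
  define Q where "Q q \<longleftrightarrow> (\<exists>C>0. \<forall>n>0. (\<forall>p. prime p \<longrightarrow> p dvd n \<longrightarrow> q \<le> p) \<longrightarrow> real (num_divisors n) \<le> C * real n powr e)"
    for q :: nat
  \<comment> \<open>For primes p \<ge> P one has p powr e \<ge> 2: each such factor at most doubles
    the number of divisors while n powr e at least doubles, so the constant there is 1.\<close>
  obtain P :: nat where P: "2 powr (1 / e) < real P" using reals_Archimedean2 by blast
  have step: "Q q" if "Q (Suc q)" for q
  proof (cases "prime q")
    case False
    then have *: "(q \<le> p) = (Suc q \<le> p)" if "prime p" for p :: nat
      using that by (cases "p = q") auto
    from that show ?thesis unfolding Q_def using * by metis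
  next
    case True
    obtain C where C: "C > 0" "\<And>n. 0 < n \<Longrightarrow> (\<And>p. prime p \<Longrightarrow> p dvd n \<Longrightarrow> Suc q \<le> p) \<Longrightarrow> real (num_divisors n) \<le> C * real n powr e"
      using \<open>Q (Suc q)\<close> unfolding Q_def by blast
    \<comment> \<open>The prime q costs one factor \<open>K\<close>, whatever its multiplicity in
      n.\<close>
    obtain K where K: "K > 0" "\<And>a::nat. real (Suc a) \<le> K * (2 powr e) ^ a" using linear_le_powr[OF e] by blast
    have "real (num_divisors n) \<le> (K * C) * real n powr e"
      if n: "0 < n" and pn: "\<And>p. prime p \<Longrightarrow> p dvd n \<Longrightarrow> q \<le> p" for n
    proof -
      obtain a m where nm: "n = q ^ a * m" "\<not> q dvd m"
        using prime_power_canonical[OF True n] by (auto simp: mult.commute)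
      have m: "0 < m" using n nm by (cases m) auto
      have q2: "2 \<le> q" using True by (rule prime_ge_2_nat)
      have "Suc q \<le> p" if "prime p" "p dvd m" for p
        using pn[of p] that nm by (cases "p = q") (auto simp: le_less)
      then have m': "real (num_divisors m) \<le> C * real m powr e" using C(2)[OF m] by blast
      have "(2 powr e) ^ a \<le> (real q powr e) ^ a"
        using q2 e by (intro power_mono powr_mono2) auto
      also have "\<dots> = real (q ^ a) powr e"
        using q2 by (simp add: powr_power powr_powr mult.commute flip: powr_realpow)
      finally have "K * (2 powr e) ^ a \<le> K * real (q ^ a) powr e" using K by simp
      then have a: "real (Suc a) \<le> K * real (q ^ a) powr e" using K(2)[of a] by linarith
      have "real (num_divisors n) \<le> real (num_divisors (q ^ a)) * real (num_divisors m)"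
        unfolding nm(1) using num_divisors_mult_le[of "q ^ a" m] m q2
        by (metis of_nat_le_iff of_nat_mult less_le_trans pos2 zero_less_power)
      also have "\<dots> \<le> (K * real (q ^ a) powr e) * (C * real m powr e)"
        using a m' K C by (intro mult_mono) (auto simp: num_divisors_prime_power[OF True])
      also have "\<dots> = (K * C) * real n powr e"
        by (simp add: nm powr_mult)
      finally show ?thesis .
    qed
    moreover have "0 < K * C" using K C by simp
    ultimately show ?thesis unfolding Q_def by blast
  qed
  have QP: "Q P"
  proof -
    have "real (num_divisors n) \<le> real n powr e"
      if "0 < n" "\<And>p. prime p \<Longrightarrow> p dvd n \<Longrightarrow> P \<le> p" for n
      using that
    proof (induction n rule: less_induct)
      case (less n)
      show ?case
      proof (cases "n = 1")
        case False
        then obtain p where p: "prime p" "p dvd n" using prime_factor_nat by blast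
        then obtain m where nm: "n = p * m" by (auto elim: dvdE)
        have p2: "2 \<le> p" using p by (simp add: prime_ge_2_nat)
        have m0: "0 < m" using less.prems(1) nm by (cases m) simp_all
        moreover have "m < n" using m0 p2 nm by simp
        ultimately have m: "0 < m" "m < n" by simp_all
        have IH: "real (num_divisors m) \<le> real m powr e"
          using less.IH[OF m(2,1)] less.prems(2) nm by simp
        have "2 powr (1 / e) \<le> real p" using less.prems(2)[OF p] P by linarith
        then have "(2 powr (1 / e)) powr e \<le> real p powr e" using e by (intro powr_mono2) auto
        then have 2: "2 \<le> real p powr e" using e by (simp add: powr_powr)
        have "num_divisors n \<le> 2 * num_divisors m"
          using num_divisors_mult_le[of p m] num_divisors_prime_power[OF p(1), of 1] m p2 nm by simp
        then have "real (num_divisors n) \<le> 2 * real (num_divisors m)"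
          by (metis of_nat_le_iff of_nat_mult of_nat_numeral)
        also have "\<dots> \<le> real p powr e * real m powr e" using 2 IH by (intro mult_mono) auto
        also have "\<dots> = real n powr e" by (simp add: nm powr_mult)
        finally show ?thesis .
      qed (simp add: num_divisors_def)
    qed
    then show ?thesis unfolding Q_def by (intro exI[of _ 1]) auto
  qed
  have "Q (P - k)" for k
  proof (induction k)
    case (Suc k)
    show ?case
    proof (cases "k < P")
      case True
      then have "P - k = Suc (P - Suc k)" by simp
      with Suc step show ?thesis by metis
    qed (use Suc in simp)
  qed (use QP in simp)
  from this[of P] show ?thesis unfolding Q_def by simp
qed

section \<open>Mean values of Dirichlet polynomials\<close>

lemma has_integral_cis:
  fixes x :: real
  assumes "x \<noteq> 0" "A \<le> B"
  shows "((\<lambda>t. cis (x * t)) has_integral (cis (x * B) - cis (x * A)) / (\<i> * of_real x)) {A..B}"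
proof -
  have "((\<lambda>t. cis (x * t) / (\<i> * of_real x)) has_vector_derivative cis (x * t)) (at t within {A..B})" for t
  proof -
    have d: "((\<lambda>t. exp (of_real t * (\<i> * of_real x))) has_vector_derivative
        (\<i> * of_real x) * exp (of_real t * (\<i> * of_real x))) (at t within {A..B})"
      using exp_scaleR_has_vector_derivative_right[of "\<i> * of_real x" t "{A..B}"]
      by (simp add: scaleR_conv_of_real mult.commute)
    have e: "exp (of_real t * (\<i> * of_real x)) = cis (x * t)" for t
      by (simp add: cis_conv_exp mult_ac)
    have "((\<lambda>t. inverse (\<i> * of_real x) * cis (x * t)) has_vector_derivative
       inverse (\<i> * of_real x) * ((\<i> * of_real x) * cis (x * t))) (at t within {A..B})"
      using d unfolding e by (rule has_vector_derivative_mult_right)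
    moreover have "inverse (\<i> * of_real x) * ((\<i> * of_real x) * cis (x * t)) = cis (x * t)"
    proof -
      have cancel: "inverse z * (z * w) = w" if "z \<noteq> 0" for z w :: complex
        using that by (simp add: mult.assoc[symmetric])
      show ?thesis by (rule cancel) (use assms in simp)
    qed
    ultimately show ?thesis by (simp add: divide_inverse mult.commute)
  qed
  then have "((\<lambda>t. cis (x * t)) has_integral cis (x * B) / (\<i> * of_real x) - cis (x * A) / (\<i> * of_real x)) {A..B}"
    using assms by (intro fundamental_theorem_of_calculus) auto
  then show ?thesis by (simp add: diff_divide_distrib)
qed

lemma norm_integral_cis_le:
  fixes x :: real
  assumes "x \<noteq> 0" "A \<le> B"
  shows "norm (integral {A..B} (\<lambda>t. cis (x * t))) \<le> 2 / \<bar>x\<bar>"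
proof -
  have "norm (cis (x * B) - cis (x * A)) \<le> 1 + 1"
    by (rule order_trans[OF norm_triangle_ineq4]) simp
  then have "norm ((cis (x * B) - cis (x * A)) / (\<i> * of_real x)) \<le> 2 / \<bar>x\<bar>"
    using assms by (simp add: norm_divide norm_mult divide_right_mono)
  then show ?thesis
    using integral_unique[OF has_integral_cis[OF assms]] by simp
qed

text \<open>The \<open>cis\<close> factor is k powr (- \<i> * t) for k > 0. Real coefficients
  suffice because s1 and s2 share the imaginary part t.\<close>

definition dirichlet_poly :: "nat set \<Rightarrow> (nat \<Rightarrow> real) \<Rightarrow> real \<Rightarrow> complex" where
  "dirichlet_poly K c t = (\<Sum>k\<in>K. of_real (c k) * cis (- (ln (real k) * t)))"

lemma of_nat_powr_imaginary:
  "0 < k \<Longrightarrow> of_nat k powr (- (of_real a + \<i> * of_real t)) = of_real (real k powr (-a)) * cis (- (ln (real k) * t))"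
proof -
  assume k: "0 < k"
  have "of_nat k powr (- (of_real a + \<i> * of_real t)) = (complex_of_real (real k) powr of_real (-a)) * complex_of_real (real k) powr (- (\<i> * of_real t))"
    by (simp add: powr_add[symmetric])
  also have "complex_of_real (real k) powr of_real (-a) = of_real (real k powr (-a))"
    using k by (subst powr_of_real) auto
  also have "complex_of_real (real k) powr (- (\<i> * of_real t)) = cis (- (ln (real k) * t))"
    using k by (simp add: powr_def cis_conv_exp Ln_of_nat mult_ac)
  finally show ?thesis .
qed

lemma continuous_on_dirichlet_poly [continuous_intros]:
  "continuous_on A (dirichlet_poly K c)"
  unfolding dirichlet_poly_def[abs_def] by (intro continuous_intros)

lemma norm_dirichlet_poly_le: "norm (dirichlet_poly K c t) \<le> (\<Sum>k\<in>K. \<bar>c k\<bar>)"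
  unfolding dirichlet_poly_def by (rule order_trans[OF norm_sum]) (simp add: norm_mult)

text \<open>Termwise integration: equal frequencies give the length of the interval, different ones
  an oscillating integral of size at most 2 over the distance of the logarithms. Two index sets are
  kept apart because the lower bound on the critical line pairs a long polynomial with a short
  one.\<close>

lemma dirichlet_poly_inner_product:
  assumes K: "finite K" "0 \<notin> K" and L: "finite L" "0 \<notin> L" and AB: "A \<le> B"
  shows "norm (integral {A..B} (\<lambda>t. dirichlet_poly K c t * cnj (dirichlet_poly L d t))
      - of_real ((B - A) * (\<Sum>k\<in>K \<inter> L. c k * d k)))
    \<le> (\<Sum>k\<in>K. \<Sum>l\<in>L - {k}. \<bar>c k\<bar> * \<bar>d l\<bar> * (2 / \<bar>ln (real k) - ln (real l)\<bar>))"
proof -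
  define f where "f k l t = of_real (c k * d l) * cis ((ln (real l) - ln (real k)) * t)" for k l t
  have fI: "f k l integrable_on {A..B}" for k l
    unfolding f_def[abs_def] by (intro integrable_continuous_interval continuous_intros)
  have eq: "dirichlet_poly K c t * cnj (dirichlet_poly L d t) = (\<Sum>k\<in>K. \<Sum>l\<in>L. f k l t)" for t
    unfolding dirichlet_poly_def cnj_sum sum_product
    by (intro sum.cong refl) (simp add: f_def cis_cnj cis_mult algebra_simps)
  have int: "integral {A..B} (\<lambda>t. dirichlet_poly K c t * cnj (dirichlet_poly L d t)) =
      (\<Sum>k\<in>K. \<Sum>l\<in>L. integral {A..B} (f k l))"
    unfolding eq using K L fI
    by (subst integral_sum; (intro integrable_sum fI)?; simp add: integral_sum)+
  have diag: "integral {A..B} (f k k) = of_real ((B - A) * (c k * d k))" for k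
    using AB by (simp add: f_def[abs_def] scaleR_conv_of_real)
  have off: "norm (integral {A..B} (f k l)) \<le> \<bar>c k\<bar> * \<bar>d l\<bar> * (2 / \<bar>ln (real k) - ln (real l)\<bar>)"
    if "k \<in> K" "l \<in> L" "k \<noteq> l" for k l
  proof -
    have "0 < k" "0 < l" using that K L by (metis gr0I)+
    then have "ln (real l) - ln (real k) \<noteq> 0" using that by simp
    from norm_integral_cis_le[OF this AB]
    have "norm (integral {A..B} (\<lambda>t. cis ((ln (real l) - ln (real k)) * t))) \<le> 2 / \<bar>ln (real k) - ln (real l)\<bar>"
      by (simp add: abs_minus_commute)
    then have "\<bar>c k * d l\<bar> * norm (integral {A..B} (\<lambda>t. cis ((ln (real l) - ln (real k)) * t))) \<le> \<bar>c k * d l\<bar> * (2 / \<bar>ln (real k) - ln (real l)\<bar>)"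
      by (rule mult_left_mono) simp
    then show ?thesis by (simp add: f_def[abs_def] norm_mult abs_mult)
  qed
  have split: "(\<Sum>l\<in>L. integral {A..B} (f k l)) =
      (if k \<in> L then of_real ((B - A) * (c k * d k)) else 0) + (\<Sum>l\<in>L - {k}. integral {A..B} (f k l))" for k
    using L by (cases "k \<in> L") (simp_all add: sum.remove[of L k] diag)
  have "integral {A..B} (\<lambda>t. dirichlet_poly K c t * cnj (dirichlet_poly L d t)) =
     (\<Sum>k\<in>K. if k \<in> L then of_real ((B - A) * (c k * d k)) else 0) + (\<Sum>k\<in>K. \<Sum>l\<in>L - {k}. integral {A..B} (f k l))"
    unfolding int split by (rule sum.distrib)
  also have "(\<Sum>k\<in>K. if k \<in> L then of_real ((B - A) * (c k * d k)) else 0) = of_real ((B - A) * (\<Sum>k\<in>K \<inter> L. c k * d k))"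
    using K by (simp add: sum.inter_restrict sum_distrib_left of_real_sum if_distrib cong: if_cong)
  finally have "integral {A..B} (\<lambda>t. dirichlet_poly K c t * cnj (dirichlet_poly L d t))
      - of_real ((B - A) * (\<Sum>k\<in>K \<inter> L. c k * d k)) = (\<Sum>k\<in>K. \<Sum>l\<in>L - {k}. integral {A..B} (f k l))"
    by simp
  then show ?thesis
    by (simp only:) (intro order_trans[OF norm_sum] sum_mono off; blast)
qed

lemma dirichlet_poly_mean_square:
  assumes K: "finite K" "0 \<notin> K" and AB: "A \<le> B"
  shows "\<bar>integral {A..B} (\<lambda>t. (norm (dirichlet_poly K c t))\<^sup>2) - (B - A) * (\<Sum>k\<in>K. (c k)\<^sup>2)\<bar>
    \<le> (\<Sum>k\<in>K. \<Sum>l\<in>K - {k}. \<bar>c k\<bar> * \<bar>c l\<bar> * (2 / \<bar>ln (real k) - ln (real l)\<bar>))"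
proof -
  have "integral {A..B} (\<lambda>t. dirichlet_poly K c t * cnj (dirichlet_poly K c t)) =
     integral {A..B} (\<lambda>t. complex_of_real ((norm (dirichlet_poly K c t))\<^sup>2))"
    by (simp only: complex_norm_square)
  also have "\<dots> = of_real (integral {A..B} (\<lambda>t. (norm (dirichlet_poly K c t))\<^sup>2))"
  proof (rule integral_unique)
    have "((\<lambda>t. (norm (dirichlet_poly K c t))\<^sup>2) has_integral integral {A..B} (\<lambda>t. (norm (dirichlet_poly K c t))\<^sup>2)) {A..B}"
      by (intro integrable_integral integrable_continuous_interval continuous_intros)
    from has_integral_linear[OF this bounded_linear_of_real]
    show "((\<lambda>t. complex_of_real ((norm (dirichlet_poly K c t))\<^sup>2)) has_integral
        of_real (integral {A..B} (\<lambda>t. (norm (dirichlet_poly K c t))\<^sup>2))) {A..B}"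
      by (simp only: o_def)
  qed
  finally have "integral {A..B} (\<lambda>t. dirichlet_poly K c t * cnj (dirichlet_poly K c t)) =
    of_real (integral {A..B} (\<lambda>t. (norm (dirichlet_poly K c t))\<^sup>2))" .
  then have "integral {A..B} (\<lambda>t. dirichlet_poly K c t * cnj (dirichlet_poly K c t)) - of_real ((B - A) * (\<Sum>k\<in>K \<inter> K. c k * c k))
     = of_real (integral {A..B} (\<lambda>t. (norm (dirichlet_poly K c t))\<^sup>2) - (B - A) * (\<Sum>k\<in>K. (c k)\<^sup>2))"
    by (simp add: power2_eq_square)
  with dirichlet_poly_inner_product[OF K K AB, of c c] show ?thesis
    by (simp only: norm_of_real)
qed

section \<open>Estimates for off-diagonal sums\<close>

lemma inverse_ln_diff_le:
  assumes "0 < k" "k < l"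
  shows "1 / \<bar>ln (real k) - ln (real l)\<bar> \<le> 1 + real k / real (l - k)"
    "1 / \<bar>ln (real l) - ln (real k)\<bar> \<le> 1 + real k / real (l - k)"
proof -
  have kl: "0 < real k" "real k < real l" using assms by auto
  \<comment> \<open>From ln x \<le> x - 1 one gets ln (l / k) \<ge> (l - k) / l, and l / (l - k) = 1
    + k / (l - k): the first summand serves distant pairs, the second close ones.\<close>
  have "ln (real k / real l) \<le> real k / real l - 1" using kl by (intro ln_le_minus_one) auto
  then have "(real l - real k) / real l \<le> ln (real l) - ln (real k)"
    using kl by (simp add: ln_div diff_divide_distrib)
  moreover have "0 < (real l - real k) / real l" using kl by simp
  ultimately have "1 / (ln (real l) - ln (real k)) \<le> 1 / ((real l - real k) / real l)"
    by (intro divide_left_mono mult_pos_pos) auto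
  also have "\<dots> = 1 + real k / real (l - k)"
    using kl assms by (simp add: of_nat_diff field_simps)
  finally show "1 / \<bar>ln (real k) - ln (real l)\<bar> \<le> 1 + real k / real (l - k)"
    "1 / \<bar>ln (real l) - ln (real k)\<bar> \<le> 1 + real k / real (l - k)"
    using kl by (simp_all add: abs_if)
qed

lemma sum_inverse_distance_le:
  assumes "K \<subseteq> {1..M}" "k \<in> K"
  shows "(\<Sum>l\<in>K - {k}. 1 / \<bar>real k - real l\<bar>) \<le> 2 * harm M"
proof -
  have k: "1 \<le> k" "k \<le> M" using assms by auto
  have "(\<Sum>l\<in>K - {k}. 1 / \<bar>real k - real l\<bar>) \<le> (\<Sum>l\<in>{1..<k} \<union> {k<..M}. 1 / \<bar>real k - real l\<bar>)"
    using assms by (intro sum_mono2) (auto simp: subset_iff)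
  also have "\<dots> = (\<Sum>l\<in>{1..<k}. 1 / \<bar>real k - real l\<bar>) + (\<Sum>l\<in>{k<..M}. 1 / \<bar>real k - real l\<bar>)"
    by (intro sum.union_disjoint) auto
  also have "(\<Sum>l\<in>{1..<k}. 1 / \<bar>real k - real l\<bar>) = (\<Sum>h\<in>{1..<k}. inverse (real h))"
    by (intro sum.reindex_bij_witness[of _ "\<lambda>h. k - h" "\<lambda>l. k - l"]) (auto simp: of_nat_diff divide_inverse)
  also have "\<dots> \<le> harm M"
    unfolding harm_def using k by (intro sum_mono2) auto
  also have "(\<Sum>l\<in>{k<..M}. 1 / \<bar>real k - real l\<bar>) = (\<Sum>h\<in>{1..M - k}. inverse (real h))"
    by (intro sum.reindex_bij_witness[of _ "\<lambda>h. h + k" "\<lambda>l. l - k"]) (auto simp: of_nat_diff divide_inverse)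
  also have "\<dots> \<le> harm M"
    unfolding harm_def using k by (intro sum_mono2) auto
  finally show ?thesis by simp
qed

text \<open>A weak form of the Montgomery--Vaughan inequality; losing a logarithm is harmless here.\<close>

lemma hilbert_sum_le:
  assumes K: "K \<subseteq> {1..M}" and c: "\<And>k. k \<in> K \<Longrightarrow> 0 \<le> c k"
  shows "(\<Sum>k\<in>K. \<Sum>l\<in>K - {k}. \<bar>c k\<bar> * \<bar>c l\<bar> * (2 / \<bar>ln (real k) - ln (real l)\<bar>))
    \<le> 2 * (\<Sum>k\<in>K. c k)\<^sup>2 + 4 * harm M * (\<Sum>k\<in>K. real k * (c k)\<^sup>2)"
proof -
  have fin: "finite K" using K by (rule finite_subset) simp
  let ?q = "\<lambda>k. real k * (c k)\<^sup>2"
  have pair: "\<bar>c k\<bar> * \<bar>c l\<bar> * (2 / \<bar>ln (real k) - ln (real l)\<bar>) \<le>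
      2 * (c k * c l) + ?q k * (1 / \<bar>real k - real l\<bar>) + ?q l * (1 / \<bar>real l - real k\<bar>)"
    if kl: "k \<in> K" "l \<in> K" "k \<noteq> l" for k l
  proof -
    have aux: "c i * c j * (2 / \<bar>ln (real k) - ln (real l)\<bar>) \<le>
      2 * (c i * c j) + (?q i + ?q j) * (1 / \<bar>real k - real l\<bar>)"
      if ij: "i \<in> K" "j \<in> K" "i < j" "{i, j} = {k, l}" for i j
    proof -
      have pos: "0 < i" "0 \<le> c i" "0 \<le> c j" using ij K c by auto
      have "1 / \<bar>ln (real k) - ln (real l)\<bar> \<le> 1 + real i / real (j - i)"
        using inverse_ln_diff_le[OF pos(1) ij(3)] ij(4) by (auto simp: doubleton_eq_iff)
      then have "c i * c j * 2 * (1 / \<bar>ln (real k) - ln (real l)\<bar>) \<le> c i * c j * 2 * (1 + real i / real (j - i))"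
        using pos by (intro mult_left_mono) auto
      also have "\<dots> = 2 * (c i * c j) + (2 * c i * c j * real i) * (1 / real (j - i))"
        by (simp add: algebra_simps)
      \<comment> \<open>The arithmetic-geometric mean inequality with the smaller index i as weight;
        raising i to j on the second square makes the bound symmetric in the pair.\<close>
      also have "\<dots> \<le> 2 * (c i * c j) + (?q i + ?q j) * (1 / real (j - i))"
      proof -
        have "0 \<le> real i * (c i - c j)\<^sup>2" by simp
        then have "2 * c i * c j * real i \<le> real i * (c i)\<^sup>2 + real i * (c j)\<^sup>2"
          by (simp add: power2_diff algebra_simps)
        also have "\<dots> \<le> ?q i + ?q j" using ij by (intro add_mono mult_right_mono) auto
        finally show ?thesis by (intro add_left_mono mult_right_mono) auto
      qed
      also have "1 / real (j - i) = 1 / \<bar>real k - real l\<bar>"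
        using ij by (auto simp: doubleton_eq_iff of_nat_diff)
      finally show ?thesis by simp
    qed
    have "c k * c l * (2 / \<bar>ln (real k) - ln (real l)\<bar>) \<le>
      2 * (c k * c l) + (?q k + ?q l) * (1 / \<bar>real k - real l\<bar>)"
      using aux[of k l] aux[of l k] kl
      by (cases "k < l") (auto simp: insert_commute mult.commute add.commute)
    moreover have "\<bar>real l - real k\<bar> = \<bar>real k - real l\<bar>" by (rule abs_minus_commute)
    ultimately show ?thesis using c[OF kl(1)] c[OF kl(2)] by (simp add: add_divide_distrib)
  qed
  have "(\<Sum>k\<in>K. \<Sum>l\<in>K - {k}. \<bar>c k\<bar> * \<bar>c l\<bar> * (2 / \<bar>ln (real k) - ln (real l)\<bar>)) \<le>
     (\<Sum>k\<in>K. \<Sum>l\<in>K - {k}. 2 * (c k * c l) + ?q k * (1 / \<bar>real k - real l\<bar>) + ?q l * (1 / \<bar>real l - real k\<bar>))"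
    by (intro sum_mono pair) auto
  also have "\<dots> = (\<Sum>k\<in>K. \<Sum>l\<in>K - {k}. 2 * (c k * c l)) + (\<Sum>k\<in>K. \<Sum>l\<in>K - {k}. ?q k * (1 / \<bar>real k - real l\<bar>))
     + (\<Sum>k\<in>K. \<Sum>l\<in>K - {k}. ?q l * (1 / \<bar>real l - real k\<bar>))"
    by (simp only: sum.distrib)
  also have "(\<Sum>k\<in>K. \<Sum>l\<in>K - {k}. ?q l * (1 / \<bar>real l - real k\<bar>)) = (\<Sum>k\<in>K. \<Sum>l\<in>K - {k}. ?q k * (1 / \<bar>real k - real l\<bar>))"
  proof -
    have r: "K - {k} = {l\<in>K. k \<noteq> l}" for k by auto
    show ?thesis
      unfolding r by (subst sum.swap_restrict[OF fin fin]) (intro sum.cong; auto)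
  qed
  also have "(\<Sum>k\<in>K. \<Sum>l\<in>K - {k}. ?q k * (1 / \<bar>real k - real l\<bar>)) \<le> (\<Sum>k\<in>K. ?q k * (2 * harm M))"
    unfolding sum_distrib_left[symmetric]
    by (intro sum_mono mult_left_mono sum_inverse_distance_le K) auto
  also have "(\<Sum>k\<in>K. \<Sum>l\<in>K - {k}. 2 * (c k * c l)) \<le> (\<Sum>k\<in>K. \<Sum>l\<in>K. 2 * (c k * c l))"
    using c fin by (intro sum_mono sum_mono2) auto
  also have "(\<Sum>k\<in>K. \<Sum>l\<in>K. 2 * (c k * c l)) = 2 * (\<Sum>k\<in>K. \<Sum>l\<in>K. c k * c l)"
    by (simp only: sum_distrib_left)
  also have "(\<Sum>k\<in>K. \<Sum>l\<in>K. c k * c l) = (\<Sum>k\<in>K. c k)\<^sup>2"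
    by (simp only: power2_eq_square sum_product)
  finally show ?thesis
    by (simp only: sum_distrib_right[symmetric]) (simp add: algebra_simps)
qed

text \<open>For i < j the singular factor can be traded: i / (j - i) * j powr (-p) \<le> (j - i)
  powr (-p). Close pairs thus form a convolution of two convergent series, and neither a logarithm
  nor the length of the sum enters. This is the source of the error O(1) in the region of absolute
  convergence.\<close>

lemma hilbert_sum_bounded:
  assumes p: "1 < p" and Z: "summable (\<lambda>n. real (Suc n) powr (-p))"
    and K: "finite K" "0 \<notin> K" and c: "\<And>k. k \<in> K \<Longrightarrow> 0 \<le> c k" "\<And>k. k \<in> K \<Longrightarrow> c k \<le> A * real k powr (-p)"
    and A: "0 \<le> A"
  shows "(\<Sum>k\<in>K. \<Sum>l\<in>K - {k}. \<bar>c k\<bar> * \<bar>c l\<bar> * (2 / \<bar>ln (real k) - ln (real l)\<bar>))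
    \<le> 6 * A\<^sup>2 * (\<Sum>n. real (Suc n) powr (-p))\<^sup>2"
proof -
  define S where "S = (\<Sum>n. real (Suc n) powr (-p))"
  let ?z = "\<lambda>k. real k powr (-p)"
  have zsum: "(\<Sum>k\<in>I. ?z k) \<le> S" if "finite I" "0 \<notin> I" for I
  proof -
    have "(\<Sum>k\<in>I. ?z k) = (\<Sum>n\<in>(\<lambda>k. k - 1) ` I. real (Suc n) powr (-p))"
    proof (subst sum.reindex)
      show "inj_on (\<lambda>k. k - 1) I"
        using that by (intro inj_onI) (metis One_nat_def Suc_pred gr0I)
      show "(\<Sum>k\<in>I. ?z k) = sum ((\<lambda>n. real (Suc n) powr (-p)) \<circ> (\<lambda>k. k - 1)) I"
        using that by (intro sum.cong refl) (metis One_nat_def Suc_pred comp_apply gr0I)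
    qed
    also have "\<dots> \<le> S" unfolding S_def using that by (intro sum_le_suminf Z) auto
    finally show ?thesis .
  qed
  have S0: "0 \<le> S" using zsum[of "{}"] by simp
  \<comment> \<open>The traded bound made symmetric: the smaller index and the distance, each to the
    power -p.\<close>
  define g where "g k l = (if k < l then ?z k * ?z (l - k) else ?z l * ?z (k - l))" for k l
  have pair: "\<bar>c k\<bar> * \<bar>c l\<bar> * (2 / \<bar>ln (real k) - ln (real l)\<bar>) \<le> 2 * A\<^sup>2 * (?z k * ?z l + g k l)"
    if kl: "k \<in> K" "l \<in> K" "k \<noteq> l" for k l
  proof -
    have aux: "1 / \<bar>ln (real k) - ln (real l)\<bar> * (?z i * ?z j) \<le> ?z i * ?z j + ?z i * ?z (j - i)"
      if ij: "0 < i" "i < j" "{i, j} = {k, l}" for i j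
    proof -
      have "1 / \<bar>ln (real k) - ln (real l)\<bar> \<le> 1 + real i / real (j - i)"
        using inverse_ln_diff_le[OF ij(1,2)] ij(3) by (auto simp: doubleton_eq_iff)
      then have "1 / \<bar>ln (real k) - ln (real l)\<bar> * (?z i * ?z j) \<le> (1 + real i / real (j - i)) * (?z i * ?z j)"
        by (intro mult_right_mono) auto
      also have "\<dots> = ?z i * ?z j + ?z i * (real i / real (j - i) * ?z j)" by (simp add: algebra_simps)
      also have "real i / real (j - i) * ?z j \<le> ?z (j - i)"
      proof -
        have "?z j = real j powr (-1) * real j powr (- (p - 1))" by (simp only: powr_add[symmetric]) simp
        also have "\<dots> \<le> real i powr (-1) * real (j - i) powr (- (p - 1))"
          using ij p by (intro mult_mono powr_mono2') auto
        finally have "real i / real (j - i) * ?z j \<le> real i / real (j - i) * (real i powr (-1) * real (j - i) powr (- (p - 1)))"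
          by (intro mult_left_mono) auto
        also have "\<dots> = real (j - i) powr (-1) * real (j - i) powr (- (p - 1))"
          using ij by (simp add: powr_minus_divide)
        also have "\<dots> = ?z (j - i)" by (simp only: powr_add[symmetric]) simp
        finally show ?thesis .
      qed
      then have "?z i * ?z j + ?z i * (real i / real (j - i) * ?z j) \<le> ?z i * ?z j + ?z i * ?z (j - i)"
        by (intro add_left_mono mult_left_mono) auto
      finally show ?thesis .
    qed
    have pos: "0 < k" "0 < l" using kl K by (metis gr0I)+
    have "1 / \<bar>ln (real k) - ln (real l)\<bar> * (?z k * ?z l) \<le> ?z k * ?z l + g k l"
      using aux[of k l] aux[of l k] pos kl by (cases "k < l") (auto simp: g_def insert_commute mult.commute)
    then have "2 * A\<^sup>2 * (1 / \<bar>ln (real k) - ln (real l)\<bar> * (?z k * ?z l)) \<le> 2 * A\<^sup>2 * (?z k * ?z l + g k l)"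
      by (intro mult_left_mono) auto
    moreover have "c k * c l * (2 / \<bar>ln (real k) - ln (real l)\<bar>) \<le> (A * ?z k) * (A * ?z l) * (2 / \<bar>ln (real k) - ln (real l)\<bar>)"
      using c kl A by (intro mult_right_mono mult_mono) auto
    ultimately show ?thesis using c(1)[OF kl(1)] c(1)[OF kl(2)] by (simp add: power2_eq_square mult_ac)
  qed
  have g0: "0 \<le> g k l" for k l by (simp add: g_def)
  have gsum: "(\<Sum>k\<in>K. \<Sum>l\<in>K - {k}. g k l) \<le> 2 * S\<^sup>2"
  proof -
    have "(\<Sum>l\<in>K - {k}. g k l) \<le> (\<Sum>l\<in>{l\<in>K. k < l}. ?z k * ?z (l - k)) + (\<Sum>l\<in>{l\<in>K. l < k}. ?z l * ?z (k - l))" for k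
    proof -
      have "(\<Sum>l\<in>K - {k}. g k l) = (\<Sum>l\<in>{l\<in>K. k < l} \<union> {l\<in>K. l < k}. g k l)"
        by (intro sum.cong) auto
      also have "\<dots> = (\<Sum>l\<in>{l\<in>K. k < l}. g k l) + (\<Sum>l\<in>{l\<in>K. l < k}. g k l)"
        using K by (intro sum.union_disjoint) auto
      also have "\<dots> = (\<Sum>l\<in>{l\<in>K. k < l}. ?z k * ?z (l - k)) + (\<Sum>l\<in>{l\<in>K. l < k}. ?z l * ?z (k - l))"
        by (intro arg_cong2[where f="(+)"] sum.cong) (auto simp: g_def)
      finally show ?thesis by simp
    qed
    then have "(\<Sum>k\<in>K. \<Sum>l\<in>K - {k}. g k l) \<le>
       (\<Sum>k\<in>K. \<Sum>l\<in>{l\<in>K. k < l}. ?z k * ?z (l - k)) + (\<Sum>k\<in>K. \<Sum>l\<in>{l\<in>K. l < k}. ?z l * ?z (k - l))"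
      unfolding sum.distrib[symmetric] by (intro sum_mono)
    also have "(\<Sum>k\<in>K. \<Sum>l\<in>{l\<in>K. l < k}. ?z l * ?z (k - l)) = (\<Sum>k\<in>K. \<Sum>l\<in>{l\<in>K. k < l}. ?z k * ?z (l - k))"
      by (rule sum.swap_restrict) (use K in auto)
    also have "(\<Sum>k\<in>K. \<Sum>l\<in>{l\<in>K. k < l}. ?z k * ?z (l - k)) \<le> (\<Sum>k\<in>K. ?z k * S)"
    proof (intro sum_mono)
      fix k assume "k \<in> K"
      have "(\<Sum>l\<in>{l\<in>K. k < l}. ?z (l - k)) = (\<Sum>h\<in>(\<lambda>l. l - k) ` {l\<in>K. k < l}. ?z h)"
        by (subst sum.reindex) (auto simp: inj_on_def)
      also have "\<dots> \<le> S" using K by (intro zsum) auto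
      finally show "(\<Sum>l\<in>{l\<in>K. k < l}. ?z k * ?z (l - k)) \<le> ?z k * S"
        unfolding sum_distrib_left[symmetric] by (intro mult_left_mono) auto
    qed
    also have "(\<Sum>k\<in>K. ?z k * S) \<le> S * S"
      unfolding sum_distrib_right[symmetric] using zsum[OF K] S0 by (intro mult_right_mono) auto
    finally show ?thesis by (simp add: power2_eq_square)
  qed
  have zz: "(\<Sum>k\<in>K. \<Sum>l\<in>K - {k}. ?z k * ?z l) \<le> S\<^sup>2"
  proof -
    have "(\<Sum>k\<in>K. \<Sum>l\<in>K - {k}. ?z k * ?z l) \<le> (\<Sum>k\<in>K. \<Sum>l\<in>K. ?z k * ?z l)"
      using K by (intro sum_mono sum_mono2) auto
    also have "\<dots> = (\<Sum>k\<in>K. ?z k) * (\<Sum>k\<in>K. ?z k)" by (simp add: sum_product)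
    also have "\<dots> \<le> S * S" using zsum[OF K] S0 by (intro mult_mono sum_nonneg) auto
    finally show ?thesis by (simp add: power2_eq_square)
  qed
  have "(\<Sum>k\<in>K. \<Sum>l\<in>K - {k}. \<bar>c k\<bar> * \<bar>c l\<bar> * (2 / \<bar>ln (real k) - ln (real l)\<bar>)) \<le>
     (\<Sum>k\<in>K. \<Sum>l\<in>K - {k}. 2 * A\<^sup>2 * (?z k * ?z l + g k l))"
    by (intro sum_mono pair) auto
  also have "\<dots> = 2 * A\<^sup>2 * ((\<Sum>k\<in>K. \<Sum>l\<in>K - {k}. ?z k * ?z l) + (\<Sum>k\<in>K. \<Sum>l\<in>K - {k}. g k l))"
    by (simp only: sum_distrib_left[symmetric] sum.distrib)
  also have "\<dots> \<le> 2 * A\<^sup>2 * (S\<^sup>2 + 2 * S\<^sup>2)"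
    using zz gsum by (intro mult_left_mono add_mono) auto
  finally show ?thesis by (simp add: S_def)
qed

lemma harm_le_1_plus_ln: "1 \<le> n \<Longrightarrow> harm n \<le> 1 + ln (real n)"
proof (induction n rule: dec_induct)
  case (step n)
  have "ln (real n / real (Suc n)) \<le> real n / real (Suc n) - 1"
    using step by (intro ln_le_minus_one) auto
  then have "inverse (real (Suc n)) \<le> ln (real (Suc n)) - ln (real n)"
    using step by (simp add: ln_div field_simps)
  then show ?case using step by (simp add: harm_Suc)
qed (simp add: harm_def)

section \<open>The coefficients of the partial sums\<close>

definition factor_pairs :: "nat \<Rightarrow> (nat \<times> nat) set" where
  "factor_pairs k = {(m, n). 0 < m \<and> m < n \<and> m * n = k}"

definition pair_weight :: "real \<Rightarrow> real \<Rightarrow> nat \<times> nat \<Rightarrow> real" where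
  "pair_weight \<sigma>1 \<sigma>2 = (\<lambda>(m, n). real m powr (-\<sigma>1) * real n powr (-\<sigma>2))"

definition ordered_pairs :: "nat \<Rightarrow> (nat \<times> nat) set" where
  "ordered_pairs N = {(m, n). 0 < m \<and> m < n \<and> n < N}"

text \<open>The coefficient of k powr (- \<i> * t) in \<open>dz_partial N\<close>. It can fall below
  \<open>box_coeff\<close> only from k = N on.\<close>

definition trunc_coeff :: "nat \<Rightarrow> real \<Rightarrow> real \<Rightarrow> nat \<Rightarrow> real" where
  "trunc_coeff N \<sigma>1 \<sigma>2 k = (\<Sum>x\<in>{x\<in>ordered_pairs N. fst x * snd x = k}. pair_weight \<sigma>1 \<sigma>2 x)"

lemma pair_weight_nonneg: "0 \<le> pair_weight \<sigma>1 \<sigma>2 x"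
  by (simp add: pair_weight_def case_prod_unfold)

lemma box_coeff_eq: "box_coeff \<sigma>1 \<sigma>2 k = (\<Sum>x\<in>factor_pairs k. pair_weight \<sigma>1 \<sigma>2 x)"
  unfolding box_coeff_def factor_pairs_def pair_weight_def
  by (intro sum.cong) (auto simp: powr_minus divide_inverse)

lemma finite_factor_pairs [simp]: "finite (factor_pairs k)"
proof (rule finite_subset)
  show "factor_pairs k \<subseteq> {..k} \<times> {..k}" by (auto simp: factor_pairs_def)
qed simp

lemma finite_ordered_pairs [simp]: "finite (ordered_pairs N)"
proof (rule finite_subset)
  show "ordered_pairs N \<subseteq> {..N} \<times> {..N}" by (auto simp: ordered_pairs_def)
qed simp

lemma card_factor_pairs_le: "0 < k \<Longrightarrow> card (factor_pairs k) \<le> num_divisors k"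
  unfolding num_divisors_def
proof (rule card_inj_on_le[of fst])
  show "inj_on fst (factor_pairs k)" by (auto simp: inj_on_def factor_pairs_def)
  show "fst ` factor_pairs k \<subseteq> {d. d dvd k}" by (auto simp: factor_pairs_def)
qed simp

lemma box_coeff_nonneg: "0 \<le> box_coeff \<sigma>1 \<sigma>2 k"
  unfolding box_coeff_eq by (intro sum_nonneg pair_weight_nonneg)

text \<open>The smallest product with 0 < m < n is 2. So the series from 2 on may be handled as a
  series over all natural numbers.\<close>

lemma box_coeff_small: "k < 2 \<Longrightarrow> box_coeff \<sigma>1 \<sigma>2 k = 0"
proof -
  assume "k < 2"
  then have "factor_pairs k = {}"
    by (auto simp: factor_pairs_def less_2_cases_iff)
  then show ?thesis by (simp add: box_coeff_eq)
qed

lemma trunc_coeff_nonneg: "0 \<le> trunc_coeff N \<sigma>1 \<sigma>2 k"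
  unfolding trunc_coeff_def by (intro sum_nonneg pair_weight_nonneg)

lemma trunc_coeff_le_box_coeff: "trunc_coeff N \<sigma>1 \<sigma>2 k \<le> box_coeff \<sigma>1 \<sigma>2 k"
  unfolding trunc_coeff_def box_coeff_eq
  by (intro sum_mono2 finite_factor_pairs pair_weight_nonneg)
     (auto simp: factor_pairs_def ordered_pairs_def)

lemma trunc_coeff_eq_box_coeff: "k < N \<Longrightarrow> trunc_coeff N \<sigma>1 \<sigma>2 k = box_coeff \<sigma>1 \<sigma>2 k"
  unfolding trunc_coeff_def box_coeff_eq
proof (rule sum.cong)
  assume "k < N"
  have "n < N" if "0 < m" "m * n = k" for m n
    using that \<open>k < N\<close> by (metis One_nat_def Suc_leI le_less_trans mult_le_mono1 nat_mult_1)
  then show "{x \<in> ordered_pairs N. fst x * snd x = k} = factor_pairs k"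
    by (auto simp: factor_pairs_def ordered_pairs_def)
qed simp

lemma ordered_pairs_product_in: "x \<in> ordered_pairs N \<Longrightarrow> fst x * snd x \<in> {1..N\<^sup>2}"
proof -
  assume "x \<in> ordered_pairs N"
  then obtain m n where mn: "x = (m, n)" "0 < m" "m < n" "n < N" by (auto simp: ordered_pairs_def)
  have "1 * 1 \<le> m * n" using mn by (intro mult_le_mono) auto
  moreover have "m * n \<le> N * N" using mn by (intro mult_le_mono) auto
  ultimately show ?thesis by (simp add: mn(1) power2_eq_square)
qed

lemma sum_over_products:
  fixes h :: "nat \<times> nat \<Rightarrow> 'a :: comm_monoid_add"
  shows "(\<Sum>k=1..N\<^sup>2. \<Sum>x\<in>{x\<in>ordered_pairs N. fst x * snd x = k}. h x) = (\<Sum>x\<in>ordered_pairs N. h x)"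
  using ordered_pairs_product_in by (intro sum.group) auto

lemma sum_trunc_coeff: "(\<Sum>k=1..N\<^sup>2. trunc_coeff N \<sigma>1 \<sigma>2 k) = (\<Sum>x\<in>ordered_pairs N. pair_weight \<sigma>1 \<sigma>2 x)"
  unfolding trunc_coeff_def by (rule sum_over_products)

lemma sum_ordered_pairs:
  fixes h :: "nat \<Rightarrow> nat \<Rightarrow> 'a :: comm_monoid_add"
  shows "(\<Sum>(m, n)\<in>ordered_pairs N. h m n) = (\<Sum>n=1..<N. \<Sum>m=1..<n. h m n)"
proof -
  have "(\<Sum>n=1..<N. \<Sum>m=1..<n. h m n) = (\<Sum>(n, m)\<in>(SIGMA n:{1..<N}. {1..<n}). h m n)"
    by (subst sum.Sigma) auto
  also have "\<dots> = (\<Sum>(m, n)\<in>ordered_pairs N. h m n)"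
    by (rule sum.reindex_bij_witness[of _ "\<lambda>(m, n). (n, m)" "\<lambda>(n, m). (m, n)"])
       (auto simp: ordered_pairs_def)
  finally show ?thesis by simp
qed

text \<open>Since s1 and s2 have the same imaginary part, the term of the pair (m, n) oscillates
  like (m * n) powr (- \<i> * t). Collecting equal products is what makes
  \<open>double_zeta_box\<close> the mean value.\<close>

lemma dz_partial_eq_dirichlet_poly:
  "dz_partial N (Complex \<sigma>1 t) (Complex \<sigma>2 t) = dirichlet_poly {1..N\<^sup>2} (trunc_coeff N \<sigma>1 \<sigma>2) t"
proof -
  have C: "Complex a t = of_real a + \<i> * of_real t" for a
    by (simp add: complex_eq_iff)
  have w: "of_nat m powr (- Complex \<sigma>1 t) * of_nat n powr (- Complex \<sigma>2 t) =
      of_real (pair_weight \<sigma>1 \<sigma>2 (m, n)) * cis (- (ln (real (m * n)) * t))" if "0 < m" "0 < n" for m n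
  proof -
    have "ln (real (m * n)) * t = ln (real m) * t + ln (real n) * t"
      using that by (simp add: ln_mult distrib_right)
    then show ?thesis
      unfolding C of_nat_powr_imaginary[OF that(1)] of_nat_powr_imaginary[OF that(2)]
      by (simp add: pair_weight_def cis_mult)
  qed
  have "dz_partial N (Complex \<sigma>1 t) (Complex \<sigma>2 t) =
      (\<Sum>(m, n)\<in>ordered_pairs N. of_nat m powr (- Complex \<sigma>1 t) * of_nat n powr (- Complex \<sigma>2 t))"
    unfolding dz_partial_def sum_ordered_pairs ..
  also have "\<dots> = (\<Sum>x\<in>ordered_pairs N. of_real (pair_weight \<sigma>1 \<sigma>2 x) * cis (- (ln (real (fst x * snd x)) * t)))"
    by (intro sum.cong) (auto simp: ordered_pairs_def w simp del: of_nat_mult)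
  also have "\<dots> = (\<Sum>k=1..N\<^sup>2. \<Sum>x\<in>{x\<in>ordered_pairs N. fst x * snd x = k}. of_real (pair_weight \<sigma>1 \<sigma>2 x) * cis (- (ln (real (fst x * snd x)) * t)))"
    by (rule sum_over_products[symmetric])
  also have "\<dots> = dirichlet_poly {1..N\<^sup>2} (trunc_coeff N \<sigma>1 \<sigma>2) t"
    unfolding dirichlet_poly_def trunc_coeff_def of_real_sum sum_distrib_right
    by (intro sum.cong) auto
  finally show ?thesis .
qed

text \<open>Because m < n and p \<le> \<sigma>2, the surplus power of n may be moved to m, where the
  total exponent 2 * p - \<sigma>1 - \<sigma>2 is at most 0.\<close>

lemma pair_weight_le:
  assumes "0 < m" "m < n" "p \<le> \<sigma>2" "2 * p \<le> \<sigma>1 + \<sigma>2"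
  shows "pair_weight \<sigma>1 \<sigma>2 (m, n) \<le> real (m * n) powr (-p)"
proof -
  have mn: "0 < real m" "0 < real n" using assms by auto
  have "real m powr (-\<sigma>1) * real n powr (-\<sigma>2) =
     (real m powr (-p) * real n powr (-p)) * (real m powr (p - \<sigma>1) * real n powr (p - \<sigma>2))"
  proof -
    have split: "x powr (-\<sigma>) = x powr (-p) * x powr (p - \<sigma>)" for x \<sigma> :: real
      by (simp flip: powr_add)
    show ?thesis unfolding split[of _ \<sigma>1] split[of _ \<sigma>2] by (simp only: mult_ac)
  qed
  also have "real m powr (p - \<sigma>1) * real n powr (p - \<sigma>2) \<le> real m powr (p - \<sigma>1) * real m powr (p - \<sigma>2)"
    using assms by (intro mult_left_mono powr_mono2') auto
  also have "\<dots> = real m powr (2 * p - (\<sigma>1 + \<sigma>2))"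
    by (simp only: powr_add[symmetric]) (simp add: algebra_simps)
  also have "\<dots> \<le> real m powr 0" using assms by (intro powr_mono) auto
  finally show ?thesis using mn
    by (simp add: pair_weight_def powr_mult mult_left_le)
qed

section \<open>Size and square-summability of the full coefficients\<close>

lemma box_coeff_le_powr:
  assumes "p \<le> \<sigma>2" "2 * p \<le> \<sigma>1 + \<sigma>2" "0 < \<eta>"
  shows "\<exists>C>0. \<forall>k>0. box_coeff \<sigma>1 \<sigma>2 k \<le> C * real k powr (\<eta> - p)"
proof -
  obtain C where C: "C > 0" "\<And>n. n > 0 \<Longrightarrow> real (num_divisors n) \<le> C * real n powr \<eta>"
    using num_divisors_le_powr[OF assms(3)] by blast
  have "box_coeff \<sigma>1 \<sigma>2 k \<le> C * real k powr (\<eta> - p)" if k: "0 < k" for k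
  proof -
    have "box_coeff \<sigma>1 \<sigma>2 k \<le> (\<Sum>x\<in>factor_pairs k. real k powr (-p))"
      unfolding box_coeff_eq
    proof (rule sum_mono)
      fix x assume "x \<in> factor_pairs k"
      then obtain m n where "x = (m, n)" "0 < m" "m < n" "m * n = k" by (auto simp: factor_pairs_def)
      then show "pair_weight \<sigma>1 \<sigma>2 x \<le> real k powr (-p)"
        using pair_weight_le[of m n p \<sigma>2 \<sigma>1] assms by simp
    qed
    also have "\<dots> = real (card (factor_pairs k)) * real k powr (-p)" by simp
    also have "\<dots> \<le> (C * real k powr \<eta>) * real k powr (-p)"
      using C(2)[OF k] card_factor_pairs_le[OF k] by (intro mult_right_mono) auto
    also have "\<dots> = C * real k powr (\<eta> - p)" by (simp add: powr_add[symmetric])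
    finally show ?thesis .
  qed
  with C(1) show ?thesis by blast
qed

lemma box_coeff_sq_le_powr:
  assumes "p \<le> \<sigma>2" "2 * p \<le> \<sigma>1 + \<sigma>2" "0 < \<eta>"
  shows "\<exists>C>0. \<forall>k>0. (box_coeff \<sigma>1 \<sigma>2 k)\<^sup>2 \<le> C * real k powr (- (2 * p - 2 * \<eta>))"
proof -
  obtain C where C: "C > 0" "\<And>k. k > 0 \<Longrightarrow> box_coeff \<sigma>1 \<sigma>2 k \<le> C * real k powr (\<eta> - p)"
    using box_coeff_le_powr[OF assms] by blast
  have "(box_coeff \<sigma>1 \<sigma>2 k)\<^sup>2 \<le> C\<^sup>2 * real k powr (- (2 * p - 2 * \<eta>))" if "0 < k" for k
  proof -
    have "(box_coeff \<sigma>1 \<sigma>2 k)\<^sup>2 \<le> (C * real k powr (\<eta> - p))\<^sup>2"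
      using C(2)[OF that] box_coeff_nonneg by (intro power_mono)
    also have "\<dots> = C\<^sup>2 * real k powr ((\<eta> - p) + (\<eta> - p))"
      by (simp add: power_mult_distrib power2_eq_square[of "real k powr _"] flip: powr_add)
    also have "(\<eta> - p) + (\<eta> - p) = - (2 * p - 2 * \<eta>)" by simp
    finally show ?thesis .
  qed
  then show ?thesis using C(1) by (intro exI[of _ "C\<^sup>2"]) auto
qed

lemma summable_box_coeff_sq:
  assumes "1/2 < \<sigma>2" "1 < \<sigma>1 + \<sigma>2"
  shows "summable (\<lambda>k. (box_coeff \<sigma>1 \<sigma>2 k)\<^sup>2)"
proof -
  \<comment> \<open>The largest exponent that \<open>pair_weight_le\<close> admits; \<eta> takes
    half of its margin over 1/2, which leaves 2 * p - 2 * \<eta> > 1.\<close>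
  define p where "p = min \<sigma>2 ((\<sigma>1 + \<sigma>2) / 2)"
  define \<eta> where "\<eta> = (p - 1/2) / 2"
  have p: "1/2 < p" "p \<le> \<sigma>2" "2 * p \<le> \<sigma>1 + \<sigma>2"
    using assms by (auto simp: p_def min_def field_simps)
  obtain C where C: "\<And>k. 0 < k \<Longrightarrow> (box_coeff \<sigma>1 \<sigma>2 k)\<^sup>2 \<le> C * real k powr (- (2 * p - 2 * \<eta>))"
    using box_coeff_sq_le_powr[OF p(2,3), of \<eta>] p by (auto simp: \<eta>_def)
  have "1 < 2 * p - 2 * \<eta>" using p(1) by (simp add: \<eta>_def field_simps)
  then have "summable (\<lambda>n. C * real (1 + n) powr (- (2 * p - 2 * \<eta>)))"
    by (intro summable_mult summable_powr_tail) auto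
  then have "summable (\<lambda>n. (box_coeff \<sigma>1 \<sigma>2 (1 + n))\<^sup>2)"
  proof (rule summable_comparison_test')
    show "norm ((box_coeff \<sigma>1 \<sigma>2 (1 + n))\<^sup>2) \<le> C * real (1 + n) powr (- (2 * p - 2 * \<eta>))" for n
      using C[of "1 + n"] by simp
  qed
  then show ?thesis using summable_Suc_iff[of "\<lambda>k. (box_coeff \<sigma>1 \<sigma>2 k)\<^sup>2"] by simp
qed

lemma has_sum_box_coeff_sq:
  assumes "summable (\<lambda>k. (box_coeff \<sigma>1 \<sigma>2 k)\<^sup>2)"
  shows "((\<lambda>k. (box_coeff \<sigma>1 \<sigma>2 k)\<^sup>2) has_sum (\<Sum>k. (box_coeff \<sigma>1 \<sigma>2 k)\<^sup>2)) {2..}"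
proof -
  have "((\<lambda>k. (box_coeff \<sigma>1 \<sigma>2 k)\<^sup>2) has_sum (\<Sum>k. (box_coeff \<sigma>1 \<sigma>2 k)\<^sup>2)) UNIV"
    by (rule norm_summable_imp_has_sum) (use assms in \<open>auto intro: summable_sums\<close>)
  then show ?thesis
    by (rule has_sum_cong_neutral[THEN iffD1, rotated -1]) (auto simp: box_coeff_small)
qed

lemma double_zeta_box_eq_suminf:
  assumes "1/2 < \<sigma>2" "1 < \<sigma>1 + \<sigma>2"
  shows "double_zeta_box \<sigma>1 \<sigma>2 = (\<Sum>k. (box_coeff \<sigma>1 \<sigma>2 k)\<^sup>2)"
  unfolding double_zeta_box_def
  by (rule infsumI[OF has_sum_box_coeff_sq[OF summable_box_coeff_sq[OF assms]]])

text \<open>All weights are nonnegative, so for each product the sum of squares is at most the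
  square of the sum. Any finite family of pairs thus bounds the series from below, which serves to
  show divergence.\<close>

lemma sum_pair_weight_sq_le:
  assumes "(\<lambda>k. (box_coeff \<sigma>1 \<sigma>2 k)\<^sup>2) summable_on {2..}" "finite P"
    and P: "\<And>m n. (m, n) \<in> P \<Longrightarrow> 0 < m \<and> m < n"
  shows "(\<Sum>x\<in>P. (pair_weight \<sigma>1 \<sigma>2 x)\<^sup>2) \<le> double_zeta_box \<sigma>1 \<sigma>2"
proof -
  let ?g = "\<lambda>x. fst x * snd x :: nat"
  have "(\<Sum>x\<in>P. (pair_weight \<sigma>1 \<sigma>2 x)\<^sup>2) = (\<Sum>k\<in>?g ` P. \<Sum>x\<in>{x\<in>P. ?g x = k}. (pair_weight \<sigma>1 \<sigma>2 x)\<^sup>2)"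
    using \<open>finite P\<close> by (intro sum.group[symmetric]) auto
  also have "\<dots> \<le> (\<Sum>k\<in>?g ` P. (box_coeff \<sigma>1 \<sigma>2 k)\<^sup>2)"
  proof (rule sum_mono)
    fix k
    have "(\<Sum>x\<in>{x\<in>P. ?g x = k}. (pair_weight \<sigma>1 \<sigma>2 x)\<^sup>2) \<le> (\<Sum>x\<in>factor_pairs k. (pair_weight \<sigma>1 \<sigma>2 x)\<^sup>2)"
      by (rule sum_mono2[OF finite_factor_pairs]) (use P in \<open>auto simp: factor_pairs_def\<close>)
    also have "\<dots> \<le> (\<Sum>x\<in>factor_pairs k. pair_weight \<sigma>1 \<sigma>2 x * box_coeff \<sigma>1 \<sigma>2 k)"
      unfolding power2_eq_square box_coeff_eq
      by (intro sum_mono mult_left_mono member_le_sum pair_weight_nonneg) auto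
    also have "\<dots> = (box_coeff \<sigma>1 \<sigma>2 k)\<^sup>2"
      by (simp add: sum_distrib_right[symmetric] box_coeff_eq power2_eq_square)
    finally show "(\<Sum>x\<in>{x\<in>P. ?g x = k}. (pair_weight \<sigma>1 \<sigma>2 x)\<^sup>2) \<le> (box_coeff \<sigma>1 \<sigma>2 k)\<^sup>2" .
  qed
  also have "\<dots> \<le> double_zeta_box \<sigma>1 \<sigma>2"
    unfolding double_zeta_box_def
  proof (rule finite_sum_le_infsum[OF assms(1)])
    show "?g ` P \<subseteq> {2..}"
    proof
      fix k assume "k \<in> ?g ` P"
      then obtain m n where mn: "k = m * n" "0 < m" "m < n" using P by fastforce
      then have "1 * 2 \<le> m * n" by (intro mult_le_mono) auto
      then show "k \<in> {2..}" using mn by simp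
    qed
  qed (use \<open>finite P\<close> in auto)
  finally show ?thesis .
qed

text \<open>Two families of pairs decide: the pairs (1, n) force the sum of n powr (- 2 * \<sigma>2)
  to converge, and the pairs with m < n \<le> 2 * m force that of m powr (1 - 2 * (\<sigma>1 +
  \<sigma>2)).\<close>

lemma summable_on_box_coeff_sq_imp:
  assumes "(\<lambda>k. (box_coeff \<sigma>1 \<sigma>2 k)\<^sup>2) summable_on {2..}"
  shows "1/2 < \<sigma>2 \<and> 1 < \<sigma>1 + \<sigma>2"
proof
  have bounded: "r < -1" if le: "\<And>M. (\<Sum>m=1..M. c * real m powr r) \<le> B" and "0 < c" for r c B
  proof -
    have "summable (\<lambda>i. c * real (Suc i) powr r)"
    proof (rule summableI_nonneg_bounded)
      show "(\<Sum>i<n. c * real (Suc i) powr r) \<le> B" for n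
        using le[of n] sum.shift_bounds_Suc_ivl[of "\<lambda>m. c * real m powr r" 0 n]
        by (simp add: lessThan_atLeast0 atLeastLessThanSuc_atLeastAtMost)
    qed (use \<open>0 < c\<close> in simp)
    then have "summable (\<lambda>i. real (Suc i) powr r)"
      using \<open>0 < c\<close> by (simp add: summable_cmult_iff)
    then have "summable (\<lambda>i. real i powr r)"
      using summable_Suc_iff[of "\<lambda>i. real i powr r"] by simp
    then show ?thesis by (simp only: summable_real_powr_iff)
  qed
  show s2: "1/2 < \<sigma>2"
  proof -
    have "- (2 * \<sigma>2) < -1"
    proof (rule bounded[of 1])
      fix M :: nat
      have "(\<Sum>m=1..M. 1 * real m powr (- (2 * \<sigma>2))) \<le> 1 + (\<Sum>m=2..M. real m powr (- (2 * \<sigma>2)))"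
        using sum.atLeast_Suc_atMost[of "Suc 0" M "\<lambda>m. real m powr (- (2 * \<sigma>2))"]
        by (cases "M = 0") (simp_all add: numeral_2_eq_2)
      also have "(\<Sum>m=2..M. real m powr (- (2 * \<sigma>2))) = (\<Sum>x\<in>Pair 1 ` {2..M}. (pair_weight \<sigma>1 \<sigma>2 x)\<^sup>2)"
        by (subst sum.reindex) (auto simp: inj_on_def pair_weight_def power2_eq_square simp flip: powr_add)
      also have "\<dots> \<le> double_zeta_box \<sigma>1 \<sigma>2"
        by (rule sum_pair_weight_sq_le[OF assms]) auto
      finally show "(\<Sum>m=1..M. 1 * real m powr (- (2 * \<sigma>2))) \<le> 1 + double_zeta_box \<sigma>1 \<sigma>2" by simp
    qed simp
    then show ?thesis by simp
  qed
  show "1 < \<sigma>1 + \<sigma>2"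
  proof -
    have "1 - 2 * (\<sigma>1 + \<sigma>2) < -1"
    proof (rule bounded[of "2 powr (- (2 * \<sigma>2))"])
      fix M :: nat
      let ?P = "SIGMA m:{1..M}. {m<..2 * m}"
      \<comment> \<open>The window holds m values of n, and there n powr (- 2 * \<sigma>2) is at
        least its value at 2 * m, because the first half gives \<sigma>2 > 0.\<close>
      have "2 powr (- (2 * \<sigma>2)) * real m powr (1 - 2 * (\<sigma>1 + \<sigma>2)) \<le> (\<Sum>n\<in>{m<..2 * m}. (pair_weight \<sigma>1 \<sigma>2 (m, n))\<^sup>2)"
        if m: "m \<in> {1..M}" for m
      proof -
        have "2 powr (- (2 * \<sigma>2)) * real m powr (1 - 2 * (\<sigma>1 + \<sigma>2)) =
            (\<Sum>n\<in>{m<..2 * m}. real m powr (- (2 * \<sigma>1)) * real (2 * m) powr (- (2 * \<sigma>2)))"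
        proof -
          have "1 - 2 * (\<sigma>1 + \<sigma>2) = 1 + (- (2 * \<sigma>1) + - (2 * \<sigma>2))" by simp
          then have "real m powr (1 - 2 * (\<sigma>1 + \<sigma>2)) = real m * (real m powr (- (2 * \<sigma>1)) * real m powr (- (2 * \<sigma>2)))"
            using m by (simp only: powr_add) simp
          then show ?thesis by (simp add: powr_mult)
        qed
        also have "\<dots> \<le> (\<Sum>n\<in>{m<..2 * m}. real m powr (- (2 * \<sigma>1)) * real n powr (- (2 * \<sigma>2)))"
          using s2 m by (intro sum_mono mult_left_mono powr_mono2') auto
        also have "\<dots> = (\<Sum>n\<in>{m<..2 * m}. (pair_weight \<sigma>1 \<sigma>2 (m, n))\<^sup>2)"
          by (intro sum.cong refl) (simp add: pair_weight_def power_mult_distrib, simp add: power2_eq_square flip: powr_add)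
        finally show ?thesis .
      qed
      then have "(\<Sum>m=1..M. 2 powr (- (2 * \<sigma>2)) * real m powr (1 - 2 * (\<sigma>1 + \<sigma>2))) \<le>
         (\<Sum>m=1..M. \<Sum>n\<in>{m<..2 * m}. (pair_weight \<sigma>1 \<sigma>2 (m, n))\<^sup>2)"
        by (rule sum_mono)
      also have "\<dots> = (\<Sum>x\<in>?P. (pair_weight \<sigma>1 \<sigma>2 x)\<^sup>2)"
        by (subst sum.Sigma) (auto intro!: sum.cong)
      also have "\<dots> \<le> double_zeta_box \<sigma>1 \<sigma>2"
        by (rule sum_pair_weight_sq_le[OF assms]) auto
      finally show "(\<Sum>m=1..M. 2 powr (- (2 * \<sigma>2)) * real m powr (1 - 2 * (\<sigma>1 + \<sigma>2))) \<le> double_zeta_box \<sigma>1 \<sigma>2" .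
    qed simp
    then show ?thesis by simp
  qed
qed

text \<open>The finite sum lies between the sum of the full squares below N, where nothing is
  truncated, and the whole series; so the error is at most the tail from N.\<close>

lemma sum_trunc_coeff_sq_approx:
  assumes "p \<le> \<sigma>2" "2 * p \<le> \<sigma>1 + \<sigma>2" "0 < \<eta>" "1 < 2 * p - 2 * \<eta>"
  shows "\<exists>C\<ge>0. \<forall>N\<ge>1. \<bar>double_zeta_box \<sigma>1 \<sigma>2 - (\<Sum>k=1..N\<^sup>2. (trunc_coeff N \<sigma>1 \<sigma>2 k)\<^sup>2)\<bar>
    \<le> C * real N powr (1 - (2 * p - 2 * \<eta>))"
proof -
  let ?a = "\<lambda>k. (box_coeff \<sigma>1 \<sigma>2 k)\<^sup>2" and ?e = "2 * p - 2 * \<eta>"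
  have s: "1/2 < \<sigma>2" "1 < \<sigma>1 + \<sigma>2" using assms by auto
  note sa = summable_box_coeff_sq[OF s]
  obtain C where C: "0 < C" "\<And>k. 0 < k \<Longrightarrow> ?a k \<le> C * real k powr (- ?e)"
    using box_coeff_sq_le_powr[OF assms(1-3)] by blast
  have "\<bar>double_zeta_box \<sigma>1 \<sigma>2 - (\<Sum>k=1..N\<^sup>2. (trunc_coeff N \<sigma>1 \<sigma>2 k)\<^sup>2)\<bar>
    \<le> (C * (2 powr ?e / (?e - 1))) * real N powr (1 - ?e)" if N: "1 \<le> N" for N
  proof -
    let ?T = "\<Sum>k=1..N\<^sup>2. (trunc_coeff N \<sigma>1 \<sigma>2 k)\<^sup>2"
    have NN: "N \<le> N\<^sup>2" by (simp add: power2_eq_square)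
    have "(\<Sum>k<N. ?a k) = (\<Sum>k=1..<N. ?a k)"
      using N by (simp add: lessThan_atLeast0 sum.atLeast_Suc_lessThan box_coeff_small)
    also have "\<dots> = (\<Sum>k=1..<N. (trunc_coeff N \<sigma>1 \<sigma>2 k)\<^sup>2)"
      by (intro sum.cong) (simp_all add: trunc_coeff_eq_box_coeff)
    also have "\<dots> \<le> ?T" using NN by (intro sum_mono2) auto
    finally have lower: "(\<Sum>k<N. ?a k) \<le> ?T" .
    have "?T \<le> (\<Sum>k=1..N\<^sup>2. ?a k)"
      by (intro sum_mono power_mono trunc_coeff_le_box_coeff trunc_coeff_nonneg)
    also have "\<dots> \<le> (\<Sum>k. ?a k)" by (intro sum_le_suminf sa) auto
    finally have upper: "?T \<le> (\<Sum>k. ?a k)" .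
    have "(\<Sum>k. ?a k) = (\<Sum>n. ?a (n + N)) + (\<Sum>k<N. ?a k)"
      by (rule suminf_split_initial_segment[OF sa])
    with lower upper have "\<bar>(\<Sum>k. ?a k) - ?T\<bar> \<le> (\<Sum>n. ?a (n + N))" by linarith
    also have "\<dots> \<le> (\<Sum>n. C * real (N + n) powr (- ?e))"
    proof (rule suminf_le)
      show "?a (n + N) \<le> C * real (N + n) powr (- ?e)" for n
        using C(2)[of "n + N"] N by (simp add: add.commute)
      show "summable (\<lambda>n. ?a (n + N))" by (rule summable_ignore_initial_segment[OF sa])
      show "summable (\<lambda>n. C * real (N + n) powr (- ?e))"
        using assms N by (intro summable_mult summable_powr_tail) auto
    qed
    also have "\<dots> = C * (\<Sum>n. real (N + n) powr (- ?e))"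
      using assms N by (intro suminf_mult summable_powr_tail) auto
    also have "\<dots> \<le> C * (2 powr ?e / (?e - 1) * real N powr (1 - ?e))"
      using assms N C by (intro mult_left_mono suminf_powr_tail_le) auto
    finally show ?thesis by (simp add: double_zeta_box_eq_suminf[OF s] mult.assoc)
  qed
  moreover have "0 \<le> C * (2 powr ?e / (?e - 1))" using C assms by simp
  ultimately show ?thesis by blast
qed

section \<open>Sums of truncated coefficients and mean squares of the partial sums\<close>

lemma harm_le_powr:
  assumes "0 < \<eta>"
  shows "\<exists>H>0. \<forall>N\<ge>1. harm N \<le> H * real N powr \<eta>"
proof (intro exI[of _ "1 + 1 / \<eta>"] conjI allI impI)
  show "0 < 1 + 1 / \<eta>" using assms by (simp add: add_pos_pos)
  fix N :: nat assume N: "1 \<le> N"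
  have "harm N \<le> 1 + ln (real N)" by (rule harm_le_1_plus_ln[OF N])
  also have "\<dots> \<le> real N powr \<eta> + real N powr \<eta> / \<eta>"
    using N assms by (intro add_mono ln_powr_bound ge_one_powr_ge_zero) auto
  also have "\<dots> = (1 + 1 / \<eta>) * real N powr \<eta>" by (simp add: algebra_simps)
  finally show "harm N \<le> (1 + 1 / \<eta>) * real N powr \<eta>" .
qed

text \<open>Splitting off the weight 1 / m treats all exponents alike, with \<tau> = 1 once \<sigma>
  \<ge> 1; the price is a logarithm.\<close>

lemma sum_powr_le_harm:
  assumes "\<tau> \<le> 1" "\<tau> \<le> \<sigma>" "1 \<le> N"
  shows "(\<Sum>m=1..<N. real m powr (-\<sigma>)) \<le> harm N * real N powr (1 - \<tau>)"
proof -
  have "(\<Sum>m=1..<N. real m powr (-\<sigma>)) \<le> (\<Sum>m=1..<N. inverse (real m) * real N powr (1 - \<tau>))"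
  proof (rule sum_mono)
    fix m assume m: "m \<in> {1..<N}"
    have "real m powr (-\<sigma>) \<le> real m powr (-\<tau>)" using m assms by (intro powr_mono) auto
    also have "\<dots> = inverse (real m) * real m powr (1 - \<tau>)"
      using m powr_add[of "real m" "-1" "1 - \<tau>"] by (simp add: powr_minus)
    also have "\<dots> \<le> inverse (real m) * real N powr (1 - \<tau>)"
      using m assms by (intro mult_left_mono powr_mono2) auto
    finally show "real m powr (-\<sigma>) \<le> inverse (real m) * real N powr (1 - \<tau>)" .
  qed
  also have "\<dots> \<le> harm N * real N powr (1 - \<tau>)"
    unfolding sum_distrib_right[symmetric] harm_def by (intro mult_right_mono sum_mono2) auto
  finally show ?thesis .
qed

text \<open>The origin of the exponent 2 - \<tau> - \<sigma>2: once the weights 1 / m and 1 / n are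
  removed, m powr (1 - \<sigma>1) is at most n powr (1 - \<tau>).\<close>

lemma pair_weight_le_harmonic:
  assumes "\<tau> \<le> 1" "\<tau> \<le> \<sigma>1" "\<tau> + \<sigma>2 \<le> 2" and x: "x \<in> ordered_pairs N"
  shows "real (fst x) * real (snd x) * pair_weight \<sigma>1 \<sigma>2 x \<le> real N powr (2 - \<tau> - \<sigma>2)"
proof -
  obtain m n where mn: "x = (m, n)" "0 < m" "m < n" "n < N" using x by (auto simp: ordered_pairs_def)
  have "real m * real n * pair_weight \<sigma>1 \<sigma>2 x = (real m powr 1 * real m powr (-\<sigma>1)) * (real n powr 1 * real n powr (-\<sigma>2))"
    using mn by (simp add: pair_weight_def)
  also have "\<dots> = real m powr (1 + -\<sigma>1) * real n powr (1 + -\<sigma>2)"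
    by (simp only: powr_add)
  also have "\<dots> \<le> real n powr (1 - \<tau>) * real n powr (1 + -\<sigma>2)"
  proof (intro mult_right_mono)
    have "real m powr (1 + -\<sigma>1) \<le> real m powr (1 - \<tau>)" using mn assms by (intro powr_mono) auto
    also have "\<dots> \<le> real n powr (1 - \<tau>)" using mn assms by (intro powr_mono2) auto
    finally show "real m powr (1 + -\<sigma>1) \<le> real n powr (1 - \<tau>)" .
  qed auto
  also have "\<dots> = real n powr (2 - \<tau> - \<sigma>2)"
    by (simp only: powr_add[symmetric]) (simp add: algebra_simps)
  also have "\<dots> \<le> real N powr (2 - \<tau> - \<sigma>2)" using mn assms by (intro powr_mono2) auto
  finally show ?thesis by (simp add: mn)
qed

lemma sum_pair_weight_le:
  assumes "\<tau> \<le> 1" "\<tau> \<le> \<sigma>1" "\<tau> + \<sigma>2 \<le> 2"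
  shows "(\<Sum>x\<in>ordered_pairs N. pair_weight \<sigma>1 \<sigma>2 x) \<le> (harm N)\<^sup>2 * real N powr (2 - \<tau> - \<sigma>2)"
proof -
  let ?e = "2 - \<tau> - \<sigma>2"
  have "(\<Sum>x\<in>ordered_pairs N. pair_weight \<sigma>1 \<sigma>2 x) \<le>
     (\<Sum>(m, n)\<in>ordered_pairs N. inverse (real m) * inverse (real n) * real N powr ?e)"
  proof (rule sum_mono, clarify)
    fix m n assume x: "(m, n) \<in> ordered_pairs N"
    then have "0 < real m" "0 < real n" by (auto simp: ordered_pairs_def)
    then show "pair_weight \<sigma>1 \<sigma>2 (m, n) \<le> inverse (real m) * inverse (real n) * real N powr ?e"
      using pair_weight_le_harmonic[OF assms x] by (simp add: field_simps)
  qed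
  also have "\<dots> = (\<Sum>(m, n)\<in>ordered_pairs N. inverse (real m) * inverse (real n)) * real N powr ?e"
    by (simp add: sum_distrib_right case_prod_unfold)
  also have "(\<Sum>(m, n)\<in>ordered_pairs N. inverse (real m) * inverse (real n)) \<le>
      (\<Sum>(m, n)\<in>{1..N} \<times> {1..N}. inverse (real m) * inverse (real n))"
    by (intro sum_mono2) (auto simp: ordered_pairs_def)
  also have "\<dots> = (harm N)\<^sup>2"
    by (simp add: harm_def power2_eq_square sum_product sum.cartesian_product)
  finally show ?thesis by (simp add: mult_right_mono)
qed

text \<open>Cauchy--Schwarz over the factorisations of k costs their number, at most
  \<open>D\<close>. Of the remaining square, one factor absorbs k by the harmonic bound and the
  other is summed over all pairs.\<close>

lemma sum_trunc_coeff_sq_weighted_le: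
  assumes "\<tau> \<le> 1" "\<tau> \<le> \<sigma>1" "\<tau> + \<sigma>2 \<le> 2" and D: "\<And>k. k \<in> {1..N\<^sup>2} \<Longrightarrow> real (num_divisors k) \<le> D" and "0 \<le> D"
  shows "(\<Sum>k=1..N\<^sup>2. real k * (trunc_coeff N \<sigma>1 \<sigma>2 k)\<^sup>2) \<le> D * (harm N)\<^sup>2 * real N powr (2 * (2 - \<tau> - \<sigma>2))"
proof -
  let ?e = "2 - \<tau> - \<sigma>2" and ?w = "pair_weight \<sigma>1 \<sigma>2"
  have "real k * (trunc_coeff N \<sigma>1 \<sigma>2 k)\<^sup>2 \<le> (\<Sum>x\<in>{x\<in>ordered_pairs N. fst x * snd x = k}. D * (real N powr ?e * ?w x))"
    if k: "k \<in> {1..N\<^sup>2}" for k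
  proof -
    let ?F = "{x\<in>ordered_pairs N. fst x * snd x = k}"
    have "card ?F \<le> card (factor_pairs k)"
      by (rule card_mono) (auto simp: factor_pairs_def ordered_pairs_def intro: finite_factor_pairs[unfolded factor_pairs_def])
    also have "\<dots> \<le> num_divisors k" using k by (intro card_factor_pairs_le) auto
    finally have card: "real (card ?F) \<le> D" using D[OF k] by linarith
    have "(trunc_coeff N \<sigma>1 \<sigma>2 k)\<^sup>2 \<le> real (card ?F) * (\<Sum>x\<in>?F. (?w x)\<^sup>2)"
      unfolding trunc_coeff_def using sum_squared_le_sum_of_squares[of ?w ?F] by (simp add: mult.commute)
    also have "\<dots> \<le> D * (\<Sum>x\<in>?F. (?w x)\<^sup>2)"
      by (intro mult_right_mono card sum_nonneg) auto
    finally have "real k * (trunc_coeff N \<sigma>1 \<sigma>2 k)\<^sup>2 \<le> real k * (D * (\<Sum>x\<in>?F. (?w x)\<^sup>2))"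
      by (rule mult_left_mono) simp
    also have "\<dots> = (\<Sum>x\<in>?F. D * ((real k * ?w x) * ?w x))"
      by (simp add: sum_distrib_left power2_eq_square mult_ac)
    also have "\<dots> \<le> (\<Sum>x\<in>?F. D * (real N powr ?e * ?w x))"
    proof (intro sum_mono mult_left_mono mult_right_mono pair_weight_nonneg \<open>0 \<le> D\<close>)
      fix x assume x: "x \<in> ?F"
      then have "real k = real (fst x) * real (snd x)" by auto
      then show "real k * ?w x \<le> real N powr ?e"
        using pair_weight_le_harmonic[OF assms(1-3), of x N] x by simp
    qed
    finally show ?thesis .
  qed
  then have "(\<Sum>k=1..N\<^sup>2. real k * (trunc_coeff N \<sigma>1 \<sigma>2 k)\<^sup>2) \<le>
     (\<Sum>k=1..N\<^sup>2. \<Sum>x\<in>{x\<in>ordered_pairs N. fst x * snd x = k}. D * (real N powr ?e * ?w x))"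
    by (rule sum_mono)
  also have "\<dots> = D * real N powr ?e * (\<Sum>x\<in>ordered_pairs N. ?w x)"
    unfolding sum_over_products by (simp add: sum_distrib_left mult.assoc)
  also have "\<dots> \<le> D * real N powr ?e * ((harm N)\<^sup>2 * real N powr ?e)"
    by (intro mult_left_mono sum_pair_weight_le assms mult_nonneg_nonneg) auto
  also have "\<dots> = D * (harm N)\<^sup>2 * (real N powr ?e * real N powr ?e)" by simp
  also have "real N powr ?e * real N powr ?e = real N powr (2 * ?e)"
    by (simp only: powr_add[symmetric] mult_2)
  finally show ?thesis .
qed

lemma dz_partial_mean_square:
  assumes \<tau>: "\<tau> \<le> 1" "\<tau> \<le> \<sigma>1" "\<tau> + \<sigma>2 \<le> 2" and \<eta>: "0 < \<eta>"
  shows "\<exists>C\<ge>0. \<forall>N\<ge>1. \<forall>A B. A \<le> B \<longrightarrow>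
     \<bar>integral {A..B} (\<lambda>t. (norm (dz_partial N (Complex \<sigma>1 t) (Complex \<sigma>2 t)))\<^sup>2)
        - (B - A) * (\<Sum>k=1..N\<^sup>2. (trunc_coeff N \<sigma>1 \<sigma>2 k)\<^sup>2)\<bar> \<le> C * real N powr (2 * (2 - \<tau> - \<sigma>2) + \<eta>)"
proof -
  let ?e = "2 - \<tau> - \<sigma>2"
  \<comment> \<open>Six factors N powr \<theta> are spent: two on the square of
    \<open>harm N\<close>, two on \<open>harm (N\<^sup>2)\<close> and two on the divisor bound for k
    up to \<open>N\<^sup>2\<close>.\<close>
  define \<theta> where "\<theta> = \<eta> / 6"
  have \<theta>: "0 < \<theta>" using \<eta> by (simp add: \<theta>_def)
  obtain H where H: "H > 0" "\<And>N. 1 \<le> N \<Longrightarrow> harm N \<le> H * real N powr \<theta>" using harm_le_powr[OF \<theta>] by blast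
  obtain D where D: "D > 0" "\<And>k. 0 < k \<Longrightarrow> real (num_divisors k) \<le> D * real k powr \<theta>"
    using num_divisors_le_powr[OF \<theta>] by blast
  define C where "C = 2 * (H\<^sup>2)\<^sup>2 + 4 * H * (D * H\<^sup>2)"
  have "\<bar>integral {A..B} (\<lambda>t. (norm (dz_partial N (Complex \<sigma>1 t) (Complex \<sigma>2 t)))\<^sup>2)
        - (B - A) * (\<Sum>k=1..N\<^sup>2. (trunc_coeff N \<sigma>1 \<sigma>2 k)\<^sup>2)\<bar> \<le> C * real N powr (2 * ?e + \<eta>)"
    if N: "1 \<le> N" and AB: "A \<le> B" for N A B
  proof -
    let ?c = "trunc_coeff N \<sigma>1 \<sigma>2" and ?n = "real N"
    have n1: "1 \<le> ?n" using N by simp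
    have sqp: "(?n powr a)\<^sup>2 = ?n powr (2 * a)" for a
      by (simp add: power2_eq_square flip: powr_add)
    have N2: "real (N\<^sup>2) powr a = ?n powr (2 * a)" for a
      using n1 by (simp add: power2_eq_square powr_mult flip: powr_add)
    have h0: "(0::real) \<le> harm M" for M by (simp add: harm_nonneg)
    have harmN: "(harm N :: real)\<^sup>2 \<le> H\<^sup>2 * ?n powr (2 * \<theta>)"
      using power_mono[OF H(2)[OF N] h0, of 2] by (simp add: power_mult_distrib sqp)
    have "N\<^sup>2 \<ge> 1" using N by simp
    from H(2)[OF this] have harmNN: "harm (N\<^sup>2) \<le> H * ?n powr (2 * \<theta>)" by (simp only: N2)
    have sc: "(\<Sum>k=1..N\<^sup>2. ?c k) \<le> H\<^sup>2 * ?n powr (2 * \<theta> + ?e)"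
    proof -
      have "(\<Sum>k=1..N\<^sup>2. ?c k) \<le> (harm N)\<^sup>2 * ?n powr ?e"
        unfolding sum_trunc_coeff by (rule sum_pair_weight_le[OF \<tau>])
      also have "\<dots> \<le> (H\<^sup>2 * ?n powr (2 * \<theta>)) * ?n powr ?e"
        by (intro mult_right_mono harmN) auto
      finally show ?thesis by (simp only: powr_add mult.assoc)
    qed
    have sc2: "(\<Sum>k=1..N\<^sup>2. ?c k)\<^sup>2 \<le> (H\<^sup>2)\<^sup>2 * ?n powr (2 * ?e + \<eta>)"
    proof -
      have "(\<Sum>k=1..N\<^sup>2. ?c k)\<^sup>2 \<le> (H\<^sup>2 * ?n powr (2 * \<theta> + ?e))\<^sup>2"
        by (intro power_mono sc sum_nonneg trunc_coeff_nonneg)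
      also have "\<dots> = (H\<^sup>2)\<^sup>2 * ?n powr (2 * (2 * \<theta> + ?e))" by (simp only: power_mult_distrib sqp)
      also have "\<dots> \<le> (H\<^sup>2)\<^sup>2 * ?n powr (2 * ?e + \<eta>)"
        using \<eta> n1 by (intro mult_left_mono powr_mono) (auto simp: \<theta>_def)
      finally show ?thesis .
    qed
    have "real (num_divisors k) \<le> D * ?n powr (2 * \<theta>)" if "k \<in> {1..N\<^sup>2}" for k
    proof -
      have "real (num_divisors k) \<le> D * real k powr \<theta>" using that by (intro D) auto
      also have "\<dots> \<le> D * real (N\<^sup>2) powr \<theta>"
        using that D(1) \<theta> by (intro mult_left_mono powr_mono2) (auto simp del: of_nat_power)
      finally show ?thesis by (simp only: N2)
    qed
    from sum_trunc_coeff_sq_weighted_le[OF \<tau> this]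
    have "(\<Sum>k=1..N\<^sup>2. real k * (?c k)\<^sup>2) \<le> (D * ?n powr (2 * \<theta>)) * (harm N)\<^sup>2 * ?n powr (2 * ?e)"
      using D(1) by simp
    also have "\<dots> \<le> (D * ?n powr (2 * \<theta>)) * (H\<^sup>2 * ?n powr (2 * \<theta>)) * ?n powr (2 * ?e)"
      using D(1) by (intro mult_right_mono mult_left_mono harmN mult_nonneg_nonneg) auto
    also have "\<dots> = D * H\<^sup>2 * ?n powr (2 * \<theta> + 2 * \<theta> + 2 * ?e)"
      by (simp only: powr_add mult_ac)
    finally have sq: "(\<Sum>k=1..N\<^sup>2. real k * (?c k)\<^sup>2) \<le> D * H\<^sup>2 * ?n powr (2 * \<theta> + 2 * \<theta> + 2 * ?e)" .
    have t2: "4 * harm (N\<^sup>2) * (\<Sum>k=1..N\<^sup>2. real k * (?c k)\<^sup>2) \<le> 4 * H * (D * H\<^sup>2) * ?n powr (2 * ?e + \<eta>)"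
    proof -
      have "4 * harm (N\<^sup>2) * (\<Sum>k=1..N\<^sup>2. real k * (?c k)\<^sup>2) \<le>
          4 * (H * ?n powr (2 * \<theta>)) * (D * H\<^sup>2 * ?n powr (2 * \<theta> + 2 * \<theta> + 2 * ?e))"
        using H(1) D(1) by (intro mult_mono mult_left_mono harmNN sq sum_nonneg mult_nonneg_nonneg) auto
      also have "\<dots> = 4 * H * (D * H\<^sup>2) * ?n powr (2 * \<theta> + (2 * \<theta> + 2 * \<theta> + 2 * ?e))"
        by (simp only: powr_add mult_ac)
      also have "2 * \<theta> + (2 * \<theta> + 2 * \<theta> + 2 * ?e) = 2 * ?e + \<eta>" by (simp add: \<theta>_def)
      finally show ?thesis .
    qed
    have "\<bar>integral {A..B} (\<lambda>t. (norm (dirichlet_poly {1..N\<^sup>2} ?c t))\<^sup>2) - (B - A) * (\<Sum>k=1..N\<^sup>2. (?c k)\<^sup>2)\<bar>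
      \<le> 2 * (\<Sum>k=1..N\<^sup>2. ?c k)\<^sup>2 + 4 * harm (N\<^sup>2) * (\<Sum>k=1..N\<^sup>2. real k * (?c k)\<^sup>2)"
      by (rule order_trans[OF dirichlet_poly_mean_square hilbert_sum_le])
         (use AB trunc_coeff_nonneg in auto)
    also have "\<dots> \<le> 2 * ((H\<^sup>2)\<^sup>2 * ?n powr (2 * ?e + \<eta>)) + 4 * H * (D * H\<^sup>2) * ?n powr (2 * ?e + \<eta>)"
      by (intro add_mono mult_left_mono sc2 t2) auto
    also have "\<dots> = C * ?n powr (2 * ?e + \<eta>)" by (simp add: C_def algebra_simps)
    finally show ?thesis by (simp only: dz_partial_eq_dirichlet_poly)
  qed
  moreover have "0 \<le> C" using H(1) D(1) by (simp add: C_def)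
  ultimately show ?thesis by blast
qed

text \<open>The approximation error in terms of \<open>X\<close> alone: the term with the sum over m
  dominates, the extra \<delta> absorbs its logarithm, and \<delta> \<le> 1 keeps N below X ^
  3.\<close>

lemma double_zeta_approximation_error:
  assumes \<tau>: "\<tau> \<le> 1" "\<tau> \<le> \<sigma>1" and e: "0 \<le> 2 - \<tau> - \<sigma>2" and \<delta>: "0 < \<delta>" "\<delta> \<le> 1"
  shows "\<exists>K\<ge>0. \<forall>X t N. 2 \<le> X \<longrightarrow> X \<le> t \<longrightarrow> t \<le> 2 * X \<longrightarrow> X powr (1 + \<delta>) \<le> real N \<longrightarrow> real N \<le> 2 * X powr (1 + \<delta>) \<longrightarrow>
     norm (double_zeta (Complex \<sigma>1 t) (Complex \<sigma>2 t) - dz_partial N (Complex \<sigma>1 t) (Complex \<sigma>2 t))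
       \<le> K * X powr ((1 + \<delta>) * (2 - \<tau> - \<sigma>2 + \<delta>) - 1)"
proof -
  let ?e = "2 - \<tau> - \<sigma>2"
  obtain K where K: "0 \<le> K" "\<And>X t N. 1 \<le> X \<Longrightarrow> X \<le> t \<Longrightarrow> t \<le> 2 * X \<Longrightarrow> X powr (1 + \<delta>) \<le> real N \<Longrightarrow> real N \<le> X ^ 3 \<Longrightarrow>
     norm (double_zeta (Complex \<sigma>1 t) (Complex \<sigma>2 t) - dz_partial N (Complex \<sigma>1 t) (Complex \<sigma>2 t)) \<le>
       K * (real N powr (1 - \<sigma>2) / X * (\<Sum>m=1..<N. real m powr (- \<sigma>1)) + real N powr (2 - \<sigma>1 - \<sigma>2) / X\<^sup>2)"
    using double_zeta_approximation[OF \<delta>(1), where ?\<sigma>1.0 = \<sigma>1 and ?\<sigma>2.0 = \<sigma>2] by blast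
  obtain H where H: "H > 0" "\<And>N. 1 \<le> N \<Longrightarrow> harm N \<le> H * real N powr \<delta>" using harm_le_powr[OF \<delta>(1)] by blast
  define K' where "K' = K * (H + 1) * 2 powr (?e + \<delta>)"
  have "norm (double_zeta (Complex \<sigma>1 t) (Complex \<sigma>2 t) - dz_partial N (Complex \<sigma>1 t) (Complex \<sigma>2 t))
       \<le> K' * X powr ((1 + \<delta>) * (?e + \<delta>) - 1)"
    if X: "2 \<le> X" "X \<le> t" "t \<le> 2 * X" and N: "X powr (1 + \<delta>) \<le> real N" "real N \<le> 2 * X powr (1 + \<delta>)" for X t N
  proof -
    have "X powr 1 \<le> X powr (1 + \<delta>)" using X \<delta> by (intro powr_mono) auto
    then have XN: "X \<le> real N" using X N by simp
    then have N1: "1 \<le> real N" "1 \<le> N" using X by auto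
    have "X powr (1 + \<delta>) \<le> X powr 2" using X \<delta> by (intro powr_mono) auto
    then have "2 * X powr (1 + \<delta>) \<le> X * X\<^sup>2" using X powr_realpow[of X 2] by (intro mult_mono) auto
    then have N3: "real N \<le> X ^ 3" using N by (simp add: power3_eq_cube power2_eq_square)
    have "real N powr (1 - \<sigma>2) / X * (\<Sum>m=1..<N. real m powr (- \<sigma>1)) \<le> H * (real N powr (?e + \<delta>) / X)"
    proof -
      have "(\<Sum>m=1..<N. real m powr (- \<sigma>1)) \<le> harm N * real N powr (1 - \<tau>)"
        by (rule sum_powr_le_harm[OF \<tau> N1(2)])
      also have "\<dots> \<le> (H * real N powr \<delta>) * real N powr (1 - \<tau>)"
        using H(2)[OF N1(2)] by (intro mult_right_mono) auto
      finally have "real N powr (1 - \<sigma>2) / X * (\<Sum>m=1..<N. real m powr (- \<sigma>1)) \<le> real N powr (1 - \<sigma>2) / X * ((H * real N powr \<delta>) * real N powr (1 - \<tau>))"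
        using X by (intro mult_left_mono) auto
      also have "\<dots> = H * (real N powr ((1 - \<sigma>2) + \<delta> + (1 - \<tau>)) / X)"
        by (simp only: powr_add times_divide_eq_left times_divide_eq_right mult_ac)
      also have "(1 - \<sigma>2) + \<delta> + (1 - \<tau>) = ?e + \<delta>" by simp
      finally show ?thesis .
    qed
    moreover have "real N powr (2 - \<sigma>1 - \<sigma>2) / X\<^sup>2 \<le> 1 * (real N powr (?e + \<delta>) / X)"
    proof -
      have "real N powr (2 - \<sigma>1 - \<sigma>2) \<le> real N powr (?e + \<delta>)"
        using N1 \<tau> \<delta> by (intro powr_mono) auto
      moreover have "X \<le> X\<^sup>2" using X by (simp add: power2_eq_square)
      ultimately show ?thesis using X by (simp add: frac_le)
    qed
    ultimately have "real N powr (1 - \<sigma>2) / X * (\<Sum>m=1..<N. real m powr (- \<sigma>1)) + real N powr (2 - \<sigma>1 - \<sigma>2) / X\<^sup>2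
        \<le> (H + 1) * (real N powr (?e + \<delta>) / X)"
      by (simp only: distrib_right add_mono)
    then have "norm (double_zeta (Complex \<sigma>1 t) (Complex \<sigma>2 t) - dz_partial N (Complex \<sigma>1 t) (Complex \<sigma>2 t)) \<le>
       K * ((H + 1) * (real N powr (?e + \<delta>) / X))"
      using X N(1) N3 by (intro order_trans[OF K(2)[of X t N]] mult_left_mono K(1)) auto
    also have "\<dots> \<le> K * ((H + 1) * ((2 * X powr (1 + \<delta>)) powr (?e + \<delta>) / X))"
      using K(1) H(1) X N e \<delta> by (intro mult_left_mono divide_right_mono powr_mono2) auto
    also have "(2 * X powr (1 + \<delta>)) powr (?e + \<delta>) / X = 2 powr (?e + \<delta>) * X powr ((1 + \<delta>) * (?e + \<delta>) - 1)"
    proof -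
      have "X powr ((1 + \<delta>) * (?e + \<delta>) - 1) = X powr ((1 + \<delta>) * (?e + \<delta>)) / X"
        using X powr_diff[of X "(1 + \<delta>) * (?e + \<delta>)" 1] by simp
      then show ?thesis using X by (simp add: powr_mult powr_powr)
    qed
    finally show ?thesis by (simp add: K'_def mult.assoc)
  qed
  moreover have "0 \<le> K'" using K(1) H(1) by (simp add: K'_def)
  ultimately show ?thesis by blast
qed

section \<open>Mean squares off the critical line\<close>

lemma continuous_on_double_zeta_vertical:
  "continuous_on {0<..} (\<lambda>t. double_zeta (Complex \<sigma>1 t) (Complex \<sigma>2 t))"
proof -
  have C: "continuous_on {0<..} (\<lambda>t. Complex a t)" for a
    unfolding Complex_eq by (intro continuous_intros)
  have "continuous_on {0<..} (\<lambda>t. (Complex \<sigma>1 t, Complex \<sigma>2 t))"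
    by (intro continuous_on_Pair C)
  moreover have "(\<lambda>t. (Complex \<sigma>1 t, Complex \<sigma>2 t)) ` {0<..} \<subseteq> double_zeta_dom"
    using vertical_in_dz_region[of _ "min \<sigma>2 (\<sigma>1 + \<sigma>2) - 1" \<sigma>2 \<sigma>1] by (auto simp: dz_region_def)
  ultimately show ?thesis
    using continuous_on_compose2[OF continuous_on_double_zeta] by fastforce
qed

lemma integrable_double_zeta_sq:
  "0 < A \<Longrightarrow> (\<lambda>t. (norm (double_zeta (Complex \<sigma>1 t) (Complex \<sigma>2 t)))\<^sup>2) integrable_on {A..B}"
  by (intro integrable_continuous_interval continuous_intros
      continuous_on_subset[OF continuous_on_double_zeta_vertical]) auto

lemma continuous_on_dz_partial_vertical:
  "continuous_on S (\<lambda>t. dz_partial N (Complex \<sigma>1 t) (Complex \<sigma>2 t))"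
  unfolding dz_partial_eq_dirichlet_poly by (rule continuous_on_dirichlet_poly)

lemma double_zeta_mean_square_split:
  assumes "2 \<le> A" "A \<le> B"
  shows "double_zeta_mean_square \<sigma>1 \<sigma>2 B = double_zeta_mean_square \<sigma>1 \<sigma>2 A
    + integral {A..B} (\<lambda>t. (norm (double_zeta (Complex \<sigma>1 t) (Complex \<sigma>2 t)))\<^sup>2)"
  unfolding double_zeta_mean_square_def
  using assms by (intro Henstock_Kurzweil_Integration.integral_combine[symmetric] integrable_double_zeta_sq) auto

text \<open>Pointwise, 2 * b \<le> 1 + b ^ 2 replaces Cauchy--Schwarz for the integrals. Nothing
  essential is lost in the application, where the mean square of \<open>g\<close> is at most of the
  order of the length.\<close>

lemma mean_square_compare:
  fixes f g :: "real \<Rightarrow> complex"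
  assumes f: "continuous_on {A..B} f" and g: "continuous_on {A..B} g" and AB: "A \<le> B"
    and r: "\<And>t. t \<in> {A..B} \<Longrightarrow> norm (f t - g t) \<le> r" and "0 \<le> r"
  shows "\<bar>integral {A..B} (\<lambda>t. (norm (f t))\<^sup>2) - integral {A..B} (\<lambda>t. (norm (g t))\<^sup>2)\<bar>
    \<le> r * ((B - A) + integral {A..B} (\<lambda>t. (norm (g t))\<^sup>2) + r * (B - A))"
proof -
  have If: "(\<lambda>t. (norm (f t))\<^sup>2) integrable_on {A..B}" and Ig: "(\<lambda>t. (norm (g t))\<^sup>2) integrable_on {A..B}"
    by (intro integrable_continuous_interval continuous_intros f g)+
  have pt: "norm ((norm (f t))\<^sup>2 - (norm (g t))\<^sup>2) \<le> r * (1 + (norm (g t))\<^sup>2 + r)" if t: "t \<in> {A..B}" for t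
  proof -
    let ?a = "norm (f t)" and ?b = "norm (g t)"
    have d: "\<bar>?a - ?b\<bar> \<le> r" using norm_triangle_ineq3[of "f t" "g t"] r[OF t] by linarith
    have "0 \<le> (?b - 1)\<^sup>2" by simp
    then have "2 * ?b \<le> 1 + ?b\<^sup>2" by (simp add: power2_diff)
    then have s: "?a + ?b \<le> 1 + ?b\<^sup>2 + r" using d by linarith
    have "\<bar>?a\<^sup>2 - ?b\<^sup>2\<bar> = \<bar>?a - ?b\<bar> * (?a + ?b)"
      by (simp add: square_diff_square_factored power2_eq_square abs_mult mult.commute)
    also have "\<dots> \<le> r * (1 + ?b\<^sup>2 + r)"
      using d s \<open>0 \<le> r\<close> by (intro mult_mono) auto
    finally show ?thesis by simp
  qed
  have Ih: "(\<lambda>t. r * (1 + (norm (g t))\<^sup>2 + r)) integrable_on {A..B}"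
    by (intro integrable_continuous_interval continuous_intros g)
  have "\<bar>integral {A..B} (\<lambda>t. (norm (f t))\<^sup>2 - (norm (g t))\<^sup>2)\<bar> \<le> integral {A..B} (\<lambda>t. r * (1 + (norm (g t))\<^sup>2 + r))"
    using integral_norm_bound_integral[OF integrable_diff[OF If Ig] Ih pt] by simp
  also have "integral {A..B} (\<lambda>t. r * (1 + (norm (g t))\<^sup>2 + r)) = r * (integral {A..B} (\<lambda>t. (1 + r) + (norm (g t))\<^sup>2))"
    by (simp add: add_ac)
  also have "integral {A..B} (\<lambda>t. (1 + r) + (norm (g t))\<^sup>2) = (1 + r) * (B - A) + integral {A..B} (\<lambda>t. (norm (g t))\<^sup>2)"
    using AB by (subst integral_add) (auto simp: Ig)
  also have "integral {A..B} (\<lambda>t. (norm (f t))\<^sup>2 - (norm (g t))\<^sup>2) = integral {A..B} (\<lambda>t. (norm (f t))\<^sup>2) - integral {A..B} (\<lambda>t. (norm (g t))\<^sup>2)"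
    by (rule integral_diff[OF If Ig])
  finally show ?thesis by (simp add: algebra_simps)
qed

lemma dyadic_length:
  fixes X \<delta> :: real
  assumes "2 \<le> X" "0 < \<delta>"
  obtains N :: nat where "X powr (1 + \<delta>) \<le> real N" "real N \<le> 2 * X powr (1 + \<delta>)" "X \<le> real N" "1 \<le> N"
proof -
  define N where "N = nat \<lceil>X powr (1 + \<delta>)\<rceil>"
  have "X powr 1 \<le> X powr (1 + \<delta>)" using assms by (intro powr_mono) auto
  then have X: "X \<le> X powr (1 + \<delta>)" using assms by simp
  then have N: "X powr (1 + \<delta>) \<le> real N" "real N \<le> X powr (1 + \<delta>) + 1"
    using assms unfolding N_def by linarith+
  then show ?thesis using X assms by (intro that[of N]) auto
qed

text \<open>With e = 2 - \<tau> - \<sigma>2 there are three errors: the off-diagonal part N powr (2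
  * e + \<delta>); the truncation of the coefficients, X times a power of N with exponent close to 2
  * e - 1; and the approximation, X times X powr (-1/2).\<close>

lemma mean_square_dyadic:
  assumes \<tau>: "\<tau> \<le> 1" "\<tau> \<le> \<sigma>1" and e: "0 \<le> 2 - \<tau> - \<sigma>2" "2 - \<tau> - \<sigma>2 < 1/2" and \<epsilon>: "0 < \<epsilon>"
  shows "\<exists>C\<ge>0. \<forall>X\<ge>2. \<bar>integral {X..2 * X} (\<lambda>t. (norm (double_zeta (Complex \<sigma>1 t) (Complex \<sigma>2 t)))\<^sup>2)
     - double_zeta_box \<sigma>1 \<sigma>2 * X\<bar> \<le> C * (X powr (2 * (2 - \<tau> - \<sigma>2) + \<epsilon>) + X powr (1/2))"
proof -
  define e where "e = 2 - \<tau> - \<sigma>2"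
  have e: "0 \<le> e" "e < 1/2" using assms by (auto simp: e_def)
  \<comment> \<open>The part \<epsilon> / 4 covers the exponent (1 + \<delta>) * (2 * e + \<delta>)
    \<le> 2 * e + 4 * \<delta>; a third of 1/2 - e keeps this at most 1 and brings the approximation
    error down to X powr (-1/2).\<close>
  define \<delta> where "\<delta> = min (min (\<epsilon> / 4) ((1/2 - e) / 3)) 1"
  have \<delta>: "0 < \<delta>" "\<delta> \<le> 1" "4 * \<delta> \<le> \<epsilon>" "3 * \<delta> \<le> 1/2 - e"
    using \<epsilon> e by (auto simp: \<delta>_def min_def field_simps)
  have nl: "\<delta> * e \<le> \<delta> * (1/2)" "\<delta> * \<delta> \<le> \<delta> * 1"
    using \<delta> e by (intro mult_left_mono; simp)+
  define S where "S = double_zeta_box \<sigma>1 \<sigma>2"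
  obtain K where K: "0 \<le> K" "\<And>X t N. 2 \<le> X \<Longrightarrow> X \<le> t \<Longrightarrow> t \<le> 2 * X \<Longrightarrow> X powr (1 + \<delta>) \<le> real N \<Longrightarrow> real N \<le> 2 * X powr (1 + \<delta>) \<Longrightarrow>
     norm (double_zeta (Complex \<sigma>1 t) (Complex \<sigma>2 t) - dz_partial N (Complex \<sigma>1 t) (Complex \<sigma>2 t))
       \<le> K * X powr ((1 + \<delta>) * (e + \<delta>) - 1)"
    using double_zeta_approximation_error[OF \<tau> assms(3) \<delta>(1,2)] unfolding e_def by blast
  obtain C1 where C1: "0 \<le> C1" "\<And>N A B. 1 \<le> N \<Longrightarrow> A \<le> B \<Longrightarrow>
     \<bar>integral {A..B} (\<lambda>t. (norm (dz_partial N (Complex \<sigma>1 t) (Complex \<sigma>2 t)))\<^sup>2)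
        - (B - A) * (\<Sum>k=1..N\<^sup>2. (trunc_coeff N \<sigma>1 \<sigma>2 k)\<^sup>2)\<bar> \<le> C1 * real N powr (2 * e + \<delta>)"
    using dz_partial_mean_square[OF \<tau> _ \<delta>(1), of \<sigma>2] assms(3) unfolding e_def by auto
  \<comment> \<open>The exponent p = 1 - e = \<tau> + \<sigma>2 - 1 is admissible: p \<le> \<sigma>2
    since \<tau> \<le> 1, and 2 * p \<le> \<sigma>1 + \<sigma>2 since \<tau> \<le> \<sigma>1 and
    \<tau> + \<sigma>2 \<le> 2.\<close>
  obtain C2 where C2: "0 \<le> C2" "\<And>N. 1 \<le> N \<Longrightarrow> \<bar>S - (\<Sum>k=1..N\<^sup>2. (trunc_coeff N \<sigma>1 \<sigma>2 k)\<^sup>2)\<bar>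
    \<le> C2 * real N powr (1 - (2 * (1 - e) - 2 * \<delta>))"
    using sum_trunc_coeff_sq_approx[of "1 - e" \<sigma>2 \<sigma>1 \<delta>] assms \<delta> e unfolding e_def S_def by auto
  define C3 where "C3 = C1 * 2 powr (2 * e + \<delta>) + C2"
  have C3: "0 \<le> C3" using C1(1) C2(1) by (simp add: C3_def)
  define C where "C = C3 + K * (1 + \<bar>S\<bar> + C3 + K)"
  have "\<bar>integral {X..2 * X} (\<lambda>t. (norm (double_zeta (Complex \<sigma>1 t) (Complex \<sigma>2 t)))\<^sup>2) - S * X\<bar>
    \<le> C * (X powr (2 * e + \<epsilon>) + X powr (1/2))" if X: "2 \<le> X" for X
  proof -
    obtain N where N: "X powr (1 + \<delta>) \<le> real N" "real N \<le> 2 * X powr (1 + \<delta>)" "X \<le> real N" "1 \<le> N"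
      using dyadic_length[OF X \<delta>(1)] .
    let ?D = "\<lambda>t. dz_partial N (Complex \<sigma>1 t) (Complex \<sigma>2 t)" and ?Z = "\<lambda>t. double_zeta (Complex \<sigma>1 t) (Complex \<sigma>2 t)"
    define Q where "Q = integral {X..2 * X} (\<lambda>t. (norm (?D t))\<^sup>2)"
    define \<Sigma> where "\<Sigma> = (\<Sum>k=1..N\<^sup>2. (trunc_coeff N \<sigma>1 \<sigma>2 k)\<^sup>2)"
    have m1: "\<bar>Q - X * \<Sigma>\<bar> \<le> C1 * 2 powr (2 * e + \<delta>) * X powr (2 * e + 4 * \<delta>)"
    proof -
      have "\<bar>Q - X * \<Sigma>\<bar> \<le> C1 * real N powr (2 * e + \<delta>)"
        using C1(2)[OF N(4), of X "2 * X"] X by (simp add: Q_def \<Sigma>_def)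
      also have "\<dots> \<le> C1 * (2 * X powr (1 + \<delta>)) powr (2 * e + \<delta>)"
        using N e \<delta> C1(1) by (intro mult_left_mono powr_mono2) auto
      also have "\<dots> = C1 * 2 powr (2 * e + \<delta>) * X powr ((1 + \<delta>) * (2 * e + \<delta>))"
        using X by (simp add: powr_mult powr_powr)
      also have "\<dots> \<le> C1 * 2 powr (2 * e + \<delta>) * X powr (2 * e + 4 * \<delta>)"
      proof (intro mult_left_mono powr_mono)
        show "(1 + \<delta>) * (2 * e + \<delta>) \<le> 2 * e + 4 * \<delta>"
        proof -
          have "(1 + \<delta>) * (2 * e + \<delta>) = 2 * e + \<delta> + 2 * (\<delta> * e) + \<delta> * \<delta>" by (simp add: algebra_simps)
          then show ?thesis using nl \<delta>(1) by linarith
        qed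
      qed (use X C1(1) in auto)
      finally show ?thesis .
    qed
    have m2: "\<bar>X * \<Sigma> - S * X\<bar> \<le> C2 * X powr (2 * e + 4 * \<delta>)"
    proof -
      have "\<bar>S - \<Sigma>\<bar> \<le> C2 * real N powr (1 - (2 * (1 - e) - 2 * \<delta>))"
        using C2(2)[OF N(4)] by (simp add: \<Sigma>_def)
      also have "\<dots> \<le> C2 * X powr (1 - (2 * (1 - e) - 2 * \<delta>))"
        using N X e \<delta> C2(1) by (intro mult_left_mono powr_mono2') auto
      finally have "X * \<bar>S - \<Sigma>\<bar> \<le> X * (C2 * X powr (1 - (2 * (1 - e) - 2 * \<delta>)))"
        using X by (intro mult_left_mono) auto
      also have "\<dots> = C2 * (X powr 1 * X powr (1 - (2 * (1 - e) - 2 * \<delta>)))" using X by simp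
      also have "\<dots> = C2 * X powr (1 + (1 - (2 * (1 - e) - 2 * \<delta>)))" by (simp only: powr_add)
      also have "\<dots> \<le> C2 * X powr (2 * e + 4 * \<delta>)"
        using X \<delta> C2(1) by (intro mult_left_mono powr_mono) auto
      finally have "X * \<bar>S - \<Sigma>\<bar> \<le> C2 * X powr (2 * e + 4 * \<delta>)" .
      moreover have "\<bar>X * \<Sigma> - S * X\<bar> = X * \<bar>S - \<Sigma>\<bar>"
      proof -
        have "X * \<Sigma> - S * X = - (X * (S - \<Sigma>))" by (simp add: algebra_simps)
        then show ?thesis using X by (simp add: abs_mult)
      qed
      ultimately show ?thesis by simp
    qed
    have m: "\<bar>Q - S * X\<bar> \<le> C3 * X powr (2 * e + 4 * \<delta>)"
      using m1 m2 by (simp add: C3_def distrib_right)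
    have "X powr (2 * e + 4 * \<delta>) \<le> X powr 1" using X \<delta> e by (intro powr_mono) auto
    then have "C3 * X powr (2 * e + 4 * \<delta>) \<le> C3 * X" using X C3 by (intro mult_left_mono) auto
    with m have "Q \<le> S * X + C3 * X" by linarith
    also have "S * X \<le> \<bar>S\<bar> * X" using X by (intro mult_right_mono) auto
    finally have Qle: "Q \<le> (\<bar>S\<bar> + C3) * X" by (simp add: distrib_right)
    define r where "r = K * X powr (-1/2)"
    have r0: "0 \<le> r" using K(1) by (simp add: r_def)
    have "X powr (-1/2) \<le> X powr 0" using X by (intro powr_mono) auto
    then have rK: "r \<le> K" using K(1) X by (simp add: r_def mult_left_le)
    have err: "norm (?Z t - ?D t) \<le> r" if t: "t \<in> {X..2 * X}" for t
    proof -
      have "norm (?Z t - ?D t) \<le> K * X powr ((1 + \<delta>) * (e + \<delta>) - 1)"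
        using t X N by (intro K(2)) auto
      also have "\<dots> \<le> K * X powr (-1/2)"
      proof (intro mult_left_mono powr_mono)
        show "(1 + \<delta>) * (e + \<delta>) - 1 \<le> -1/2"
        proof -
          have "(1 + \<delta>) * (e + \<delta>) = e + \<delta> + \<delta> * e + \<delta> * \<delta>" by (simp add: algebra_simps)
          then show ?thesis using nl \<delta> e by linarith
        qed
      qed (use X K(1) in auto)
      finally show ?thesis by (simp add: r_def)
    qed
    have "\<bar>integral {X..2 * X} (\<lambda>t. (norm (?Z t))\<^sup>2) - Q\<bar> \<le> r * ((2 * X - X) + Q + r * (2 * X - X))"
      unfolding Q_def
      by (rule mean_square_compare[OF _ continuous_on_dz_partial_vertical _ err r0])
         (use X in \<open>auto intro!: continuous_on_subset[OF continuous_on_double_zeta_vertical]\<close>)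
    also have "\<dots> \<le> r * (X + (\<bar>S\<bar> + C3) * X + K * X)"
      using r0 Qle rK X by (intro mult_left_mono add_mono mult_right_mono) auto
    also have "\<dots> = K * (1 + \<bar>S\<bar> + C3 + K) * (X powr (-1/2) * X powr 1)"
      using X by (simp add: r_def algebra_simps)
    also have "X powr (-1/2) * X powr 1 = X powr (1/2)" by (simp only: powr_add[symmetric]) simp
    finally have cmp: "\<bar>integral {X..2 * X} (\<lambda>t. (norm (?Z t))\<^sup>2) - Q\<bar> \<le> K * (1 + \<bar>S\<bar> + C3 + K) * X powr (1/2)" .
    have "C3 * X powr (2 * e + 4 * \<delta>) \<le> C3 * X powr (2 * e + \<epsilon>)"
      using X \<delta> C3 by (intro mult_left_mono powr_mono) auto
    with m have "\<bar>Q - S * X\<bar> \<le> C3 * X powr (2 * e + \<epsilon>)" by linarith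
    with cmp have "\<bar>integral {X..2 * X} (\<lambda>t. (norm (?Z t))\<^sup>2) - S * X\<bar> \<le>
       C3 * X powr (2 * e + \<epsilon>) + K * (1 + \<bar>S\<bar> + C3 + K) * X powr (1/2)" by linarith
    also have "\<dots> \<le> C * X powr (2 * e + \<epsilon>) + C * X powr (1/2)"
      using C3 K(1) by (intro add_mono mult_right_mono) (auto simp: C_def)
    finally show ?thesis by (simp add: distrib_left)
  qed
  moreover have "0 \<le> C" using C3 K(1) by (simp add: C_def)
  ultimately show ?thesis unfolding S_def e_def by blast
qed

text \<open>Replaces the geometric series over dyadic blocks: as g shrinks by a factor q < 1 under
  halving, a bound K * g reproduces itself as soon as K * q + C \<le> K. The induction is on the
  number of halvings.\<close>

lemma dyadic_accumulation:
  fixes F g :: "real \<Rightarrow> real"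
  assumes base: "\<And>T. 2 \<le> T \<Longrightarrow> T \<le> 4 \<Longrightarrow> \<bar>F T\<bar> \<le> C0"
    and step: "\<And>T. 4 \<le> T \<Longrightarrow> \<bar>F T - F (T / 2)\<bar> \<le> C * g T"
    and g: "\<And>T. 4 \<le> T \<Longrightarrow> g (T / 2) \<le> q * g T" "\<And>T. 2 \<le> T \<Longrightarrow> c \<le> g T"
    and q: "0 \<le> q" "q < 1" and "0 < c" "0 \<le> C" "0 \<le> C0"
  shows "\<exists>K\<ge>0. \<forall>T\<ge>2. \<bar>F T\<bar> \<le> K * g T"
proof -
  \<comment> \<open>C0 / c settles T \<le> 4, and C / (1 - q) secures K * q + C \<le> K.\<close>
  define K where "K = C0 / c + C / (1 - q)"
  have K0: "0 \<le> K" using assms by (simp add: K_def)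
  have "\<bar>F T\<bar> \<le> K * g T" if "2 \<le> T" "T \<le> 2 ^ (n + 2)" for n T
    using that
  proof (induction n arbitrary: T)
    case 0
    have "C0 / c * c \<le> K * g T"
      using g(2)[OF 0(1)] K0 assms by (intro mult_mono) (auto simp: K_def)
    then have "C0 \<le> K * g T" using \<open>0 < c\<close> by simp
    moreover have "\<bar>F T\<bar> \<le> C0" using 0 by (intro base) auto
    ultimately show ?case by linarith
  next
    case (Suc n)
    show ?case
    proof (cases "T \<le> 4")
      case True
      have "C0 / c * c \<le> K * g T"
        using g(2)[OF Suc(2)] K0 assms by (intro mult_mono) (auto simp: K_def)
      then have "C0 \<le> K * g T" using \<open>0 < c\<close> by simp
      moreover have "\<bar>F T\<bar> \<le> C0" using Suc(2) True by (rule base)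
      ultimately show ?thesis by linarith
    next
      case False
      then have T4: "4 \<le> T" by simp
      have gT: "0 \<le> g T" using g(2)[OF Suc(2)] \<open>0 < c\<close> by linarith
      have "\<bar>F (T / 2)\<bar> \<le> K * g (T / 2)" using Suc T4 by (intro Suc.IH) auto
      also have "\<dots> \<le> K * (q * g T)" using g(1)[OF T4] K0 by (rule mult_left_mono)
      finally have "\<bar>F T\<bar> \<le> K * (q * g T) + C * g T" using step[OF T4] by linarith
      also have "\<dots> = (K * q + C) * g T" by (simp add: algebra_simps)
      also have "\<dots> \<le> K * g T"
      proof (rule mult_right_mono[OF _ gT])
        have "C = C / (1 - q) * (1 - q)" using q by simp
        also have "\<dots> \<le> K * (1 - q)" using assms by (intro mult_right_mono) (auto simp: K_def)
        finally show "K * q + C \<le> K" by (simp add: algebra_simps)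
      qed
      finally show ?thesis .
    qed
  qed
  moreover have "\<exists>n. T \<le> 2 ^ (n + 2)" for T :: real
  proof -
    obtain n where "T < 2 ^ n" using real_arch_pow[of 2 T] by auto
    also have "(2::real) ^ n \<le> 2 ^ (n + 2)" by (rule power_increasing) auto
    finally show ?thesis by (intro exI[of _ n]) simp
  qed
  ultimately show ?thesis using K0 by blast
qed

lemma double_zeta_mean_square_nonneg: "0 \<le> double_zeta_mean_square \<sigma>1 \<sigma>2 T"
  unfolding double_zeta_mean_square_def
  by (rule integral_nonneg) (auto intro: integrable_double_zeta_sq)

lemma double_zeta_mean_square_mono:
  assumes "2 \<le> A" "A \<le> B"
  shows "double_zeta_mean_square \<sigma>1 \<sigma>2 A \<le> double_zeta_mean_square \<sigma>1 \<sigma>2 B"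
  using double_zeta_mean_square_split[OF assms, of \<sigma>1 \<sigma>2] assms
    integral_nonneg[OF integrable_double_zeta_sq[of A \<sigma>1 \<sigma>2 B]] by simp

text \<open>Cases (ii) and (iii) are \<tau> = 1 and \<tau> = \<sigma>1. Halving T multiplies the two
  error terms by 2 powr (-a) and 2 powr (-1/2); both factors are below 1, the first because
  \<epsilon> makes a positive.\<close>

theorem mean_square_asymptotic:
  assumes \<tau>: "\<tau> \<le> 1" "\<tau> \<le> \<sigma>1" and e: "0 \<le> 2 - \<tau> - \<sigma>2" "2 - \<tau> - \<sigma>2 < 1/2" and \<epsilon>: "0 < \<epsilon>"
  shows "\<exists>C. \<forall>T\<ge>2. \<bar>double_zeta_mean_square \<sigma>1 \<sigma>2 T - double_zeta_box \<sigma>1 \<sigma>2 * T\<bar>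
     \<le> C * (T powr (4 - 2 * \<tau> - 2 * \<sigma>2 + \<epsilon>) + T powr (1/2))"
proof -
  define a where "a = 2 * (2 - \<tau> - \<sigma>2) + \<epsilon>"
  have a: "0 < a" using e \<epsilon> by (simp add: a_def)
  define S where "S = double_zeta_box \<sigma>1 \<sigma>2"
  let ?I = "double_zeta_mean_square \<sigma>1 \<sigma>2"
  let ?g = "\<lambda>T::real. T powr a + T powr (1/2)"
  obtain C where C: "0 \<le> C" "\<And>X. 2 \<le> X \<Longrightarrow> \<bar>integral {X..2 * X} (\<lambda>t. (norm (double_zeta (Complex \<sigma>1 t) (Complex \<sigma>2 t)))\<^sup>2)
     - S * X\<bar> \<le> C * ?g X"
    using mean_square_dyadic[OF \<tau> e \<epsilon>] unfolding a_def S_def by blast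
  have "\<exists>K\<ge>0. \<forall>T\<ge>2. \<bar>?I T - S * T\<bar> \<le> K * ?g T"
  proof (rule dyadic_accumulation[where q = "max (2 powr (-a)) (2 powr (-1/2))" and c = 1 and C = C
        and ?C0.0 = "?I 4 + \<bar>S\<bar> * 4"])
    fix T :: real assume T: "2 \<le> T" "T \<le> 4"
    have "?I T \<le> ?I 4" using T by (intro double_zeta_mean_square_mono) auto
    moreover have "0 \<le> ?I T" by (rule double_zeta_mean_square_nonneg)
    moreover have "\<bar>S * T\<bar> \<le> \<bar>S\<bar> * 4" using T by (simp add: abs_mult mult_left_mono)
    ultimately show "\<bar>?I T - S * T\<bar> \<le> ?I 4 + \<bar>S\<bar> * 4" by linarith
  next
    fix T :: real assume T: "4 \<le> T"
    have "?I T - S * T - (?I (T / 2) - S * (T / 2)) = integral {T / 2..2 * (T / 2)} (\<lambda>t. (norm (double_zeta (Complex \<sigma>1 t) (Complex \<sigma>2 t)))\<^sup>2) - S * (T / 2)"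
      using double_zeta_mean_square_split[of "T / 2" T \<sigma>1 \<sigma>2] T by (simp add: algebra_simps)
    also have "\<bar>\<dots>\<bar> \<le> C * ?g (T / 2)" using T by (intro C(2)) auto
    also have "\<dots> \<le> C * ?g T" using T a C(1) by (intro mult_left_mono add_mono powr_mono2) auto
    finally show "\<bar>?I T - S * T - (?I (T / 2) - S * (T / 2))\<bar> \<le> C * ?g T" .
    have half: "(T / 2) powr x = 2 powr (-x) * T powr x" for x
    proof -
      have "(T / 2) powr x = T powr x / 2 powr x" using T by (subst powr_divide) auto
      then show ?thesis by (simp only: powr_minus_divide) simp
    qed
    show "?g (T / 2) \<le> max (2 powr (-a)) (2 powr (-1/2)) * ?g T"
      unfolding half distrib_left by (intro add_mono mult_right_mono) auto
  next
    fix T :: real assume T: "2 \<le> T"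
    have "1 \<le> T powr a" using T a by (intro ge_one_powr_ge_zero) auto
    then show "1 \<le> ?g T" by (simp add: add_increasing2)
  next
    have "2 powr (-a) < 2 powr 0" "2 powr (-1/2) < (2::real) powr 0" using a by (intro powr_less_mono; simp)+
    then show "max (2 powr (-a)) (2 powr (-1/2)) < (1::real)" by simp
  qed (use C(1) double_zeta_mean_square_nonneg in \<open>auto simp: le_max_iff_disj\<close>)
  then obtain K where "\<forall>T\<ge>2. \<bar>?I T - S * T\<bar> \<le> K * ?g T" by blast
  moreover have "a = 4 - 2 * \<tau> - 2 * \<sigma>2 + \<epsilon>" by (simp add: a_def)
  ultimately show ?thesis unfolding S_def by (intro exI[of _ K]) simp
qed

section \<open>The region of absolute convergence\<close>

lemma (in euler_maclaurin) dz_partial_tendsto: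
  assumes s2: "1 < Re s2" and s12: "2 < Re (s1 + s2)" and J: "1 \<le> J"
  shows "(\<lambda>N. dz_partial N s1 s2) \<longlonglongrightarrow> double_zeta s1 s2"
proof -
  define f where "f m = of_nat m powr (-s1) * zeta_tail s2 (Suc m)" for m
  define M where "M N = (\<Sum>m=1..<N. of_nat m powr (-s1) :: complex)" for N
  have "(\<lambda>i. f (Suc i)) sums double_zeta s1 s2"
    using dz_cont_sums[OF s2 s12 _ J, of 1] double_zeta_series_eq_dz_cont[OF s2 s12 _ J, of 1]
      double_zeta_eq_series[OF s2 s12] by (simp add: f_def)
  then have "(\<lambda>n. \<Sum>m=1..<Suc n. f m) \<longlonglongrightarrow> double_zeta s1 s2"
    unfolding sums_def One_nat_def sum.shift_bounds_Suc_ivl lessThan_atLeast0 .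
  then have F: "(\<lambda>N. \<Sum>m=1..<N. f m) \<longlonglongrightarrow> double_zeta s1 s2"
    by (rule LIMSEQ_imp_Suc)
  \<comment> \<open>Truncation at n < N differs from a partial sum of the outer series by the sum
    over m < N times the tail from N. In this region the exponent \<open>e\<close> below is
    negative; half of it pays for the harmonic factor and the other half sends the product to
    0.\<close>
  have eq: "dz_partial N s1 s2 = (\<Sum>m=1..<N. f m) - M N * zeta_tail s2 N" for N
  proof -
    have "f m = of_nat m powr (-s1) * (\<Sum>n=Suc m..<N. of_nat n powr (-s2)) + of_nat m powr (-s1) * zeta_tail s2 N"
      if "m \<in> {1..<N}" for m
      using zeta_tail_split[OF s2, of "Suc m" N] that by (simp add: f_def distrib_left)
    then have "(\<Sum>m=1..<N. f m) = (\<Sum>m=1..<N. \<Sum>n=Suc m..<N. of_nat m powr (-s1) * of_nat n powr (-s2)) + M N * zeta_tail s2 N"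
      by (simp add: M_def sum.distrib sum_distrib_right sum_distrib_left)
    then show ?thesis unfolding dz_partial_def sum_triangle_swap by simp
  qed
  define \<tau> where "\<tau> = min (Re s1) 1"
  define e where "e = 2 - \<tau> - Re s2"
  have \<tau>: "\<tau> \<le> 1" "\<tau> \<le> Re s1" and e: "e < 0" using s2 s12 by (auto simp: \<tau>_def e_def min_def)
  obtain H where H: "H > 0" "\<And>N. 1 \<le> N \<Longrightarrow> harm N \<le> H * real N powr (-e/2)"
    using harm_le_powr[of "-e/2"] e by auto
  define K where "K = 2 powr Re s2 / (Re s2 - 1)"
  have K: "0 \<le> K" using s2 by (simp add: K_def)
  have "norm (M N * zeta_tail s2 N) \<le> H * K * real N powr (e / 2)" if N: "1 \<le> N" for N
  proof -
    have "norm (M N) \<le> (\<Sum>m=1..<N. real m powr (- Re s1))"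
      unfolding M_def by (rule order_trans[OF norm_sum]) simp
    also have "\<dots> \<le> harm N * real N powr (1 - \<tau>)" by (rule sum_powr_le_harm[OF \<tau> N])
    also have "\<dots> \<le> (H * real N powr (-e/2)) * real N powr (1 - \<tau>)"
      by (intro mult_right_mono H N) auto
    finally have "norm (M N * zeta_tail s2 N) \<le> ((H * real N powr (-e/2)) * real N powr (1 - \<tau>)) * (K * real N powr (1 - Re s2))"
      unfolding norm_mult using norm_zeta_tail_le[OF s2 N] H(1) by (intro mult_mono) (auto simp: K_def)
    also have "\<dots> = H * K * real N powr (-e/2 + (1 - \<tau>) + (1 - Re s2))"
      by (simp only: powr_add mult_ac)
    also have "-e/2 + (1 - \<tau>) + (1 - Re s2) = e / 2" by (simp add: e_def field_simps)
    finally show ?thesis .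
  qed
  then have bound: "\<forall>\<^sub>F N in sequentially. norm (M N * zeta_tail s2 N) \<le> H * K * real N powr (e / 2)"
    by (rule eventually_sequentiallyI)
  have "(\<lambda>N. real N powr (e / 2)) \<longlonglongrightarrow> 0"
    using e by (intro tendsto_neg_powr filterlim_real_sequentially) auto
  from tendsto_mult_right_zero[OF this, of "H * K"] have "(\<lambda>N. H * K * real N powr (e / 2)) \<longlonglongrightarrow> 0" .
  then have "(\<lambda>N. M N * zeta_tail s2 N) \<longlonglongrightarrow> 0"
    by (rule Lim_null_comparison[OF bound])
  from tendsto_diff[OF F this] show ?thesis unfolding eq by simp
qed

lemma dz_partial_tendsto:
  assumes "1 < Re s2" "2 < Re (s1 + s2)"
  shows "(\<lambda>N. dz_partial N s1 s2) \<longlonglongrightarrow> double_zeta s1 s2"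
proof -
  obtain b C where EM: "euler_maclaurin 1 b C" using ex_euler_maclaurin by blast
  then interpret euler_maclaurin 1 b C .
  show ?thesis using assms by (intro dz_partial_tendsto) auto
qed

text \<open>The off-diagonal bound \<open>U\<close> is uniform in \<open>N\<close>, so N may tend to
  infinity with T fixed. The partial sums are bounded by A * Z, which permits dominated
  convergence.\<close>

theorem mean_square_convergent:
  assumes s2: "1 < \<sigma>2" and s12: "2 < \<sigma>1 + \<sigma>2"
  shows "\<exists>C. \<forall>T\<ge>2. \<bar>double_zeta_mean_square \<sigma>1 \<sigma>2 T - double_zeta_box \<sigma>1 \<sigma>2 * T\<bar> \<le> C"
proof -
  define p where "p = min \<sigma>2 ((\<sigma>1 + \<sigma>2) / 2)"
  \<comment> \<open>Half of p - 1, so that p - \<eta> > 1 as the convolution bound requires.\<close>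
  define \<eta> where "\<eta> = (p - 1) / 2"
  have p: "1 < p" "p \<le> \<sigma>2" "2 * p \<le> \<sigma>1 + \<sigma>2" using assms by (auto simp: p_def min_def field_simps)
  have \<eta>: "0 < \<eta>" "1 < p - \<eta>" "1 < 2 * p - 2 * \<eta>" using p by (auto simp: \<eta>_def field_simps)
  obtain A where A: "0 < A" "\<And>k. 0 < k \<Longrightarrow> box_coeff \<sigma>1 \<sigma>2 k \<le> A * real k powr (\<eta> - p)"
    using box_coeff_le_powr[OF p(2,3) \<eta>(1)] by blast
  let ?p = "p - \<eta>"
  define Z where "Z = (\<Sum>n. real (Suc n) powr (- ?p))"
  have sZ: "summable (\<lambda>n. real (Suc n) powr (- ?p))"
    using summable_powr_tail[OF \<eta>(2), of 1] by simp
  have Z0: "0 \<le> Z" unfolding Z_def by (intro suminf_nonneg sZ) auto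
  let ?c = "\<lambda>N. trunc_coeff N \<sigma>1 \<sigma>2" and ?D = "\<lambda>N t. dz_partial N (Complex \<sigma>1 t) (Complex \<sigma>2 t)"
  let ?Zt = "\<lambda>t. double_zeta (Complex \<sigma>1 t) (Complex \<sigma>2 t)"
  have c: "?c N k \<le> A * real k powr (- ?p)" if "0 < k" for N k
    using trunc_coeff_le_box_coeff[of N \<sigma>1 \<sigma>2 k] A(2)[OF that] by simp
  have Dbound: "norm (?D N t) \<le> A * Z" for N t
  proof -
    have "norm (?D N t) \<le> (\<Sum>k=1..N\<^sup>2. \<bar>?c N k\<bar>)"
      unfolding dz_partial_eq_dirichlet_poly by (rule norm_dirichlet_poly_le)
    also have "\<dots> \<le> (\<Sum>k=1..N\<^sup>2. A * real k powr (- ?p))"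
      using c by (intro sum_mono) (simp add: trunc_coeff_nonneg)
    also have "\<dots> = A * (\<Sum>k<N\<^sup>2. real (Suc k) powr (- ?p))"
      unfolding One_nat_def sum.atLeast1_atMost_eq by (simp add: sum_distrib_left)
    also have "\<dots> \<le> A * Z"
      unfolding Z_def using A(1) by (intro mult_left_mono sum_le_suminf sZ) auto
    finally show ?thesis .
  qed
  define U where "U = 6 * A\<^sup>2 * Z\<^sup>2"
  let ?\<Sigma> = "\<lambda>N. \<Sum>k=1..N\<^sup>2. (?c N k)\<^sup>2"
  have approx: "\<bar>integral {2..T} (\<lambda>t. (norm (?D N t))\<^sup>2) - (T - 2) * ?\<Sigma> N\<bar> \<le> U" if "2 \<le> T" for N T
    unfolding dz_partial_eq_dirichlet_poly U_def Z_def
    by (rule order_trans[OF dirichlet_poly_mean_square hilbert_sum_bounded[OF \<eta>(2) sZ]])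
       (use that c A(1) trunc_coeff_nonneg in auto)
  have \<Sigma>: "?\<Sigma> \<longlonglongrightarrow> double_zeta_box \<sigma>1 \<sigma>2"
  proof -
    obtain C where C: "\<And>N. 1 \<le> N \<Longrightarrow> \<bar>double_zeta_box \<sigma>1 \<sigma>2 - ?\<Sigma> N\<bar> \<le> C * real N powr (1 - (2 * p - 2 * \<eta>))"
      using sum_trunc_coeff_sq_approx[OF p(2,3) \<eta>(1,3)] by blast
    then have "norm (double_zeta_box \<sigma>1 \<sigma>2 - ?\<Sigma> N) \<le> C * real N powr (1 - (2 * p - 2 * \<eta>))" if "1 \<le> N" for N
      using that unfolding real_norm_def by blast
    then have ev: "\<forall>\<^sub>F N in sequentially. norm (double_zeta_box \<sigma>1 \<sigma>2 - ?\<Sigma> N) \<le> C * real N powr (1 - (2 * p - 2 * \<eta>))"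
      by (rule eventually_sequentiallyI)
    have "(\<lambda>N. real N powr (1 - (2 * p - 2 * \<eta>))) \<longlonglongrightarrow> 0"
      using \<eta> by (intro tendsto_neg_powr filterlim_real_sequentially) auto
    from tendsto_mult_right_zero[OF this, of C]
    have "(\<lambda>N. double_zeta_box \<sigma>1 \<sigma>2 - ?\<Sigma> N) \<longlonglongrightarrow> 0"
      by (rule Lim_null_comparison[OF ev])
    from tendsto_diff[OF tendsto_const[of "double_zeta_box \<sigma>1 \<sigma>2"] this] show ?thesis by simp
  qed
  have int: "(\<lambda>N. integral {2..T} (\<lambda>t. (norm (?D N t))\<^sup>2)) \<longlonglongrightarrow> double_zeta_mean_square \<sigma>1 \<sigma>2 T" for T
    unfolding double_zeta_mean_square_def
  proof (rule dominated_convergence(2)[where h = "\<lambda>_. (A * Z)\<^sup>2"])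
    show "(\<lambda>t. (norm (?D N t))\<^sup>2) integrable_on {2..T}" for N
      by (intro integrable_continuous_interval continuous_intros continuous_on_dz_partial_vertical)
    show "(\<lambda>_. (A * Z)\<^sup>2) integrable_on {2..T}" by (intro integrable_continuous_interval continuous_intros)
    show "norm ((norm (?D N t))\<^sup>2) \<le> (A * Z)\<^sup>2" for N t
      using power_mono[OF Dbound norm_ge_zero, of N t 2] by simp
    show "(\<lambda>N. (norm (?D N t))\<^sup>2) \<longlonglongrightarrow> (norm (?Zt t))\<^sup>2" for t
      using assms by (intro tendsto_intros dz_partial_tendsto) auto
  qed
  \<comment> \<open>The interval begins at 2, so the diagonal term carries T - 2; this accounts for
    the second summand of the bound.\<close>
  have "\<bar>double_zeta_mean_square \<sigma>1 \<sigma>2 T - double_zeta_box \<sigma>1 \<sigma>2 * T\<bar> \<le> U + 2 * \<bar>double_zeta_box \<sigma>1 \<sigma>2\<bar>"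
    if T: "2 \<le> T" for T
  proof -
    have "(\<lambda>N. \<bar>integral {2..T} (\<lambda>t. (norm (?D N t))\<^sup>2) - (T - 2) * ?\<Sigma> N\<bar>) \<longlonglongrightarrow>
       \<bar>double_zeta_mean_square \<sigma>1 \<sigma>2 T - (T - 2) * double_zeta_box \<sigma>1 \<sigma>2\<bar>"
      by (intro tendsto_intros int \<Sigma>)
    from tendsto_upperbound[OF this, of U] approx[OF T]
    have "\<bar>double_zeta_mean_square \<sigma>1 \<sigma>2 T - (T - 2) * double_zeta_box \<sigma>1 \<sigma>2\<bar> \<le> U" by simp
    moreover have "(T - 2) * double_zeta_box \<sigma>1 \<sigma>2 = double_zeta_box \<sigma>1 \<sigma>2 * T - 2 * double_zeta_box \<sigma>1 \<sigma>2"
      by (simp add: algebra_simps)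
    ultimately show ?thesis by linarith
  qed
  then show ?thesis by blast
qed

section \<open>The critical line\<close>

lemma norm_exp_diff_le:
  fixes s :: complex and u v :: real
  assumes "0 \<le> Re s" "0 \<le> u" "0 \<le> v"
  shows "norm (exp (- s * of_real u) - exp (- s * of_real v)) \<le> norm s * \<bar>u - v\<bar>"
proof -
  let ?S = "{z :: complex. 0 \<le> Re z \<and> Im z = 0}"
  have "norm (exp (- s * of_real u) - exp (- s * of_real v)) \<le> norm s * norm (complex_of_real u - of_real v)"
  \<comment> \<open>The mean value inequality along the nonnegative real axis, where the exponential
    has modulus at most 1.\<close>
  proof (rule field_differentiable_bound[of ?S])
    show "convex ?S" by (intro convexI) auto
    show "((\<lambda>z. exp (- s * z)) has_field_derivative (- s * exp (- s * z))) (at z within ?S)" for z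
      by (auto intro!: derivative_eq_intros)
    show "norm (- s * exp (- s * z)) \<le> norm s" if "z \<in> ?S" for z
      using that assms by (auto simp: norm_mult norm_exp_eq_Re intro!: mult_left_le)
  qed (use assms in auto)
  also have "norm (complex_of_real u - of_real v) = \<bar>u - v\<bar>"
    by (simp flip: of_real_diff)
  finally show ?thesis .
qed

lemma half_le_sin:
  assumes "0 \<le> x" "x \<le> (1::real)"
  shows "x / 2 \<le> sin x"
proof -
  have "\<bar>sin x - (\<Sum>m<3. sin_coeff m * x ^ m)\<bar> \<le> inverse (fact 3) * \<bar>x\<bar> ^ 3"
    by (rule Maclaurin_sin_bound)
  moreover have "(\<Sum>m<3. sin_coeff m * x ^ m) = x"
    by (simp add: numeral_3_eq_3 sin_coeff_def)
  moreover have "x ^ 3 \<le> x" using assms power_decreasing[of 1 3 x] by simp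
  ultimately have "\<bar>sin x - x\<bar> * 6 \<le> x" using assms by (simp add: fact_numeral)
  then have "x - sin x \<le> x / 6" by (simp add: abs_if split: if_splits)
  moreover have "x / 6 \<le> x / 2" using assms by simp
  ultimately show ?thesis using field_sum_of_halves[of x] by linarith
qed

text \<open>The exact form of the almost telescoping: for x = f n, y = r n and z = r (n + 1) the
  next term is x * y, and the defect carries the small difference y - z.\<close>

lemma telescoping_defect:
  fixes x y z :: complex
  assumes "1 - y \<noteq> 0" "1 - z \<noteq> 0"
  shows "x - (x / (1 - y) - x * y / (1 - z)) = - (x * y * (y - z) / ((1 - y) * (1 - z)))"
proof -
  have id: "x - (x / p - x * y / q) = (x * p * q - x * q + x * y * p) / (p * q)"
    if "p \<noteq> 0" "q \<noteq> 0" for p q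
    using that by (simp add: field_simps)
  have "x * (1 - y) * (1 - z) - x * (1 - z) + x * y * (1 - y) = - (x * y * (y - z))"
    by (simp add: algebra_simps)
  then show ?thesis unfolding id[OF assms] by simp
qed

text \<open>Kusmin--Landau: writing \<open>f n = n powr (-s)\<close> and \<open>r n = f (Suc n) / f n\<close>, the terms
  almost telescope as differences of \<open>f n / (1 - r n)\<close>.\<close>

lemma kusmin_landau:
  fixes t :: real
  assumes t: "1 \<le> t" and a: "2 * t \<le> real a" and ab: "a \<le> b"
  shows "norm (\<Sum>n=a..<b. of_nat n powr (- Complex (1/2) t)) \<le> 1040 * sqrt (real b) / t"
proof -
  define s where "s = Complex (1/2) t"
  define f where "f n = (of_nat n powr (-s) :: complex)" for n
  define u where "u n = ln (1 + 1 / real n)" for n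
  define r where "r n = exp (- s * of_real (u n))" for n
  define G where "G n = f n / (1 - r n)" for n
  have un: "u n = ln (real n + 1) - ln (real n)" if "0 < real n" for n
  proof -
    have "1 + 1 / real n = (real n + 1) / real n" using that by (simp add: field_simps)
    then show ?thesis using that ln_div[of "real n + 1" "real n"] by (simp add: u_def)
  qed
  have u: "0 \<le> u n" "u n \<le> 1 / real n" "1 / (2 * real n) \<le> u n" "u n - u (Suc n) \<le> 1 / (real n)\<^sup>2" "u (Suc n) \<le> u n"
    if n: "2 \<le> n" for n
  proof -
    have n0: "0 < real n" using n by simp
    show "0 \<le> u n" using n0 unfolding u_def by (intro ln_ge_zero) auto
    show "u n \<le> 1 / real n" unfolding u_def using n0 by (intro ln_add_one_self_le_self) auto
    have "ln (real n / (real n + 1)) \<le> real n / (real n + 1) - 1"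
      using n0 by (intro ln_le_minus_one) auto
    moreover have "ln (real n / (real n + 1)) = - u n"
      using n0 by (simp add: un ln_div)
    moreover have "real n / (real n + 1) - 1 = - (1 / (real n + 1))"
      using n0 by (simp add: field_simps)
    ultimately have "1 / (real n + 1) \<le> u n" by linarith
    moreover have "1 / (2 * real n) \<le> 1 / (real n + 1)" using n by (intro divide_left_mono) auto
    ultimately show "1 / (2 * real n) \<le> u n" by linarith
    have un': "u (Suc n) = ln (real n + 2) - ln (real n + 1)"
      using un[of "Suc n"] by (simp add: add_ac)
    have "u n - u (Suc n) = ln ((real n + 1)\<^sup>2 / (real n * (real n + 2)))"
      using n0 by (simp add: un[OF n0] un' ln_div ln_mult ln_realpow)
    also have "\<dots> \<le> (real n + 1)\<^sup>2 / (real n * (real n + 2)) - 1"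
      using n0 by (intro ln_le_minus_one divide_pos_pos mult_pos_pos) auto
    also have "\<dots> = 1 / (real n * (real n + 2))"
    proof -
      have "(real n + 1)\<^sup>2 = real n * (real n + 2) + 1" by (simp add: power2_eq_square algebra_simps)
      then show ?thesis using n0 by (simp add: add_divide_distrib)
    qed
    also have "\<dots> \<le> 1 / (real n)\<^sup>2"
      using n0 by (intro divide_left_mono) (auto simp: power2_eq_square)
    finally show "u n - u (Suc n) \<le> 1 / (real n)\<^sup>2" .
    show "u (Suc n) \<le> u n" unfolding u_def using n0 by (intro ln_mono) (auto simp: field_simps)
  qed
  have n2: "2 \<le> n" if "2 * t \<le> real n" for n using that t by linarith
  have fS: "f (Suc n) = f n * r n" if n: "2 \<le> n" for n
  proof -
    have n0: "0 < real n" using n by simp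
    have p: "of_nat k powr (-s) = exp (- s * of_real (ln (real k)))" if "0 < k" for k
      using that by (simp add: powr_def Ln_of_nat mult.commute)
    have "ln (real (Suc n)) = u n + ln (real n)"
      using un[OF n0] by (simp add: add.commute)
    then have "f (Suc n) = exp (- s * of_real (u n + ln (real n)))"
      unfolding f_def by (subst p) auto
    also have "- s * of_real (u n + ln (real n)) = - s * of_real (ln (real n)) + - s * of_real (u n)"
      by (simp add: algebra_simps)
    also have "exp \<dots> = f n * r n"
      unfolding exp_add f_def r_def using n by (subst p) auto
    finally show ?thesis .
  qed
  \<comment> \<open>The imaginary part of 1 - r n is exp (- u / 2) * sin (t * u). The hypothesis 2 *
    t \<le> n keeps t * u within [0, 1], so the ratio stays away from 1.\<close>
  have low: "t / (8 * real n) \<le> norm (1 - r n)" if n: "2 * t \<le> real n" for n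
  proof -
    have n0: "0 < real n" "2 \<le> n" using n t n2 by auto
    have tu: "0 \<le> t * u n" "t * u n \<le> 1"
    proof -
      have "t * u n \<le> t * (1 / real n)" using u(2)[OF n0(2)] t by (intro mult_left_mono) auto
      also have "\<dots> \<le> 1" using n n0 t by (simp add: field_simps)
      finally show "t * u n \<le> 1" .
    qed (use u(1)[OF n0(2)] t in auto)
    have "Im (1 - r n) = exp (- (u n / 2)) * sin (t * u n)"
      by (simp add: r_def s_def Im_exp)
    then have "exp (- (u n / 2)) * sin (t * u n) \<le> norm (1 - r n)"
      using abs_Im_le_cmod[of "1 - r n"] by linarith
    moreover have "1 / 2 * (t * u n / 2) \<le> exp (- (u n / 2)) * sin (t * u n)"
    proof (rule mult_mono)
      have "1 + (- (u n / 2)) \<le> exp (- (u n / 2))" by (rule exp_ge_add_one_self)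
      moreover have "1 / real n \<le> 1" using n0 by simp
      then have "u n \<le> 1" using u(2)[OF n0(2)] by linarith
      ultimately show "1 / 2 \<le> exp (- (u n / 2))" by linarith
      show "t * u n / 2 \<le> sin (t * u n)" using half_le_sin[OF tu] .
    qed (use tu in auto)
    moreover have "t / (8 * real n) \<le> 1 / 2 * (t * u n / 2)"
      using mult_left_mono[OF u(3)[OF n0(2)], of "t / 4"] t by (simp add: field_simps)
    ultimately show ?thesis by linarith
  qed
  have ne: "1 - r n \<noteq> 0" if n: "2 * t \<le> real n" for n
  proof
    assume "1 - r n = 0"
    then have "t / (8 * real n) \<le> 0" using low[OF n] by simp
    moreover have "0 < t / (8 * real n)" using n t by simp
    ultimately show False by linarith
  qed
  have nf: "norm (f n) = 1 / sqrt (real n)" for n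
  proof -
    have "Re (-s) = - (1/2)" by (simp add: s_def)
    then show ?thesis
      unfolding f_def norm_of_nat_powr by (simp only: powr_minus_divide) (simp add: powr_half_sqrt)
  qed
  have Gle: "norm (G n) \<le> 8 * sqrt (real n) / t" if n: "2 * t \<le> real n" for n
  proof -
    have n0: "0 < real n" using n t by linarith
    have "norm (G n) \<le> (1 / sqrt (real n)) / (t / (8 * real n))"
    proof -
      have pos: "0 < t / (8 * real n)" using n0 t by simp
      then have "0 < norm (1 - r n)" using low[OF n] by linarith
      then show ?thesis
        unfolding G_def norm_divide nf using pos by (intro divide_left_mono low[OF n] mult_pos_pos) auto
    qed
    also have "\<dots> = 8 * (real n / sqrt (real n)) / t" by (simp add: field_simps)
    also have "real n / sqrt (real n) = sqrt (real n)" using n0 by (simp add: real_div_sqrt)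
    finally show ?thesis .
  qed
  \<comment> \<open>The step of r is at most about t / n ^ 2 and 1 - r at least about t / n, so the
    defect is of size n powr (-1/2) / t; the constant is 256 = 2 * 8 * 16.\<close>
  have Ele: "norm (f n - (G n - G (Suc n))) \<le> 256 * (1 / sqrt (real n)) / t" if n: "2 * t \<le> real n" for n
  proof -
    have n0: "0 < real n" "2 \<le> n" "1 \<le> n" using n t n2 by auto
    have n': "2 * t \<le> real (Suc n)" using n by simp
    have "f n - (G n - G (Suc n)) = - (f (Suc n) * (r n - r (Suc n)) / ((1 - r n) * (1 - r (Suc n))))"
      unfolding G_def fS[OF n0(2)] by (rule telescoping_defect[OF ne[OF n] ne[OF n']])
    then have "norm (f n - (G n - G (Suc n))) = norm (f (Suc n)) * norm (r n - r (Suc n)) / (norm (1 - r n) * norm (1 - r (Suc n)))"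
      by (simp only: norm_minus_cancel norm_divide norm_mult)
    also have "\<dots> \<le> ((1 / sqrt (real n)) * (2 * t * (1 / (real n)\<^sup>2))) / ((t / (8 * real n)) * (t / (16 * real n)))"
    proof (rule frac_le)
      show "norm (f (Suc n)) * norm (r n - r (Suc n)) \<le> (1 / sqrt (real n)) * (2 * t * (1 / (real n)\<^sup>2))"
      proof (rule mult_mono)
        show "norm (f (Suc n)) \<le> 1 / sqrt (real n)" unfolding nf using n0 by (intro divide_left_mono) auto
        have "norm (r n - r (Suc n)) \<le> norm s * \<bar>u n - u (Suc n)\<bar>"
          unfolding r_def using u(1)[OF n0(2)] u(1)[of "Suc n"] n0 by (intro norm_exp_diff_le) (auto simp: s_def)
        also have "\<dots> \<le> (2 * t) * (1 / (real n)\<^sup>2)"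
        proof (rule mult_mono)
          show "norm s \<le> 2 * t" using cmod_le[of s] t by (simp add: s_def)
          show "\<bar>u n - u (Suc n)\<bar> \<le> 1 / (real n)\<^sup>2" using u(4,5)[OF n0(2)] by simp
        qed (use t in auto)
        finally show "norm (r n - r (Suc n)) \<le> 2 * t * (1 / (real n)\<^sup>2)" .
      qed auto
      show "t / (8 * real n) * (t / (16 * real n)) \<le> norm (1 - r n) * norm (1 - r (Suc n))"
      proof (rule mult_mono[OF low[OF n]])
        have "t / (16 * real n) \<le> t / (8 * real (Suc n))" using n0 t by (intro divide_left_mono) auto
        also have "\<dots> \<le> norm (1 - r (Suc n))" by (rule low[OF n'])
        finally show "t / (16 * real n) \<le> norm (1 - r (Suc n))" .
      qed (use t in auto)
    qed (use t n0 in auto)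
    also have "\<dots> = 256 * (1 / sqrt (real n)) / t"
      using t n0 by (simp add: field_simps power2_eq_square)
    finally show ?thesis .
  qed
  have tele: "(\<Sum>n=a..<b. G n - G (Suc n)) = G a - G b"
    using ab by (induction b rule: dec_induct) auto
  have sq: "(\<Sum>n=a..<b. 1 / sqrt (real n)) \<le> 4 * sqrt (real b)"
    using ab
  proof (induction b rule: dec_induct)
    case (step n)
    have n0: "1 \<le> real n" using step a t by linarith
    have "sqrt (real n + 1) \<le> sqrt (4 * real n)" using n0 by (intro real_sqrt_le_mono) auto
    then have le: "sqrt (real n + 1) \<le> 2 * sqrt (real n)" by (simp add: real_sqrt_mult)
    have "(sqrt (real n + 1) - sqrt (real n)) * (sqrt (real n + 1) + sqrt (real n)) = 1"
      using n0 by (simp add: algebra_simps)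
    then have "1 \<le> (sqrt (real n + 1) - sqrt (real n)) * (4 * sqrt (real n))"
      using le by (smt (verit) mult_left_mono real_sqrt_le_mono real_sqrt_ge_zero n0)
    then have "1 / sqrt (real n) \<le> 4 * (sqrt (real n + 1) - sqrt (real n))"
      using n0 by (simp add: field_simps)
    then show ?case using step by (simp add: add.commute)
  qed simp
  have "(\<Sum>n=a..<b. f n) = (G a - G b) + (\<Sum>n=a..<b. f n - (G n - G (Suc n)))"
    unfolding tele[symmetric] sum.distrib[symmetric] by simp
  also have "norm \<dots> \<le> (8 * sqrt (real b) / t + 8 * sqrt (real b) / t) + 256 * (4 * sqrt (real b)) / t"
  proof (rule norm_triangle_mono)
    have "norm (G a - G b) \<le> norm (G a) + norm (G b)" by (rule norm_triangle_ineq4)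
    also have "norm (G a) \<le> 8 * sqrt (real a) / t" by (rule Gle[OF a])
    also have "\<dots> \<le> 8 * sqrt (real b) / t" using ab t by (intro divide_right_mono) auto
    also have "norm (G b) \<le> 8 * sqrt (real b) / t" using a ab by (intro Gle) linarith
    finally show "norm (G a - G b) \<le> 8 * sqrt (real b) / t + 8 * sqrt (real b) / t" by simp
    have "norm (\<Sum>n=a..<b. f n - (G n - G (Suc n))) \<le> (\<Sum>n=a..<b. 256 * (1 / sqrt (real n)) / t)"
      using a by (intro order_trans[OF norm_sum] sum_mono Ele) (auto simp: order_trans)
    also have "\<dots> = 256 * (\<Sum>n=a..<b. 1 / sqrt (real n)) / t"
      by (simp add: sum_distrib_left sum_divide_distrib)
    also have "\<dots> \<le> 256 * (4 * sqrt (real b)) / t"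
      using sq t by (intro divide_right_mono mult_left_mono) auto
    finally show "norm (\<Sum>n=a..<b. f n - (G n - G (Suc n))) \<le> 256 * (4 * sqrt (real b)) / t" .
  qed
  \<comment> \<open>Two boundary terms with 8 each, and 256 times the factor 4 from the sum of
    inverse square roots.\<close>
  also have "\<dots> = 1040 * sqrt (real b) / t" by (simp add: field_simps)
  finally show ?thesis by (simp add: f_def s_def)
qed

section \<open>Upper bound on the critical line\<close>

lemma norm_add_sq_le: "(x + y)\<^sup>2 \<le> 2 * x\<^sup>2 + 2 * (y :: real)\<^sup>2"
proof -
  have "0 \<le> (x - y)\<^sup>2" by simp
  then show ?thesis by (simp add: power2_sum power2_diff)
qed

lemma weighted_cauchy_schwarz:
  fixes w x :: "'a \<Rightarrow> real"
  assumes "\<And>i. i \<in> I \<Longrightarrow> 0 \<le> w i"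
  shows "(\<Sum>i\<in>I. w i * x i)\<^sup>2 \<le> (\<Sum>i\<in>I. w i) * (\<Sum>i\<in>I. w i * (x i)\<^sup>2)"
proof -
  have "(\<Sum>i\<in>I. w i * x i) = (\<Sum>i\<in>I. sqrt (w i) * (sqrt (w i) * x i))"
    using assms by (intro sum.cong) (simp_all flip: mult.assoc)
  also have "\<dots>\<^sup>2 \<le> (\<Sum>i\<in>I. (sqrt (w i))\<^sup>2) * (\<Sum>i\<in>I. (sqrt (w i) * x i)\<^sup>2)"
    by (rule Cauchy_Schwarz_ineq_sum)
  also have "\<dots> = (\<Sum>i\<in>I. w i) * (\<Sum>i\<in>I. w i * (x i)\<^sup>2)"
    using assms by (intro arg_cong2[where f="(*)"] sum.cong) (simp_all add: power_mult_distrib)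
  finally show ?thesis .
qed

lemma sum_inverse_sqrt_le: "(\<Sum>k\<in>{1..M}. real k powr (-1/2)) \<le> 4 * sqrt (real M)"
proof (induction M)
  case (Suc M)
  have "sqrt (real (Suc M)) * (real (Suc M) powr (-1/2)) = real (Suc M) powr (1/2 + (-1/2))"
    by (simp only: powr_add powr_half_sqrt of_nat_0_le_iff)
  then have *: "sqrt (real (Suc M)) * (real (Suc M) powr (-1/2)) = 1" by simp
  have "sqrt (real M) \<le> sqrt (real (Suc M))" by simp
  then have "sqrt (real M) + sqrt (real (Suc M)) \<le> 4 * sqrt (real (Suc M))"
  proof -
    have "0 \<le> sqrt (real (Suc M))" by simp
    with \<open>sqrt (real M) \<le> sqrt (real (Suc M))\<close> show ?thesis by linarith
  qed
  then have "(sqrt (real (Suc M)) - sqrt (real M)) * (sqrt (real M) + sqrt (real (Suc M))) \<le>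
     (sqrt (real (Suc M)) - sqrt (real M)) * (4 * sqrt (real (Suc M)))"
    by (intro mult_left_mono) auto
  moreover have "(sqrt (real (Suc M)) - sqrt (real M)) * (sqrt (real M) + sqrt (real (Suc M))) = 1"
    by (simp add: algebra_simps)
  ultimately have "1 \<le> (sqrt (real (Suc M)) - sqrt (real M)) * (4 * sqrt (real (Suc M)))" by linarith
  then have "1 * real (Suc M) powr (-1/2) \<le> (sqrt (real (Suc M)) - sqrt (real M)) * (4 * sqrt (real (Suc M))) * real (Suc M) powr (-1/2)"
    by (intro mult_right_mono) auto
  also have "\<dots> = 4 * (sqrt (real (Suc M)) - sqrt (real M)) * (sqrt (real (Suc M)) * real (Suc M) powr (-1/2))"
    by simp
  finally have "real (Suc M) powr (-1/2) \<le> 4 * (sqrt (real (Suc M)) - sqrt (real M))" unfolding * by simp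
  then show ?case using Suc by (simp add: algebra_simps)
qed simp

lemma sum_powr_minus_half_eq:
  "(\<Sum>n\<in>I. of_nat n powr (- Complex (1/2) t)) = dirichlet_poly I (\<lambda>n. real n powr (-1/2)) t" if "0 \<notin> I"
  unfolding dirichlet_poly_def
proof (rule sum.cong)
  fix n assume "n \<in> I"
  then have "0 < n" using that by (metis gr0I)
  moreover have "Complex (1/2) t = of_real (1/2) + \<i> * of_real t" by (simp add: complex_eq_iff)
  ultimately show "of_nat n powr (- Complex (1/2) t) = of_real (real n powr (-1/2)) * cis (- (ln (real n) * t))"
    using of_nat_powr_imaginary[of n "1/2" t] by simp
qed simp

text \<open>The three quantities in \<open>hilbert_sum_le\<close> for coefficients n powr (-1/2):
  the squares add up to a harmonic sum, the coefficients to at most 4 * sqrt M, and n times the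
  square is 1. An arbitrary index set up to M gives a bound uniform over the sums n > m met later;
  36 = 2 * 16 + 4.\<close>

lemma mean_square_half_line:
  assumes I: "I \<subseteq> {1..M}" and M: "1 \<le> M" and AB: "A \<le> B"
  shows "integral {A..B} (\<lambda>t. (norm (dirichlet_poly I (\<lambda>n. real n powr (-1/2)) t))\<^sup>2)
     \<le> ((B - A) + 36 * real M) * (1 + ln (real M))"
proof -
  let ?c = "\<lambda>n. real n powr (-1/2)"
  have fin: "finite I" "0 \<notin> I" using I finite_subset by auto
  have sq: "(?c n)\<^sup>2 = inverse (real n)" for n
  proof -
    have "(?c n)\<^sup>2 = real n powr (-1/2 + -1/2)" by (simp only: power2_eq_square powr_add)
    also have "\<dots> = real n powr (-1)" by simp
    finally show ?thesis by (simp only: powr_minus) simp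
  qed
  have h: "harm M \<le> 1 + ln (real M)" by (rule harm_le_1_plus_ln[OF M])
  have l0: "0 \<le> ln (real M)" using M by simp
  have s1: "(\<Sum>n\<in>I. (?c n)\<^sup>2) \<le> 1 + ln (real M)"
  proof -
    have "(\<Sum>n\<in>I. (?c n)\<^sup>2) \<le> harm M"
      unfolding sq harm_def using I by (intro sum_mono2) auto
    with h show ?thesis by linarith
  qed
  have s2: "(\<Sum>n\<in>I. ?c n)\<^sup>2 \<le> 16 * real M"
  proof -
    have "(\<Sum>n\<in>I. ?c n) \<le> (\<Sum>n\<in>{1..M}. ?c n)" using I by (intro sum_mono2) auto
    also have "\<dots> \<le> 4 * sqrt (real M)" by (rule sum_inverse_sqrt_le)
    finally have "(\<Sum>n\<in>I. ?c n)\<^sup>2 \<le> (4 * sqrt (real M))\<^sup>2" by (intro power_mono sum_nonneg) auto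
    then show ?thesis by (simp add: power_mult_distrib)
  qed
  have s3: "(\<Sum>n\<in>I. real n * (?c n)\<^sup>2) \<le> real M"
  proof -
    have "(\<Sum>n\<in>I. real n * (?c n)\<^sup>2) \<le> (\<Sum>n\<in>I. 1)" proof (rule sum_mono)
      show "real n * (?c n)\<^sup>2 \<le> 1" for n unfolding sq by (cases "n = 0") auto
    qed
    also have "\<dots> = real (card I)" by simp
    also have "\<dots> \<le> real (card {1..M})" using I by (intro of_nat_mono card_mono) auto
    finally show ?thesis by simp
  qed
  have "\<bar>integral {A..B} (\<lambda>t. (norm (dirichlet_poly I ?c t))\<^sup>2) - (B - A) * (\<Sum>n\<in>I. (?c n)\<^sup>2)\<bar>
     \<le> 2 * (\<Sum>n\<in>I. ?c n)\<^sup>2 + 4 * harm M * (\<Sum>n\<in>I. real n * (?c n)\<^sup>2)"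
    by (rule order_trans[OF dirichlet_poly_mean_square[OF fin AB] hilbert_sum_le[OF I]]) auto
  then have "integral {A..B} (\<lambda>t. (norm (dirichlet_poly I ?c t))\<^sup>2) \<le> (B - A) * (\<Sum>n\<in>I. (?c n)\<^sup>2)
     + (2 * (\<Sum>n\<in>I. ?c n)\<^sup>2 + 4 * harm M * (\<Sum>n\<in>I. real n * (?c n)\<^sup>2))" by linarith
  also have "\<dots> \<le> (B - A) * (1 + ln (real M)) + (2 * (16 * real M) + 4 * (1 + ln (real M)) * real M)"
    using s1 s2 s3 h AB l0 by (intro add_mono mult_left_mono mult_mono sum_nonneg) (auto simp: harm_nonneg)
  also have "\<dots> \<le> (B - A) * (1 + ln (real M)) + 36 * real M * (1 + ln (real M))"
  proof -
    have "0 \<le> real M * ln (real M)" using l0 by simp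
    then show ?thesis by (simp add: algebra_simps)
  qed
  finally show ?thesis by (simp add: algebra_simps)
qed

lemma sum_powr_le_suminf:
  assumes "1 < \<sigma>"
  shows "(\<Sum>m=1..<N. real m powr (-\<sigma>)) \<le> (\<Sum>n. real (1 + n) powr (-\<sigma>))"
proof -
  have "(\<Sum>m=1..<N. real m powr (-\<sigma>)) = (\<Sum>n<N - 1. real (1 + n) powr (-\<sigma>))"
    by (rule sum.reindex_bij_witness[of _ Suc "\<lambda>m. m - 1"]) auto
  also have "\<dots> \<le> (\<Sum>n. real (1 + n) powr (-\<sigma>))"
    using assms by (intro sum_le_suminf summable_powr_tail) auto
  finally show ?thesis .
qed

text \<open>For n \<ge> 4 * X \<ge> 2 * t the phase of the summand varies slowly enough for
  Kusmin--Landau, which bounds the part of the inner sum up to N by a constant; only n < L, with L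
  of order X, survives.\<close>

lemma dz_partial_critical_le:
  assumes \<sigma>: "1 < \<sigma>1" and X: "2 \<le> X" and t: "X \<le> t" "t \<le> 2 * X" and L: "L = min N (nat \<lceil>4 * X\<rceil>)"
    and N: "real N \<le> 2 * X powr (5/4)"
  shows "norm (dz_partial N (Complex \<sigma>1 t) (Complex (1/2) t)) \<le>
    (\<Sum>m=1..<N. real m powr (-\<sigma>1) * (norm (dirichlet_poly {Suc m..<L} (\<lambda>n. real n powr (-1/2)) t) + 2080))"
proof -
  let ?q = "\<lambda>n. of_nat n powr (- Complex (1/2) t) :: complex"
  have tX: "1 \<le> t" using X t by simp
  have tail: "norm (\<Sum>n=Suc m..<N. ?q n) \<le> norm (\<Sum>n=Suc m..<L. ?q n) + 2080" for m
  proof -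
    \<comment> \<open>For m + 1 \<ge> L the short sum is empty and the remainder starts at m +
      1.\<close>
    define a where "a = max (Suc m) L"
    have "(\<Sum>n=Suc m..<N. ?q n) = (\<Sum>n=Suc m..<L. ?q n) + (\<Sum>n=a..<N. ?q n)"
    proof -
      have "{Suc m..<N} = {Suc m..<L} \<union> {a..<N}" using L by (auto simp: a_def)
      then show ?thesis by (simp add: sum.union_disjoint a_def)
    qed
    moreover have "norm (\<Sum>n=a..<N. ?q n) \<le> 2080"
    proof (cases "a \<le> N \<and> L \<noteq> N")
      case True
      then have "L = nat \<lceil>4 * X\<rceil>" using L by (simp add: min_def split: if_splits)
      moreover have "L \<le> a" by (simp add: a_def)
      ultimately have "4 * X \<le> real a" by linarith
      then have "norm (\<Sum>n=a..<N. ?q n) \<le> 1040 * sqrt (real N) / t"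
        using True t by (intro kusmin_landau tX) auto
      \<comment> \<open>N \<le> 2 * X powr (5/4) is below (2 * t) ^ 2, which turns 1040 into
        2080.\<close>
      also have "sqrt (real N) \<le> 2 * t"
      proof -
        have "X powr (5/4) \<le> X powr 2" using X by (intro powr_mono) auto
        then have "real N \<le> 2 * X\<^sup>2" using N X powr_realpow[of X 2] by simp
        also have "\<dots> \<le> (2 * t)\<^sup>2"
        proof -
          have "X\<^sup>2 \<le> t\<^sup>2" using t X by (intro power_mono) auto
          moreover have "(2 * t)\<^sup>2 = 4 * t\<^sup>2" by (simp add: power_mult_distrib)
          ultimately show ?thesis using zero_le_power2[of t] by linarith
        qed
        finally show ?thesis using tX by (intro real_le_lsqrt) auto
      qed
      then have "1040 * sqrt (real N) / t \<le> 1040 * (2 * t) / t" using tX by (intro divide_right_mono) auto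
      also have "\<dots> = 2080" using tX by simp
      finally show ?thesis .
    next
      case False
      then have "{a..<N} = {}" by (auto simp: a_def L)
      then show ?thesis by simp
    qed
    ultimately show ?thesis by (smt (verit) norm_triangle_ineq)
  qed
  have "dz_partial N (Complex \<sigma>1 t) (Complex (1/2) t) = (\<Sum>m=1..<N. of_nat m powr (- Complex \<sigma>1 t) * (\<Sum>n=Suc m..<N. ?q n))"
    unfolding dz_partial_def sum_triangle_swap[symmetric] by (simp add: sum_distrib_left)
  also have "norm \<dots> \<le> (\<Sum>m=1..<N. real m powr (-\<sigma>1) * (norm (\<Sum>n=Suc m..<L. ?q n) + 2080))"
    by (intro order_trans[OF norm_sum] sum_mono) (simp add: norm_mult mult_left_mono tail)
  finally show ?thesis by (simp add: sum_powr_minus_half_eq)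
qed

text \<open>Since \<sigma>1 > 1, the weights m powr (-\<sigma>1) have a finite total, and
  Cauchy--Schwarz over m with these weights reduces the mean square to those of single sums over n <
  L, each O(X ln X) uniformly in m. With length N in place of L the Hilbert-type bound would give N
  ln N, which is too large.\<close>

lemma mean_square_critical_upper:
  assumes \<sigma>: "1 < \<sigma>1"
  shows "\<exists>C\<ge>0. \<forall>X\<ge>2. integral {X..2 * X} (\<lambda>t. (norm (double_zeta (Complex \<sigma>1 t) (Complex (1/2) t)))\<^sup>2) \<le> C * (X * ln X)"
proof -
  \<comment> \<open>Here \<delta> = 1/4: the exponent 5/4 * 3/4 - 1 = -1/16 is negative, so the
    approximation error is bounded.\<close>
  obtain K where K: "0 \<le> K" "\<And>X t N. 2 \<le> X \<Longrightarrow> X \<le> t \<Longrightarrow> t \<le> 2 * X \<Longrightarrow> X powr (1 + 1/4) \<le> real N \<Longrightarrow> real N \<le> 2 * X powr (1 + 1/4) \<Longrightarrow>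
     norm (double_zeta (Complex \<sigma>1 t) (Complex (1/2) t) - dz_partial N (Complex \<sigma>1 t) (Complex (1/2) t))
       \<le> K * X powr ((1 + 1/4) * (2 - 1 - 1/2 + 1/4) - 1)"
    using double_zeta_approximation_error[of 1 \<sigma>1 "1/2" "1/4"] \<sigma> by auto
  define Z where "Z = (\<Sum>n. real (1 + n) powr (-\<sigma>1))"
  have Z: "(\<Sum>m=1..<N. real m powr (-\<sigma>1)) \<le> Z" for N
    unfolding Z_def by (rule sum_powr_le_suminf[OF \<sigma>])
  have Z0: "0 \<le> Z" using Z[of 0] by simp
  define E where "E = 4 * 2080\<^sup>2 * Z\<^sup>2 + 2 * K\<^sup>2"
  have E0: "0 \<le> E" using Z0 by (simp add: E_def)
  define C where "C = 4 * Z\<^sup>2 * 181 * (1 / ln 2 + 4) + E / ln 2"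
  have ln2: "0 < ln (2::real)" by simp
  have C0: "0 \<le> C" using Z0 E0 ln2 by (simp add: C_def)
  moreover have "integral {X..2 * X} (\<lambda>t. (norm (double_zeta (Complex \<sigma>1 t) (Complex (1/2) t)))\<^sup>2) \<le> C * (X * ln X)"
    if X: "2 \<le> X" for X
  proof -
    obtain N where N: "X powr (1 + 1/4) \<le> real N" "real N \<le> 2 * X powr (1 + 1/4)" "X \<le> real N" "1 \<le> N"
      using dyadic_length[OF X, of "1/4"] by auto
    define L where "L = min N (nat \<lceil>4 * X\<rceil>)"
    define M where "M = nat \<lceil>4 * X\<rceil>"
    have M: "1 \<le> M" "real M \<le> 5 * X" "L \<le> M"
      using X unfolding M_def L_def by linarith+
    let ?W = "\<lambda>m t. dirichlet_poly {Suc m..<L} (\<lambda>n. real n powr (-1/2)) t"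
    let ?w = "\<lambda>m. real m powr (-\<sigma>1)"
    have lX: "ln 2 \<le> ln X" using X by simp
    have lX1: "1 \<le> ln X / ln 2" using lX ln2 by (simp add: field_simps)
    have lM: "1 + ln (real M) \<le> (1 / ln 2 + 4) * ln X"
    proof -
      have "ln (real M) \<le> ln (8 * X)" using M X by (intro ln_mono) auto
      also have "\<dots> = 3 * ln 2 + ln X"
      proof -
        have "ln (8::real) = ln (2 ^ 3)" by simp
        also have "\<dots> = 3 * ln 2" by (subst ln_realpow) simp_all
        finally show ?thesis using X by (simp add: ln_mult)
      qed
      also have "\<dots> \<le> 3 * ln X + ln X" using lX by simp
      finally have "1 + ln (real M) \<le> ln X / ln 2 + 4 * ln X" using lX1 by linarith
      then show ?thesis by (simp add: distrib_right)
    qed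
    have pt: "(norm (double_zeta (Complex \<sigma>1 t) (Complex (1/2) t)))\<^sup>2 \<le> (\<Sum>m=1..<N. 4 * Z * ?w m * (norm (?W m t))\<^sup>2) + E"
      if t: "t \<in> {X..2 * X}" for t
    proof -
      let ?D = "dz_partial N (Complex \<sigma>1 t) (Complex (1/2) t)"
      have "norm (double_zeta (Complex \<sigma>1 t) (Complex (1/2) t) - ?D) \<le> K * X powr ((1 + 1/4) * (2 - 1 - 1/2 + 1/4) - 1)"
        using t X N by (intro K(2)) auto
      also have "\<dots> \<le> K * X powr 0" using X K(1) by (intro mult_left_mono powr_mono) auto
      finally have "norm (double_zeta (Complex \<sigma>1 t) (Complex (1/2) t)) \<le> norm ?D + K"
        using X norm_triangle_sub[of "double_zeta (Complex \<sigma>1 t) (Complex (1/2) t)" ?D] by simp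
      then have "(norm (double_zeta (Complex \<sigma>1 t) (Complex (1/2) t)))\<^sup>2 \<le> (norm ?D + K)\<^sup>2"
        by (intro power_mono) auto
      also have "\<dots> \<le> 2 * (norm ?D)\<^sup>2 + 2 * K\<^sup>2" by (rule norm_add_sq_le)
      also have "(norm ?D)\<^sup>2 \<le> (\<Sum>m=1..<N. ?w m * (norm (?W m t) + 2080))\<^sup>2"
        using t N(2) X by (intro power_mono dz_partial_critical_le[OF \<sigma> X _ _ L_def]) auto
      also have "\<dots> \<le> (\<Sum>m=1..<N. ?w m) * (\<Sum>m=1..<N. ?w m * (norm (?W m t) + 2080)\<^sup>2)"
        by (rule weighted_cauchy_schwarz) simp
      also have "\<dots> \<le> Z * (\<Sum>m=1..<N. ?w m * (2 * (norm (?W m t))\<^sup>2 + 2 * 2080\<^sup>2))"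
        using Z Z0 by (intro mult_mono sum_mono mult_left_mono norm_add_sq_le sum_nonneg) auto
      also have "\<dots> = (\<Sum>m=1..<N. 2 * Z * ?w m * (norm (?W m t))\<^sup>2) + 2 * 2080\<^sup>2 * Z * (\<Sum>m=1..<N. ?w m)"
        unfolding sum_distrib_left sum.distrib[symmetric] by (intro sum.cong) (simp_all add: algebra_simps)
      also have "\<dots> \<le> (\<Sum>m=1..<N. 2 * Z * ?w m * (norm (?W m t))\<^sup>2) + 2 * 2080\<^sup>2 * Z * Z"
        using Z Z0 by (intro add_left_mono mult_left_mono) auto
      finally have "(norm (double_zeta (Complex \<sigma>1 t) (Complex (1/2) t)))\<^sup>2 \<le>
         2 * ((\<Sum>m=1..<N. 2 * Z * ?w m * (norm (?W m t))\<^sup>2) + 2 * 2080\<^sup>2 * Z * Z) + 2 * K\<^sup>2" by simp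
      also have "\<dots> = (\<Sum>m=1..<N. 4 * Z * ?w m * (norm (?W m t))\<^sup>2) + E"
        by (simp add: E_def sum_distrib_left power2_eq_square mult.assoc)
      finally show ?thesis .
    qed
    have IW: "(\<lambda>t. (norm (?W m t))\<^sup>2) integrable_on {X..2 * X}" for m
      by (intro integrable_continuous_interval continuous_intros)
    have IS: "(\<lambda>t. \<Sum>m=1..<N. 4 * Z * ?w m * (norm (?W m t))\<^sup>2) integrable_on {X..2 * X}"
      by (intro integrable_continuous_interval continuous_intros)
    have IW': "(\<lambda>t. 4 * Z * ?w m * (norm (?W m t))\<^sup>2) integrable_on {X..2 * X}" for m
      by (intro integrable_continuous_interval continuous_intros)
    \<comment> \<open>M \<le> 5 * X, and 1 + 36 * 5 = 181.\<close>
    have bound: "integral {X..2 * X} (\<lambda>t. (norm (?W m t))\<^sup>2) \<le> 181 * X * (1 + ln (real M))" for m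
    proof -
      have "integral {X..2 * X} (\<lambda>t. (norm (?W m t))\<^sup>2) \<le> ((2 * X - X) + 36 * real M) * (1 + ln (real M))"
        by (rule mean_square_half_line) (use M X in auto)
      also have "\<dots> \<le> (181 * X) * (1 + ln (real M))" using M X by (intro mult_right_mono) auto
      finally show ?thesis .
    qed
    have "integral {X..2 * X} (\<lambda>t. (norm (double_zeta (Complex \<sigma>1 t) (Complex (1/2) t)))\<^sup>2)
       \<le> integral {X..2 * X} (\<lambda>t. (\<Sum>m=1..<N. 4 * Z * ?w m * (norm (?W m t))\<^sup>2) + E)"
      using X by (intro integral_le integrable_double_zeta_sq integrable_add IS pt) auto
    also have "\<dots> = integral {X..2 * X} (\<lambda>t. \<Sum>m=1..<N. 4 * Z * ?w m * (norm (?W m t))\<^sup>2) + E * X"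
      using X by (subst integral_add[OF IS]) auto
    also have "integral {X..2 * X} (\<lambda>t. \<Sum>m=1..<N. 4 * Z * ?w m * (norm (?W m t))\<^sup>2) =
       (\<Sum>m=1..<N. 4 * Z * ?w m * integral {X..2 * X} (\<lambda>t. (norm (?W m t))\<^sup>2))"
      by (subst integral_sum) (use IW' in auto)
    also have "\<dots> \<le> (\<Sum>m=1..<N. 4 * Z * ?w m * (181 * X * (1 + ln (real M))))"
      using Z0 by (intro sum_mono mult_left_mono bound) auto
    also have "\<dots> = 4 * Z * (181 * X * (1 + ln (real M))) * (\<Sum>m=1..<N. ?w m)"
      unfolding sum_distrib_left by (intro sum.cong) (simp_all add: mult_ac)
    also have "\<dots> \<le> 4 * Z * (181 * X * (1 + ln (real M))) * Z"
      using Z Z0 X M by (intro mult_left_mono mult_nonneg_nonneg add_nonneg_nonneg) auto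
    also have "\<dots> = 4 * Z\<^sup>2 * 181 * X * (1 + ln (real M))" by (simp add: power2_eq_square)
    also have "\<dots> \<le> 4 * Z\<^sup>2 * 181 * X * ((1 / ln 2 + 4) * ln X)"
      using X by (intro mult_left_mono lM) auto
    also have "E * X \<le> E * X * (ln X / ln 2)"
      using mult_left_mono[OF lX1, of "E * X"] E0 X by simp
    finally have "integral {X..2 * X} (\<lambda>t. (norm (double_zeta (Complex \<sigma>1 t) (Complex (1/2) t)))\<^sup>2)
       \<le> 4 * Z\<^sup>2 * 181 * X * ((1 / ln 2 + 4) * ln X) + E * X * (ln X / ln 2)"
      by simp
    also have "\<dots> = C * (X * ln X)"
      unfolding C_def distrib_right[of "4 * Z\<^sup>2 * 181 * (1 / ln 2 + 4)" "E / ln 2"] by simp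
    finally show ?thesis .
  qed
  ultimately show ?thesis by blast
qed

section \<open>Lower bound on the critical line\<close>

lemma bilinear_off_diagonal_le:
  assumes K: "finite K" "0 \<notin> K" and L: "L \<subseteq> {1..Y}"
  shows "(\<Sum>k\<in>K. \<Sum>l\<in>L - {k}. \<bar>c k\<bar> * \<bar>d l\<bar> * (2 / \<bar>ln (real k) - ln (real l)\<bar>))
    \<le> 2 * (1 + real Y) * ((\<Sum>k\<in>K. \<bar>c k\<bar>) * (\<Sum>l\<in>L. \<bar>d l\<bar>))"
proof -
  have finL: "finite L" using L finite_subset by auto
  \<comment> \<open>The smaller of k and l is at most \<open>Y\<close> and their distance is at
    least 1, so the length of \<open>K\<close> does not enter. The bound is wasteful, which a short
    second polynomial can afford.\<close>
  have pair: "\<bar>c k\<bar> * \<bar>d l\<bar> * (2 / \<bar>ln (real k) - ln (real l)\<bar>) \<le> 2 * (1 + real Y) * (\<bar>c k\<bar> * \<bar>d l\<bar>)"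
    if kl: "k \<in> K" "l \<in> L - {k}" for k l
  proof -
    have pos: "0 < k" "0 < l" "l \<le> Y" "k \<noteq> l" using kl K L by (auto intro: gr0I)
    have frac: "real i / real (j - i) \<le> real i" if "i < j" for i j :: nat
    proof -
      have "real i / real (j - i) \<le> real i / 1" using that by (intro divide_left_mono) auto
      then show ?thesis by simp
    qed
    have "1 / \<bar>ln (real k) - ln (real l)\<bar> \<le> 1 + real Y"
    proof (cases "k < l")
      case True
      have "real k \<le> real Y" using True pos by simp
      then have "1 + real k / real (l - k) \<le> 1 + real Y"
        using frac[OF True] by (intro add_left_mono) (rule order_trans)
      with inverse_ln_diff_le(1)[OF pos(1) True] show ?thesis by (rule order_trans)
    next
      case False
      then have lk: "l < k" using pos by simp
      have "real l \<le> real Y" using pos by simp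
      then have "1 + real l / real (k - l) \<le> 1 + real Y"
        using frac[OF lk] by (intro add_left_mono) (rule order_trans)
      with inverse_ln_diff_le(2)[OF pos(2) lk] show ?thesis by (rule order_trans)
    qed
    then have "2 * (\<bar>c k\<bar> * \<bar>d l\<bar>) * (1 / \<bar>ln (real k) - ln (real l)\<bar>) \<le> 2 * (\<bar>c k\<bar> * \<bar>d l\<bar>) * (1 + real Y)"
      by (intro mult_left_mono) auto
    then show ?thesis by (simp add: mult_ac)
  qed
  have "(\<Sum>k\<in>K. \<Sum>l\<in>L - {k}. \<bar>c k\<bar> * \<bar>d l\<bar> * (2 / \<bar>ln (real k) - ln (real l)\<bar>))
    \<le> (\<Sum>k\<in>K. \<Sum>l\<in>L - {k}. 2 * (1 + real Y) * (\<bar>c k\<bar> * \<bar>d l\<bar>))"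
    by (intro sum_mono pair) auto
  also have "\<dots> \<le> (\<Sum>k\<in>K. \<Sum>l\<in>L. 2 * (1 + real Y) * (\<bar>c k\<bar> * \<bar>d l\<bar>))"
    using finL by (intro sum_mono sum_mono2) auto
  also have "\<dots> = 2 * (1 + real Y) * ((\<Sum>k\<in>K. \<bar>c k\<bar>) * (\<Sum>l\<in>L. \<bar>d l\<bar>))"
    unfolding sum_product by (simp only: sum_distrib_left)
  finally show ?thesis .
qed

text \<open>Nonnegativity of the squared distance from z to a gives a lower bound that is linear in
  z, so that z may be replaced by its approximation d and integrated against a.\<close>

lemma norm_sq_ge_inner:
  fixes z d a :: complex
  assumes "norm (z - d) \<le> r" "norm a \<le> y" "0 \<le> r"
  shows "2 * Re (d * cnj a) - 2 * (r * y) - (norm a)\<^sup>2 \<le> (norm z)\<^sup>2"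
proof -
  have "0 \<le> (Re z - Re a)\<^sup>2 + (Im z - Im a)\<^sup>2" by simp
  then have "2 * Re (z * cnj a) - (norm a)\<^sup>2 \<le> (norm z)\<^sup>2"
    by (simp add: cmod_power2 power2_diff algebra_simps)
  moreover have "Re (d * cnj a) - r * y \<le> Re (z * cnj a)"
  proof -
    have "Re ((d - z) * cnj a) \<le> norm ((d - z) * cnj a)" by (rule complex_Re_le_cmod)
    also have "\<dots> = norm (z - d) * norm a" by (simp add: norm_mult norm_minus_commute)
    also have "\<dots> \<le> r * y" using assms by (intro mult_mono) auto
    finally show ?thesis by (simp add: algebra_simps)
  qed
  ultimately show ?thesis by linarith
qed

text \<open>The coefficient of \<open>?D\<close> at k in {2..Y} is at least k powr (-1/2), from the
  pair (1, k) alone. So pairing with \<open>?A\<close> gives at least X * h and the mean square of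
  \<open>?A\<close> is at most X * h, each up to O(X); twice the first minus the second leaves X *
  h, with h at least ln X / 64 - 1. Index 1 is left out of \<open>?A\<close> since no pair has
  product 1.\<close>

lemma mean_square_critical_lower:
  assumes \<sigma>: "1 < \<sigma>1"
  shows "\<exists>C. \<forall>X\<ge>2. X * (ln X / 64 - C) \<le> integral {X..2 * X} (\<lambda>t. (norm (double_zeta (Complex \<sigma>1 t) (Complex (1/2) t)))\<^sup>2)"
proof -
  obtain K where K: "0 \<le> K" "\<And>X t N. 2 \<le> X \<Longrightarrow> X \<le> t \<Longrightarrow> t \<le> 2 * X \<Longrightarrow> X powr (1 + 1/4) \<le> real N \<Longrightarrow> real N \<le> 2 * X powr (1 + 1/4) \<Longrightarrow>
     norm (double_zeta (Complex \<sigma>1 t) (Complex (1/2) t) - dz_partial N (Complex \<sigma>1 t) (Complex (1/2) t))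
       \<le> K * X powr ((1 + 1/4) * (2 - 1 - 1/2 + 1/4) - 1)"
    using double_zeta_approximation_error[of 1 \<sigma>1 "1/2" "1/4"] \<sigma> by auto
  obtain H where H: "H > 0" "\<And>N. 1 \<le> N \<Longrightarrow> harm N \<le> H * real N powr (1/32)"
    using harm_le_powr[of "1/32"] by auto
  \<comment> \<open>The constant in the coefficient sum: the squared harmonic bound, and N \<le> 2 *
    X powr (5/4) raised to 9/16 = 1/2 + 2/32.\<close>
  define B where "B = H\<^sup>2 * 2 powr (9/16)"
  have B0: "0 \<le> B" by (simp add: B_def)
  \<comment> \<open>Collected from the end: 1 from comparing h with ln y, 8 * B from twice the
    off-diagonal pairing, 2 * K from the approximation error, 4 from the mean square of
    \<open>?A\<close>.\<close>
  define C where "C = 1 + 8 * B + 2 * K + 4"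
  have "X * (ln X / 64 - C) \<le> integral {X..2 * X} (\<lambda>t. (norm (double_zeta (Complex \<sigma>1 t) (Complex (1/2) t)))\<^sup>2)"
    if X: "2 \<le> X" for X
  proof -
    obtain N where N: "X powr (1 + 1/4) \<le> real N" "real N \<le> 2 * X powr (1 + 1/4)" "X \<le> real N" "1 \<le> N"
      using dyadic_length[OF X, of "1/4"] by auto
    \<comment> \<open>The exponent 1/64 keeps three errors O(X): X powr (45/64 + 2/64) from the
      pairing, X powr (3/64) from the mean square of \<open>?A\<close>, and X times X powr (-1/16 +
      1/64) from the approximation.\<close>
    define y where "y = X powr (1/64)"
    define Y where "Y = nat \<lfloor>y\<rfloor>"
    have y1: "1 \<le> y" unfolding y_def using X by (intro ge_one_powr_ge_zero) auto
    have Y: "real Y \<le> y" "y < real Y + 1" "1 \<le> Y" using y1 unfolding Y_def by linarith+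
    have "y < X" unfolding y_def using X powr_less_mono[of "1/64" 1 X] by simp
    then have YN: "Y < N" using Y N by linarith
    have yp: "y ^ k = X powr (real k / 64)" for k
      unfolding y_def using X by (simp add: powr_powr powr_realpow[symmetric])
    have pX: "X powr a \<le> X" if "a \<le> 1" for a using X powr_mono[OF that, of X] by simp
    let ?a = "\<lambda>n. real n powr (-1/2)"
    let ?c = "trunc_coeff N \<sigma>1 (1/2)"
    let ?A = "dirichlet_poly {2..Y} ?a"
    let ?D = "\<lambda>t. dz_partial N (Complex \<sigma>1 t) (Complex (1/2) t)" and ?Z = "\<lambda>t. double_zeta (Complex \<sigma>1 t) (Complex (1/2) t)"
    define h where "h = (\<Sum>k=2..Y. inverse (real k))"
    have sqa: "?a n * ?a n = inverse (real n)" for n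
    proof -
      have "?a n * ?a n = real n powr (-1/2 + -1/2)" by (simp only: powr_add)
      also have "\<dots> = real n powr (-1)" by simp
      finally show ?thesis by (simp only: powr_minus) simp
    qed
    have suma: "(\<Sum>n=2..Y. \<bar>?a n\<bar>) \<le> y"
    proof -
      have "(\<Sum>n=2..Y. \<bar>?a n\<bar>) \<le> (\<Sum>n=2..Y. 1)"
      proof (rule sum_mono)
        fix n assume "n \<in> {2..Y}"
        then have "?a n \<le> real n powr 0" by (intro powr_mono) auto
        then show "\<bar>?a n\<bar> \<le> 1" using \<open>n \<in> {2..Y}\<close> by simp
      qed
      also have "\<dots> \<le> y" using Y by simp
      finally show ?thesis .
    qed
    have sumc: "(\<Sum>k=1..N\<^sup>2. \<bar>?c k\<bar>) \<le> B * X powr (45/64)"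
    proof -
      have "(\<Sum>k=1..N\<^sup>2. \<bar>?c k\<bar>) = (\<Sum>k=1..N\<^sup>2. ?c k)" by (simp add: trunc_coeff_nonneg)
      also have "\<dots> \<le> (harm N)\<^sup>2 * real N powr (2 - 1 - 1/2)"
        unfolding sum_trunc_coeff using \<sigma> by (intro sum_pair_weight_le) auto
      also have "\<dots> \<le> (H * real N powr (1/32))\<^sup>2 * real N powr (2 - 1 - 1/2)"
        using H(2)[OF N(4)] by (intro mult_right_mono power_mono) (auto simp: harm_nonneg)
      also have "\<dots> = H\<^sup>2 * (real N powr (1/32) * real N powr (1/32) * real N powr (2 - 1 - 1/2))"
        by (simp add: power2_eq_square)
      also have "real N powr (1/32) * real N powr (1/32) * real N powr (2 - 1 - 1/2) = real N powr (9/16)"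
        by (simp only: powr_add[symmetric]) simp
      also have "H\<^sup>2 * real N powr (9/16) \<le> H\<^sup>2 * (2 * X powr (1 + 1/4)) powr (9/16)"
        using N by (intro mult_left_mono powr_mono2) auto
      also have "\<dots> = B * X powr (45/64)" using X by (simp add: B_def powr_mult powr_powr)
      finally show ?thesis .
    qed
    have c_ge: "?a k \<le> ?c k" if "k \<in> {2..Y}" for k
    proof -
      have "?a k = (\<Sum>x\<in>{(1, k)}. pair_weight \<sigma>1 (1/2) x)" by (simp add: pair_weight_def)
      also have "\<dots> \<le> box_coeff \<sigma>1 (1/2) k"
        unfolding box_coeff_eq using that
        by (intro sum_mono2 finite_factor_pairs pair_weight_nonneg) (auto simp: factor_pairs_def)
      also have "\<dots> = ?c k" using that YN by (intro trunc_coeff_eq_box_coeff[symmetric]) auto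
      finally show ?thesis .
    qed
    have main: "X * h - 4 * B * X \<le> Re (integral {X..2 * X} (\<lambda>t. ?D t * cnj (?A t)))"
    proof -
      let ?J = "integral {X..2 * X} (\<lambda>t. ?D t * cnj (?A t))"
      have YNN: "Y \<le> N\<^sup>2"
        unfolding power2_eq_square by (rule order_trans[OF less_imp_le[OF YN] le_square])
      then have inter: "{1..N\<^sup>2} \<inter> {2..Y} = {2..Y}" by auto
      have "norm (?J - of_real ((2 * X - X) * (\<Sum>k\<in>{1..N\<^sup>2} \<inter> {2..Y}. ?c k * ?a k)))
         \<le> 2 * (1 + real Y) * ((\<Sum>k=1..N\<^sup>2. \<bar>?c k\<bar>) * (\<Sum>l=2..Y. \<bar>?a l\<bar>))"
        unfolding dz_partial_eq_dirichlet_poly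
        by (rule order_trans[OF dirichlet_poly_inner_product bilinear_off_diagonal_le]) (use X in auto)
      also have "\<dots> \<le> 2 * (2 * y) * ((B * X powr (45/64)) * y)"
        using Y y1 sumc suma B0 by (intro mult_mono mult_left_mono sum_nonneg mult_nonneg_nonneg) auto
      also have "\<dots> = 4 * B * (X powr (45/64) * y ^ 2)" by (simp add: power2_eq_square)
      also have "X powr (45/64) * y ^ 2 = X powr (45/64 + 2/64)" by (simp only: yp powr_add) simp
      also have "4 * B * X powr (45/64 + 2/64) \<le> 4 * B * X" using B0 by (intro mult_left_mono pX) auto
      finally have "norm (?J - of_real (X * (\<Sum>k=2..Y. ?c k * ?a k))) \<le> 4 * B * X" unfolding inter by simp
      then have "X * (\<Sum>k=2..Y. ?c k * ?a k) - 4 * B * X \<le> Re ?J"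
        using abs_Re_le_cmod[of "?J - of_real (X * (\<Sum>k=2..Y. ?c k * ?a k))"] by simp
      moreover have "h \<le> (\<Sum>k=2..Y. ?c k * ?a k)"
        unfolding h_def using c_ge by (intro sum_mono) (simp add: mult_right_mono flip: sqa)
      then have "X * h \<le> X * (\<Sum>k=2..Y. ?c k * ?a k)" using X by (intro mult_left_mono) auto
      ultimately show ?thesis by linarith
    qed
    have A2: "integral {X..2 * X} (\<lambda>t. (norm (?A t))\<^sup>2) \<le> X * h + 4 * X"
    proof -
      have "\<bar>integral {X..2 * X} (\<lambda>t. (norm (?A t))\<^sup>2) - (2 * X - X) * (\<Sum>k=2..Y. (?a k)\<^sup>2)\<bar>
         \<le> 2 * (1 + real Y) * ((\<Sum>k=2..Y. \<bar>?a k\<bar>) * (\<Sum>l=2..Y. \<bar>?a l\<bar>))"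
        by (rule order_trans[OF dirichlet_poly_mean_square bilinear_off_diagonal_le]) (use X in auto)
      also have "\<dots> \<le> 2 * (2 * y) * (y * y)"
        using Y y1 suma by (intro mult_mono mult_left_mono sum_nonneg mult_nonneg_nonneg) auto
      also have "\<dots> = 4 * y ^ 3" by (simp add: power3_eq_cube)
      also have "\<dots> \<le> 4 * X" unfolding yp by (intro mult_left_mono pX) auto
      finally have "\<bar>integral {X..2 * X} (\<lambda>t. (norm (?A t))\<^sup>2) - X * h\<bar> \<le> 4 * X"
        by (simp only: power2_eq_square sqa h_def) simp
      then show ?thesis by linarith
    qed
    define r where "r = K * X powr (-1/16)"
    have r0: "0 \<le> r" using K(1) by (simp add: r_def)
    have ry: "r * y \<le> K"
    proof -
      have "r * y = K * (X powr (-1/16) * X powr (1/64))" by (simp add: r_def y_def)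
      also have "X powr (-1/16) * X powr (1/64) = X powr (-1/16 + 1/64)" by (simp only: powr_add)
      also have "\<dots> \<le> X powr 0" using X by (intro powr_mono) auto
      finally show ?thesis using X K(1) by (simp add: mult_left_mono mult_left_le)
    qed
    have Ay: "norm (?A t) \<le> y" for t
      by (rule order_trans[OF norm_dirichlet_poly_le suma])
    have pt: "2 * Re (?D t * cnj (?A t)) - 2 * (r * y) - (norm (?A t))\<^sup>2 \<le> (norm (?Z t))\<^sup>2"
      if t: "t \<in> {X..2 * X}" for t
    proof (rule norm_sq_ge_inner[OF _ Ay r0])
      have "norm (?Z t - ?D t) \<le> K * X powr ((1 + 1/4) * (2 - 1 - 1/2 + 1/4) - 1)"
        using t X N by (intro K(2)) auto
      also have "(1 + 1/4) * (2 - 1 - 1/2 + 1/4) - 1 = - (1/16 :: real)" by simp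
      finally show "norm (?Z t - ?D t) \<le> r" by (simp add: r_def)
    qed
    have cD: "continuous_on {X..2 * X} (\<lambda>t. ?D t * cnj (?A t))"
      by (intro continuous_intros continuous_on_dz_partial_vertical)
    have ID: "(\<lambda>t. ?D t * cnj (?A t)) integrable_on {X..2 * X}"
      by (rule integrable_continuous_interval[OF cD])
    have IRe: "((\<lambda>t. Re (?D t * cnj (?A t))) has_integral Re (integral {X..2 * X} (\<lambda>t. ?D t * cnj (?A t)))) {X..2 * X}"
      using has_integral_linear[OF integrable_integral[OF ID] bounded_linear_Re] by (simp only: o_def)
    have IA: "((\<lambda>t. (norm (?A t))\<^sup>2) has_integral integral {X..2 * X} (\<lambda>t. (norm (?A t))\<^sup>2)) {X..2 * X}"
      by (intro integrable_integral integrable_continuous_interval continuous_intros)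
    have Ic: "((\<lambda>t. 2 * (r * y)) has_integral (2 * (r * y)) * X) {X..2 * X}"
      using has_integral_const_real[of "2 * (r * y)" X "2 * X"] X by (simp add: mult.commute)
    have "2 * Re (integral {X..2 * X} (\<lambda>t. ?D t * cnj (?A t))) - (2 * (r * y)) * X - integral {X..2 * X} (\<lambda>t. (norm (?A t))\<^sup>2)
        \<le> integral {X..2 * X} (\<lambda>t. (norm (?Z t))\<^sup>2)"
      by (rule has_integral_le[OF has_integral_diff[OF has_integral_diff[OF has_integral_mult_right[OF IRe] Ic] IA]
          integrable_integral[OF integrable_double_zeta_sq] pt]) (use X in auto)
    note lower = this
    have ryX: "(2 * (r * y)) * X \<le> 2 * K * X" using ry X by (intro mult_right_mono) auto
    have arith: "2 * (p - q) - u - (p + w) \<le> z"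
      if "2 * a - v - c \<le> z" "v \<le> u" "p - q \<le> a" "c \<le> p + w" for a c p q u v w z :: real
    proof -
      have "2 * (p - q) \<le> 2 * a" using that(3) by simp
      then have "2 * (p - q) - u - (p + w) \<le> 2 * a - v - c" using that(2,4) by (intro diff_mono) auto
      then show ?thesis using that(1) by (rule order_trans)
    qed
    have low: "2 * (X * h - 4 * B * X) - 2 * K * X - (X * h + 4 * X) \<le> integral {X..2 * X} (\<lambda>t. (norm (?Z t))\<^sup>2)"
      by (rule arith[OF lower ryX main A2])
    have "ln X / 64 - 1 \<le> h"
    proof -
      have "ln X / 64 = ln y" using X by (simp add: y_def ln_powr)
      also have "\<dots> \<le> ln (real Y + 1)" using Y y1 by (intro ln_mono) auto
      also have "\<dots> \<le> harm Y" by (rule ln_le_harm)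
      also have "harm Y = 1 + h"
        unfolding h_def harm_def using Y(3) sum.atLeast_Suc_atMost[of "Suc 0" Y "\<lambda>k. inverse (real k)"]
        by (simp add: numeral_2_eq_2)
      finally show ?thesis by simp
    qed
    then have "X * (ln X / 64 - 1) \<le> X * h" using X by (intro mult_left_mono) auto
    moreover have "X * (ln X / 64 - C) = X * (ln X / 64 - 1) - (8 * B * X + 2 * K * X + 4 * X)"
      by (simp add: C_def algebra_simps)
    moreover have "2 * (X * h - 4 * B * X) - 2 * K * X - (X * h + 4 * X) = X * h - (8 * B * X + 2 * K * X + 4 * X)"
      by (simp add: algebra_simps)
    ultimately show ?thesis using low by linarith
  qed
  then show ?thesis by blast
qed

text \<open>The upper bound adds up dyadic blocks with ratio 1/2. For the lower bound the last block
  [T / 2, T] suffices, as the part before it is nonnegative.\<close>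

theorem mean_square_critical:
  assumes \<sigma>: "1 < \<sigma>1"
  shows "double_zeta_mean_square \<sigma>1 (1/2) \<in> \<Theta>[at_top](\<lambda>T. T * ln T)"
proof -
  let ?I = "double_zeta_mean_square \<sigma>1 (1/2)"
  let ?Q = "\<lambda>X. integral {X..2 * X} (\<lambda>t. (norm (double_zeta (Complex \<sigma>1 t) (Complex (1/2) t)))\<^sup>2)"
  have split: "?I T = ?I (T / 2) + ?Q (T / 2)" if "4 \<le> T" for T
    using double_zeta_mean_square_split[of "T / 2" T \<sigma>1 "1/2"] that by simp
  obtain C where C: "0 \<le> C" "\<And>X. 2 \<le> X \<Longrightarrow> ?Q X \<le> C * (X * ln X)"
    using mean_square_critical_upper[OF \<sigma>] by blast
  have "\<exists>K\<ge>0. \<forall>T\<ge>2. \<bar>?I T\<bar> \<le> K * (T * ln T)"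
  proof (rule dyadic_accumulation[where q = "1/2" and c = "2 * ln 2" and C = C and ?C0.0 = "?I 4"])
    fix T :: real assume T: "2 \<le> T" "T \<le> 4"
    then show "\<bar>?I T\<bar> \<le> ?I 4"
      using double_zeta_mean_square_mono[of T 4] double_zeta_mean_square_nonneg[of \<sigma>1 "1/2" T] by simp
  next
    fix T :: real assume T: "4 \<le> T"
    have half: "T / 2 * ln (T / 2) \<le> 1 / 2 * (T * ln T)"
      using T mult_left_mono[of "ln (T / 2)" "ln T" "T / 2"] by simp
    show "T / 2 * ln (T / 2) \<le> 1 / 2 * (T * ln T)" by (rule half)
    have Q0: "0 \<le> ?Q (T / 2)" using T by (intro integral_nonneg integrable_double_zeta_sq) auto
    have "?Q (T / 2) \<le> C * (T / 2 * ln (T / 2))" using T by (intro C(2)) auto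
    also have "\<dots> \<le> C * (T * ln T)"
    proof (rule mult_left_mono[OF _ C(1)])
      have "0 \<le> T * ln T" using T by simp
      with half show "T / 2 * ln (T / 2) \<le> T * ln T" by linarith
    qed
    finally show "\<bar>?I T - ?I (T / 2)\<bar> \<le> C * (T * ln T)" using split[OF T] Q0 by simp
  next
    fix T :: real assume "2 \<le> T"
    then show "2 * ln 2 \<le> T * ln T" by (intro mult_mono) auto
  qed (use C(1) double_zeta_mean_square_nonneg in auto)
  then obtain K where K: "\<And>T. 2 \<le> T \<Longrightarrow> \<bar>?I T\<bar> \<le> K * (T * ln T)" by blast
  obtain C' where C': "\<And>X. 2 \<le> X \<Longrightarrow> X * (ln X / 64 - C') \<le> ?Q X"
    using mean_square_critical_lower[OF \<sigma>] by blast
  show ?thesis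
  proof (rule bigthetaI)
    show "?I \<in> O(\<lambda>T. T * ln T)"
    proof (rule bigoI)
      show "\<forall>\<^sub>F T in at_top. norm (?I T) \<le> K * norm (T * ln T)"
        using eventually_ge_at_top[of 2] by eventually_elim (use K in \<open>simp add: abs_mult\<close>)
    qed
    show "?I \<in> \<Omega>(\<lambda>T. T * ln T)"
    proof (rule landau_omega.bigI)
      \<comment> \<open>Half of the coefficient 1/64 pays for the constants once T is large, and the
        block has length T / 2; so 1/256 = 1/128 * 1/2.\<close>
      show "(0::real) < 1/256" by simp
      have "\<forall>\<^sub>F T in at_top. 128 * (ln 2 / 64 + C') \<le> ln (T :: real)"
        using ln_at_top by (simp add: filterlim_at_top)
      then show "\<forall>\<^sub>F T in at_top. 1/256 * norm (T * ln T) \<le> norm (?I T)"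
        using eventually_ge_at_top[of 4]
      proof eventually_elim
        case (elim T)
        have "ln (T / 2) = ln T - ln 2" using elim by (simp add: ln_div)
        moreover have "a / 128 \<le> (a - b) / 64 - c" if "128 * (b / 64 + c) \<le> a" for a b c :: real
          using that by (simp add: field_simps)
        ultimately have "ln T / 128 \<le> ln (T / 2) / 64 - C'" using elim(1) by presburger
        then have "T / 2 * (ln T / 128) \<le> T / 2 * (ln (T / 2) / 64 - C')" using elim by (intro mult_left_mono) auto
        also have "\<dots> \<le> ?Q (T / 2)" using elim by (intro C') auto
        also have "\<dots> \<le> ?I T" using split[of T] elim double_zeta_mean_square_nonneg[of \<sigma>1 "1/2" "T / 2"] by simp
        finally have "1/256 * (T * ln T) \<le> ?I T" by simp
        then show ?case using elim double_zeta_mean_square_nonneg[of \<sigma>1 "1/2" T] by (simp add: abs_mult)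
      qed
    qed
  qed
qed

theorem theorem1p3:
  fixes \<sigma>1 \<sigma>2 :: real
  shows
    "((\<lambda>k. (box_coeff \<sigma>1 \<sigma>2 k)\<^sup>2) summable_on {2..} \<longleftrightarrow> \<sigma>2 > 1/2 \<and> \<sigma>1 + \<sigma>2 > 1)
     \<and> (\<sigma>2 > 1 \<and> \<sigma>1 + \<sigma>2 > 2 \<longrightarrow>
          (\<exists>C. \<forall>T\<ge>2. \<bar>double_zeta_mean_square \<sigma>1 \<sigma>2 T - double_zeta_box \<sigma>1 \<sigma>2 * T\<bar> \<le> C))
     \<and> (\<sigma>1 > 1 \<and> 1/2 < \<sigma>2 \<and> \<sigma>2 \<le> 1 \<longrightarrow>
          (\<exists>\<epsilon>\<^sub>0>0. \<forall>\<epsilon>. 0 < \<epsilon> \<and> \<epsilon> < \<epsilon>\<^sub>0 \<longrightarrow>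
            (\<exists>C. \<forall>T\<ge>2. \<bar>double_zeta_mean_square \<sigma>1 \<sigma>2 T - double_zeta_box \<sigma>1 \<sigma>2 * T\<bar>
               \<le> C * (T powr (2 - 2 * \<sigma>2 + \<epsilon>) + T powr (1/2)))))
     \<and> (\<sigma>1 \<le> 1 \<and> 3/2 < \<sigma>1 + \<sigma>2 \<and> \<sigma>1 + \<sigma>2 \<le> 2 \<longrightarrow>
          (\<exists>\<epsilon>\<^sub>0>0. \<forall>\<epsilon>. 0 < \<epsilon> \<and> \<epsilon> < \<epsilon>\<^sub>0 \<longrightarrow>
            (\<exists>C. \<forall>T\<ge>2. \<bar>double_zeta_mean_square \<sigma>1 \<sigma>2 T - double_zeta_box \<sigma>1 \<sigma>2 * T\<bar>
               \<le> C * (T powr (4 - 2 * \<sigma>1 - 2 * \<sigma>2 + \<epsilon>) + T powr (1/2)))))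
     \<and> (\<sigma>1 > 1 \<and> \<sigma>2 = 1/2 \<longrightarrow>
          double_zeta_mean_square \<sigma>1 \<sigma>2 \<in> \<Theta>[at_top](\<lambda>T. T * ln T))"
proof (intro conjI impI)
  show "(\<lambda>k. (box_coeff \<sigma>1 \<sigma>2 k)\<^sup>2) summable_on {2..} \<longleftrightarrow> \<sigma>2 > 1/2 \<and> \<sigma>1 + \<sigma>2 > 1"
  proof
    assume "\<sigma>2 > 1/2 \<and> \<sigma>1 + \<sigma>2 > 1"
    then show "(\<lambda>k. (box_coeff \<sigma>1 \<sigma>2 k)\<^sup>2) summable_on {2..}"
      using has_sum_box_coeff_sq[OF summable_box_coeff_sq] by (auto intro: has_sum_imp_summable)
  qed (rule summable_on_box_coeff_sq_imp)
next
  assume "\<sigma>2 > 1 \<and> \<sigma>1 + \<sigma>2 > 2"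
  then show "\<exists>C. \<forall>T\<ge>2. \<bar>double_zeta_mean_square \<sigma>1 \<sigma>2 T - double_zeta_box \<sigma>1 \<sigma>2 * T\<bar> \<le> C"
    by (intro mean_square_convergent) auto
next
  assume *: "\<sigma>1 > 1 \<and> 1/2 < \<sigma>2 \<and> \<sigma>2 \<le> 1"
  \<comment> \<open>The case \<tau> = 1, with \<open>2 * 1\<close> left unsimplified so that it
    matches the pattern in \<tau>. The bound holds for every \<epsilon> > 0, so the threshold 1
    chosen below is arbitrary.\<close>
  have "\<exists>C. \<forall>T\<ge>2. \<bar>double_zeta_mean_square \<sigma>1 \<sigma>2 T - double_zeta_box \<sigma>1 \<sigma>2 * T\<bar>
               \<le> C * (T powr (4 - 2 * 1 - 2 * \<sigma>2 + \<epsilon>) + T powr (1/2))" if "0 < \<epsilon>" for \<epsilon>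
    using * that by (intro mean_square_asymptotic) auto
  then show "\<exists>\<epsilon>\<^sub>0>0. \<forall>\<epsilon>. 0 < \<epsilon> \<and> \<epsilon> < \<epsilon>\<^sub>0 \<longrightarrow>
            (\<exists>C. \<forall>T\<ge>2. \<bar>double_zeta_mean_square \<sigma>1 \<sigma>2 T - double_zeta_box \<sigma>1 \<sigma>2 * T\<bar>
               \<le> C * (T powr (2 - 2 * \<sigma>2 + \<epsilon>) + T powr (1/2)))"
    by (intro exI[of _ 1]) simp
next
  assume *: "\<sigma>1 \<le> 1 \<and> 3/2 < \<sigma>1 + \<sigma>2 \<and> \<sigma>1 + \<sigma>2 \<le> 2"
  \<comment> \<open>The case \<tau> = \<sigma>1; here \<sigma>1 + \<sigma>2 \<le> 2 is the condition
    that 2 - \<tau> - \<sigma>2 be nonnegative.\<close>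
  have "\<exists>C. \<forall>T\<ge>2. \<bar>double_zeta_mean_square \<sigma>1 \<sigma>2 T - double_zeta_box \<sigma>1 \<sigma>2 * T\<bar>
               \<le> C * (T powr (4 - 2 * \<sigma>1 - 2 * \<sigma>2 + \<epsilon>) + T powr (1/2))" if "0 < \<epsilon>" for \<epsilon>
    using * that by (intro mean_square_asymptotic) auto
  then show "\<exists>\<epsilon>\<^sub>0>0. \<forall>\<epsilon>. 0 < \<epsilon> \<and> \<epsilon> < \<epsilon>\<^sub>0 \<longrightarrow>
            (\<exists>C. \<forall>T\<ge>2. \<bar>double_zeta_mean_square \<sigma>1 \<sigma>2 T - double_zeta_box \<sigma>1 \<sigma>2 * T\<bar>
               \<le> C * (T powr (4 - 2 * \<sigma>1 - 2 * \<sigma>2 + \<epsilon>) + T powr (1/2)))"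
    by (intro exI[of _ 1]) simp
next
  assume "\<sigma>1 > 1 \<and> \<sigma>2 = 1/2"
  then show "double_zeta_mean_square \<sigma>1 \<sigma>2 \<in> \<Theta>[at_top](\<lambda>T. T * ln T)"
    using mean_square_critical by blast
qed

end
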